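(* Let $k_1\ge k_2\ge 2$ be integers and let $A_{k_1k_2-1}^q$ have Chevalley generators $H_i,Y_i^{\pm}$ and Cartan–Weyl elements $H_{ij},Y_{ij}^{\pm}$, with number operator $N$ (all defined in the context). For $1\le s\le k_2-1$ put $$\tilde Z^{\pm s}=\sum_{\mu=1}^{k_1}Y_{(\mu-1)k_2+s}^{\pm}\,q^{\frac12\sum_{\sigma\ne\mu,\,\sigma=1}^{k_1}\mathrm{sign}(\sigma-\mu)H_{(\sigma-1)k_2+s}},\qquad \tilde H^s=\sum_{\mu=1}^{k_1}H_{(\mu-1)k_2+s},$$ and for $1\le\mu\le k_1-1$ put $$\tilde X_\mu^{+}=\sum_{t=\mu k_2+1}^{(\mu+1)k_2}Y_{t-k_2,t}^{+}\,q^{\frac12\sum_{\nu\ne t,\,\nu=\mu k_2+1}^{(\mu+1)k_2}\mathrm{sign}(\nu-t)H_{\nu-k_2,\nu}+\Lambda_t^{+}},$$ $$\tilde X_\mu^{-}=\sum_{t=\mu k_2+1}^{(\mu+1)k_2}Y_{t,t-k_2}^{-}\,q^{\frac12\sum_{\nu\ne t,\,\nu=\mu k_2+1}^{(\mu+1)k_2}\mathrm{sign}(\nu-t)H_{\nu-k_2,\nu}+\Lambda_t^{-}},$$ $$\tilde H_\mu=\sum_{s=(\mu-1)k_2+1}^{\mu k_2}H_{s,s+k_2},\qquad \Lambda_t^{\pm}=\pm\Big(\frac{k_2-1}{k_1k_2}\Big(N+\sum_{\sigma=2}^{k_1k_2}H_{1,\sigma}\Big)-\sum_{\sigma=t-k_2+1}^{t-1}H_{1,\sigma}\Big).$$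 Then these elements, being expressed through the generators of $A_{k_1k_2-1}^q$ (powers $q^{cH_{ij}}$ and $q^{cN}$ being admitted), belong to the algebra $A_{k_1k_2-1}^q$ and, in the $q$-boson realization of $A_{k_1k_2-1}^q$ given in the context, they provide an explicit embedding $A_{k_1-1}^q\oplus A_{k_2-1}^q\subset A_{k_1k_2-1}^q$. That is, in this realization: the elements $\tilde X_\mu^{\pm},\tilde H_\mu$ ($1\le\mu\le k_1-1$) satisfy the defining relations of the Chevalley generators of $A_{k_1-1}^q$; the elements $\tilde Z^{\pm s},\tilde H^s$ ($1\le s\le k_2-1$) satisfy the defining relations of the Chevalley generators of $A_{k_2-1}^q$; and every element of the first family commutes with every element of the second.
   Context: Notation: $q\ne 0$, $q^2\neq 1$, with a fixed logarithm so that $q^x$ makes sense; $[x]_q=\frac{q^x-q^{-x}}{q-q^{-1}}$; $[A,B]_q=AB-qBA$; $\mathrm{sign}(x)=\pm1$ according to the sign of $x\ne0$. The algebra $A_{n-1}^q$ (the $q$-deformation of $sl_n$): it is generated by Chevalley generators $H_i$, $Y_i^{+}$, $Y_i^{-}$ ($1\le i\le n-1$), powers $q^{cH_i}$ being admitted, with defining relations - $[H_i,H_j]=0$, $[H_i,Y_j^{\pm}]=\pm c_{ij}Y_j^{\pm}$, where $c_{ii}=2$, $c_{i,i\pm1}=-1$ and $c_{ij}=0$ otherwise; - $[Y_i^{+},Y_j^{-}]=\delta_{ij}[H_i]_q$; - $[Y_i^{\pm},Y_j^{\pm}]=0$ for $|i-j|\ge 2$; - $(Y_i^{\pm})^2Y_j^{\pm}-(q+q^{-1})Y_i^{\pm}Y_j^{\pm}Y_i^{\pm}+Y_j^{\pm}(Y_i^{\pm})^2=0$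 for $|i-j|=1$. The Cartan–Weyl elements are: $H_{ij}=H_i+H_{i+1}+\dots+H_{j-1}$ for $i<j$, $H_{ji}=-H_{ij}$, $H_{ii}=0$ (so $H_i=H_{i,i+1}$); $Y_{i,i+1}^{+}=Y_i^{+}$, $Y_{i+1,i}^{-}=Y_i^{-}$; $Y_{ij}^{+}=[Y_{ik}^{+},Y_{kj}^{+}]_q$ for $i<k<j$; $Y_{ik}^{-}=[Y_{ij}^{-},Y_{jk}^{-}]_{q^{-1}}$ for $i>j>k$. The $q$-boson algebra $\mathcal{A}_q^{-}(n)$: generated by $a_i^{+},a_i^{-},N_i$ ($1\le i\le n$), powers $q^{cN_i}$ being admitted, with relations $[N_i,N_j]=0$, $[N_i,a_j^{\pm}]=\pm\delta_{ij}a_j^{\pm}$ (and correspondingly $q^{cN_i}a_j^{\pm}=a_j^{\pm}q^{c(N_i\pm\delta_{ij})}$), $[a_i^{\pm},a_j^{\pm}]=0$ for equal signs, $[a_i^{+},a_j^{-}]=0$ for $i\neq j$, $a_i^{-}a_i^{+}-q^{-1}a_i^{+}a_i^{-}=q^{N_i}$, and $a_i^{-}a_i^{+}-q\,a_i^{+}a_i^{-}=q^{-N_i}$. The $q$-boson realization of $A_{n-1}^q$ in $\mathcal{A}_q^{-}(n)$ (used here with $n=k_1k_2$): $H_i=N_i-N_{i+1}$, $Y_i^{+}=a_i^{+}a_{i+1}^{-}$, $Y_i^{-}=a_{i+1}^{+}a_i^{-}$, and in general $$H_{ij}=N_i-N_j,\qquad Y_{ij}^{+}=a_i^{+}a_j^{-}q^{-\sum_{i<k<j}N_k}\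 (i<j),\qquad Y_{ij}^{-}=a_i^{+}a_j^{-}q^{\sum_{j<k<i}N_k}\ (i>j).$$ The operator $N$ is, in this realization, the total number operator $N=\sum_{i=1}^{n}N_i$; it is adjoined to $A_{n-1}^q$ (in general a corresponding operator is to be understood as lying in an extension of $A_{n-1}^q$). *)

theory Defs
  imports Complex_Main "HOL-Library.Poly_Mapping" "HOL-Algebra.QuotRing"
begin

text \<open>
  Words are lists under concatenation, so that finitely supported functions on words with the
  convolution product of \<^theory>\<open>HOL-Library.Poly_Mapping\<close> form the free unital complex algebra.
\<close>

instantiation list :: (type) monoid_add
begin
definition zero_list :: "'a list" where "zero_list = []"
definition plus_list :: "'a list \<Rightarrow> 'a list \<Rightarrow> 'a list" where "plus_list = (@)"
instance by standard (simp_all add: zero_list_def plus_list_def)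
end

type_synonym 'g falg = "'g list \<Rightarrow>\<^sub>0 complex"

definition gen :: "'g \<Rightarrow> 'g falg" where
  "gen g = Poly_Mapping.single [g] 1"

definition scal :: "complex \<Rightarrow> 'g falg" where
  "scal c = Poly_Mapping.single [] c"

text \<open>The unital algebra homomorphism with \<open>gen g \<mapsto> U g\<close>.\<close>
definition fext :: "('g \<Rightarrow> 'h falg) \<Rightarrow> 'g falg \<Rightarrow> 'h falg" where
  "fext U x = (\<Sum>w\<in>Poly_Mapping.keys x. scal (Poly_Mapping.lookup x w) * prod_list (map U w))"

definition free_algebra :: "'g set \<Rightarrow> 'g falg ring" where
  "free_algebra S = \<lparr>carrier = {x. \<forall>w\<in>Poly_Mapping.keys x. set w \<subseteq> S},
     mult = (*), one = 1, zero = 0, add = (+)\<rparr>"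

text \<open>The algebra with generators \<open>S\<close> and relations \<open>r = 0\<close> for \<open>r \<in> R\<close>. Ideals of HOL-Algebra are
  two-sided; \<open>R\<close> is meant to lie in the free algebra on \<open>S\<close>.\<close>
definition presented :: "'g set \<Rightarrow> 'g falg set \<Rightarrow> 'g falg set ring" where
  "presented S R = free_algebra S Quot (Idl\<^bsub>free_algebra S\<^esub> R)"

definition pclass :: "'g set \<Rightarrow> 'g falg set \<Rightarrow> 'g falg \<Rightarrow> 'g falg set" where
  "pclass S R x = (Idl\<^bsub>free_algebra S\<^esub> R) +>\<^bsub>free_algebra S\<^esub> x"

definition comm :: "'a::ring_1 \<Rightarrow> 'a \<Rightarrow> 'a" where
  "comm x y = x * y - y * x"

definition qcomm :: "complex \<Rightarrow> 'g falg \<Rightarrow> 'g falg \<Rightarrow> 'g falg" where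
  "qcomm p x y = x * y - scal p * y * x"

text \<open>Throughout, \<open>h\<close> is the fixed logarithm of \<open>q\<close>.\<close>
definition qp :: "complex \<Rightarrow> complex \<Rightarrow> complex" where
  "qp h x = exp (h * x)"

text \<open>\<open>QH c i\<close> stands for \<open>q\<^bsup>c H\<^sub>i\<^esup>\<close> and \<open>QN c\<close> for \<open>q\<^bsup>c N\<^esup>\<close>. The powers are generators in their own right,
  subject to the rules of exponents and to the exchange relations with the root generators.\<close>
datatype chev = H nat | QH complex nat | Yp nat | Ym nat | NT | QN complex

definition chev_gens :: "nat \<Rightarrow> chev set" where
  "chev_gens m = (\<Union>i\<in>{1..<m}. {H i, Yp i, Ym i} \<union> range (\<lambda>c. QH c i))"

definition cartan :: "nat \<Rightarrow> nat \<Rightarrow> complex" where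
  "cartan i j = (if i = j then 2 else if i = Suc j \<or> j = Suc i then - 1 else 0)"

definition qbracket_H :: "complex \<Rightarrow> nat \<Rightarrow> chev falg" where
  "qbracket_H h i = scal (1 / (qp h 1 - qp h (- 1))) * (gen (QH 1 i) - gen (QH (- 1) i))"

definition serre :: "complex \<Rightarrow> 'g falg \<Rightarrow> 'g falg \<Rightarrow> 'g falg" where
  "serre h x y = x^2 * y - scal (qp h 1 + qp h (- 1)) * x * y * x + y * x^2"

text \<open>The last block makes precise that powers \<open>q\<^bsup>c H\<^sub>i\<^esup>\<close> are admitted.\<close>
definition chev_rels :: "complex \<Rightarrow> nat \<Rightarrow> chev falg set" where
  "chev_rels h m = (\<Union>i\<in>{1..<m}. \<Union>j\<in>{1..<m}.
     {comm (gen (H i)) (gen (H j)),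
      comm (gen (H i)) (gen (Yp j)) - scal (cartan i j) * gen (Yp j),
      comm (gen (H i)) (gen (Ym j)) + scal (cartan i j) * gen (Ym j),
      comm (gen (Yp i)) (gen (Ym j)) - (if i = j then qbracket_H h i else 0)}
     \<union> (if i + 2 \<le> j \<or> j + 2 \<le> i
        then {comm (gen (Yp i)) (gen (Yp j)), comm (gen (Ym i)) (gen (Ym j))} else {})
     \<union> (if i = Suc j \<or> j = Suc i
        then {serre h (gen (Yp i)) (gen (Yp j)), serre h (gen (Ym i)) (gen (Ym j))} else {})
     \<union> {gen (QH 0 i) - 1}
     \<union> (\<Union>c d. {gen (QH c i) * gen (QH d i) - gen (QH (c + d) i),
               comm (gen (QH c i)) (gen (QH d j)),
               comm (gen (QH c i)) (gen (H j)),
               gen (QH c i) * gen (Yp j) - scal (qp h (c * cartan i j)) * gen (Yp j) * gen (QH c i),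
               gen (QH c i) * gen (Ym j) - scal (qp h (- c * cartan i j)) * gen (Ym j) * gen (QH c i)}))"

text \<open>The extension by the number operator, which commutes with everything.\<close>
definition ext_gens :: "nat \<Rightarrow> chev set" where
  "ext_gens m = chev_gens m \<union> {NT} \<union> range QN"

definition ext_rels :: "complex \<Rightarrow> nat \<Rightarrow> chev falg set" where
  "ext_rels h m = chev_rels h m
     \<union> {comm (gen NT) (gen g) | g. g \<in> ext_gens m}
     \<union> {comm (gen (QN c)) (gen g) | c g. g \<in> ext_gens m}
     \<union> {gen (QN 0) - 1}
     \<union> {gen (QN c) * gen (QN d) - gen (QN (c + d)) | c d. True}"

definition ext_alg :: "complex \<Rightarrow> nat \<Rightarrow> chev falg set ring" where
  "ext_alg h m = presented (ext_gens m) (ext_rels h m)"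

definition ext_class :: "complex \<Rightarrow> nat \<Rightarrow> chev falg \<Rightarrow> chev falg set" where
  "ext_class h m = pclass (ext_gens m) (ext_rels h m)"

text \<open>
  A function \<open>f\<close> encodes the linear form \<open>f 0 \<cdot> N + f 1 \<cdot> H\<^sub>1 + \<dots> + f (m - 1) \<cdot> H\<^bsub>m-1\<^esub>\<close>, and
  \<open>cartan_pow m f\<close> is \<open>q\<close> to the power of this form.
\<close>
definition Hform :: "nat \<Rightarrow> nat \<Rightarrow> nat \<Rightarrow> complex" where
  "Hform i j l = (if i \<le> l \<and> l < j then 1 else if j \<le> l \<and> l < i then - 1 else 0)"

definition Nform :: "nat \<Rightarrow> complex" where
  "Nform l = (if l = 0 then 1 else 0)"

definition cartan_pow :: "nat \<Rightarrow> (nat \<Rightarrow> complex) \<Rightarrow> chev falg" where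
  "cartan_pow m f = gen (QN (f 0)) * prod_list (map (\<lambda>i. gen (QH (f i) i)) [1..<m])"

definition Hel :: "nat \<Rightarrow> nat \<Rightarrow> chev falg" where
  "Hel i j = (\<Sum>l\<in>{i..<j}. gen (H l)) - (\<Sum>l\<in>{j..<i}. gen (H l))"

text \<open>\<open>Ypl h i j\<close> is \<open>Y\<^sup>+\<^sub>i\<^sub>j\<close> for \<open>i < j\<close>, and \<open>Ymi h i j\<close> is \<open>Y\<^sup>-\<^sub>i\<^sub>j\<close> for \<open>i > j\<close>. The recursion splits off one
  simple root; by the two \<open>split\<close> lemmas below every other intermediate index gives the same element of
  the algebra.\<close>
primrec Ypl :: "complex \<Rightarrow> nat \<Rightarrow> nat \<Rightarrow> chev falg" where
  "Ypl h i 0 = 0"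
| "Ypl h i (Suc j) = (if i = j then gen (Yp i)
     else if i < j then qcomm (qp h 1) (Ypl h i j) (gen (Yp j)) else 0)"

primrec Ymi :: "complex \<Rightarrow> nat \<Rightarrow> nat \<Rightarrow> chev falg" where
  "Ymi h 0 j = 0"
| "Ymi h (Suc i) j = (if i = j then gen (Ym i)
     else if j < i then qcomm (qp h (- 1)) (gen (Ym i)) (Ymi h i j) else 0)"

lemma one_falg: "(1 :: 'g falg) = Poly_Mapping.single [] 1"
  by (simp add: zero_list_def[symmetric])

lemma scal_comm: "scal c * x = x * scal c"
proof (induction x rule: update_induct)
  case (update f k v)
  have "Poly_Mapping.update k v f = f + Poly_Mapping.single k v"
    using update(1)
    by (intro poly_mapping_eqI)
       (auto simp: lookup_update lookup_add lookup_single when_def in_keys_iff)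
  moreover have "scal c * Poly_Mapping.single k v = Poly_Mapping.single k v * scal c"
    by (simp add: scal_def mult_single plus_list_def mult.commute)
  ultimately show ?case
    using update by (simp add: algebra_simps)
qed simp

abbreviation fcarrier :: "'g set \<Rightarrow> 'g falg set" where
  "fcarrier S \<equiv> carrier (free_algebra S)"

lemma free_algebra_simps [simp]:
  "mult (free_algebra S) = (*)" "one (free_algebra S) = 1"
  "zero (free_algebra S) = 0" "add (free_algebra S) = (+)"
  by (simp_all add: free_algebra_def)

lemma fcarrier_iff: "x \<in> fcarrier S \<longleftrightarrow> (\<forall>w\<in>Poly_Mapping.keys x. set w \<subseteq> S)"
  by (simp add: free_algebra_def)

lemma fcarrier_closed:
  "gen g \<in> fcarrier S \<longleftrightarrow> g \<in> S" "scal c \<in> fcarrier S" "0 \<in> fcarrier S" "1 \<in> fcarrier S"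
  "x \<in> fcarrier S \<Longrightarrow> y \<in> fcarrier S \<Longrightarrow> x + y \<in> fcarrier S"
  "x \<in> fcarrier S \<Longrightarrow> - x \<in> fcarrier S"
  "x \<in> fcarrier S \<Longrightarrow> y \<in> fcarrier S \<Longrightarrow> x * y \<in> fcarrier S"
proof -
  show "x * y \<in> fcarrier S" if "x \<in> fcarrier S" "y \<in> fcarrier S"
    using keys_mult[of x y] that by (fastforce simp: fcarrier_iff plus_list_def)
  show "x + y \<in> fcarrier S" if "x \<in> fcarrier S" "y \<in> fcarrier S"
    using keys_add[of x y] that by (fastforce simp: fcarrier_iff)
qed (auto simp: fcarrier_iff gen_def scal_def one_falg)

lemma fcarrier_closed':
  assumes "x \<in> fcarrier S" "y \<in> fcarrier S"
  shows "x - y \<in> fcarrier S" "comm x y \<in> fcarrier S" "qcomm p x y \<in> fcarrier S"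
proof -
  have d: "a - b \<in> fcarrier S" if "a \<in> fcarrier S" "b \<in> fcarrier S" for a b
    using that fcarrier_closed(5)[of a S "- b"] fcarrier_closed(6)[of b S] by simp
  show "x - y \<in> fcarrier S" "comm x y \<in> fcarrier S" "qcomm p x y \<in> fcarrier S"
    using assms unfolding comm_def qcomm_def by (auto intro!: d fcarrier_closed)
qed

lemma ring_free_algebra: "ring (free_algebra S)"
proof (rule ringI)
  show "abelian_group (free_algebra S)"
  proof (rule abelian_groupI)
    fix x assume x: "x \<in> fcarrier S"
    show "\<exists>y\<in>fcarrier S. y \<oplus>\<^bsub>free_algebra S\<^esub> x = \<zero>\<^bsub>free_algebra S\<^esub>"
      using x by (intro bexI[of _ "- x"]) (auto intro: fcarrier_closed)
  qed (auto intro: fcarrier_closed simp: ac_simps)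
  show "monoid (free_algebra S)"
    by (rule monoidI) (auto intro: fcarrier_closed simp: mult.assoc)
qed (auto simp: algebra_simps)

lemma ext_gens_mem:
  "H i \<in> ext_gens m \<longleftrightarrow> 1 \<le> i \<and> i < m" "QH c i \<in> ext_gens m \<longleftrightarrow> 1 \<le> i \<and> i < m"
  "Yp i \<in> ext_gens m \<longleftrightarrow> 1 \<le> i \<and> i < m" "Ym i \<in> ext_gens m \<longleftrightarrow> 1 \<le> i \<and> i < m"
  "NT \<in> ext_gens m" "QN c \<in> ext_gens m"
  by (auto simp: ext_gens_def chev_gens_def image_iff)

lemma ext_rels_fcarrier: "ext_rels h m \<subseteq> fcarrier (ext_gens m)"
proof -
  note [intro!] = fcarrier_closed(2-7) fcarrier_closed' fcarrier_closed(1)[THEN iffD2]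
  have "chev_rels h m \<subseteq> fcarrier (ext_gens m)"
    unfolding chev_rels_def serre_def qbracket_H_def power2_eq_square
    by (intro UN_least Un_least insert_subsetI) (auto simp: ext_gens_mem)
  then show ?thesis
    unfolding ext_rels_def by (auto simp: ext_gens_mem)
qed

locale relators =
  fixes S :: "'g set" and R :: "'g falg set"
  assumes R: "R \<subseteq> fcarrier S"
begin

abbreviation J where "J \<equiv> Idl\<^bsub>free_algebra S\<^esub> R"

sublocale fa: ring "free_algebra S"
  by (rule ring_free_algebra)

sublocale id: ideal J "free_algebra S"
  using fa.genideal_ideal R by blast

lemma rel: "r \<in> R \<Longrightarrow> r \<in> J"
  using fa.genideal_self[OF R] by blast

lemma J_carrier: "x \<in> J \<Longrightarrow> x \<in> fcarrier S"
  using id.a_subset by blast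

lemma J_0: "0 \<in> J"
  using id.zero_closed by simp

lemma J_add: "x \<in> J \<Longrightarrow> y \<in> J \<Longrightarrow> x + y \<in> J"
  using id.a_closed by simp

lemma J_left: "x \<in> J \<Longrightarrow> a \<in> fcarrier S \<Longrightarrow> a * x \<in> J"
  using id.I_l_closed by simp

lemma J_right: "x \<in> J \<Longrightarrow> a \<in> fcarrier S \<Longrightarrow> x * a \<in> J"
  using id.I_r_closed by simp

lemma J_uminus: "x \<in> J \<Longrightarrow> - x \<in> J"
  using J_left[of x "- 1"] fcarrier_closed(4,6) by fastforce

lemma J_diff: "x \<in> J \<Longrightarrow> y \<in> J \<Longrightarrow> x - y \<in> J"
  using J_add[of x "- y"] J_uminus[of y] by simp

lemma pclass_eq:
  assumes "y \<in> fcarrier S" "x - y \<in> J"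
  shows "pclass S R x = pclass S R y"
proof -
  have "x \<in> J +>\<^bsub>free_algebra S\<^esub> y"
    unfolding a_r_coset_def' using assms by (auto intro!: bexI[of _ "x - y"])
  then show ?thesis
    unfolding pclass_def using fa.a_repr_independence[OF _ assms(1) id.a_subgroup] by simp
qed

lemma comm_qcomm:
  assumes "comm x z \<in> J" "comm y z \<in> J" "x \<in> fcarrier S" "y \<in> fcarrier S"
  shows "comm (qcomm p x y) z \<in> J"
proof -
  have c: "u * (scal p * w) = scal p * (u * w)" for u w
    by (metis scal_comm mult.assoc)
  have "comm (qcomm p x y) z = comm x z * y + x * comm y z
      - scal p * (comm y z * x + y * comm x z)"
    by (simp add: comm_def qcomm_def algebra_simps c[of z])
  also have "\<dots> \<in> J"
    by (intro J_diff J_add J_left[OF _ fcarrier_closed(2)] J_left[OF assms(1)] J_left[OF assms(2)]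
        J_right[OF assms(1)] J_right[OF assms(2)] assms)
  finally show ?thesis .
qed

lemma qcomm_assoc:
  assumes "comm x z \<in> J" "x \<in> fcarrier S" "y \<in> fcarrier S"
  shows "qcomm p (qcomm p x y) z - qcomm p x (qcomm p y z) \<in> J"
proof -
  have c: "u * (scal p * w) = scal p * (u * w)" for u w
    by (metis scal_comm mult.assoc)
  have "qcomm p (qcomm p x y) z - qcomm p x (qcomm p y z)
      = scal p * (comm x z * y) - scal p * (y * comm x z)"
    by (simp add: comm_def qcomm_def algebra_simps c[of x] c[of y] c[of z])
  also have "\<dots> \<in> J"
    by (intro J_diff J_left[OF _ fcarrier_closed(2)] J_left[OF assms(1)] J_right[OF assms(1)] assms)
  finally show ?thesis .
qed

lemma qcomm_cong:
  assumes "x - x' \<in> J" "y - y' \<in> J" "x \<in> fcarrier S" "y' \<in> fcarrier S"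
  shows "qcomm p x y - qcomm p x' y' \<in> J"
proof -
  have "qcomm p x y - qcomm p x' y' = (x - x') * y' + x * (y - y')
      - scal p * ((y - y') * x + y' * (x - x'))"
    by (simp add: qcomm_def algebra_simps)
  also have "\<dots> \<in> J"
    by (intro J_diff J_add J_left[OF _ fcarrier_closed(2)] J_left[OF assms(1)] J_left[OF assms(2)]
        J_right[OF assms(1)] J_right[OF assms(2)] assms)
  finally show ?thesis .
qed

end

lemma relators_ext: "relators (ext_gens m) (ext_rels h m)"
  by unfold_locales (rule ext_rels_fcarrier)

lemma far_rels:
  assumes "i \<in> {1..<m}" "j \<in> {1..<m}" "i + 2 \<le> j \<or> j + 2 \<le> i"
  shows "comm (gen (Yp i)) (gen (Yp j)) \<in> ext_rels h m" "comm (gen (Ym i)) (gen (Ym j)) \<in> ext_rels h m"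
proof -
  have "r \<in> chev_rels h m" if r: "r \<in> {comm (gen (Yp i)) (gen (Yp j)), comm (gen (Ym i)) (gen (Ym j))}" for r
    unfolding chev_rels_def
    by (rule UN_I[OF assms(1)], rule UN_I[OF assms(2)]) (simp only: if_P[OF assms(3)] Un_iff r simp_thms)
  then show "comm (gen (Yp i)) (gen (Yp j)) \<in> ext_rels h m" "comm (gen (Ym i)) (gen (Ym j)) \<in> ext_rels h m"
    by (simp_all add: ext_rels_def)
qed

context
  fixes h :: complex and m :: nat
begin

interpretation relators "ext_gens m" "ext_rels h m"
  by (rule relators_ext)

lemma Ypl_fcarrier: "1 \<le> i \<Longrightarrow> j \<le> m \<Longrightarrow> Ypl h i j \<in> fcarrier (ext_gens m)"
  by (induction j) (auto intro!: fcarrier_closed fcarrier_closed' fcarrier_closed(1)[THEN iffD2]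
    simp: ext_gens_mem)

lemma Ymi_fcarrier: "1 \<le> j \<Longrightarrow> i \<le> m \<Longrightarrow> Ymi h i j \<in> fcarrier (ext_gens m)"
  by (induction i) (auto intro!: fcarrier_closed fcarrier_closed' fcarrier_closed(1)[THEN iffD2]
    simp: ext_gens_mem)

lemma Ypl_comm:
  assumes "1 \<le> i" "k < j" "j < m"
  shows "comm (Ypl h i k) (gen (Yp j)) \<in> J"
  using assms
proof (induction k)
  case 0
  then show ?case by (simp add: comm_def J_0)
next
  case (Suc k)
  have f: "comm (gen (Yp k)) (gen (Yp j)) \<in> J" if "i \<le> k"
    using Suc.prems that by (intro rel far_rels) auto
  have "gen (Yp k) \<in> fcarrier (ext_gens m)" if "i \<le> k"
    using Suc.prems that by (intro fcarrier_closed(1)[THEN iffD2]) (auto simp: ext_gens_mem)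
  then show ?case
    using Suc f Ypl_fcarrier[of i k] by (auto intro!: comm_qcomm simp: comm_def[of 0] J_0)
qed

lemma Ymi_comm:
  assumes "1 \<le> k" "j < i" "i < m"
  shows "comm (Ymi h j k) (gen (Ym i)) \<in> J"
  using assms
proof (induction j)
  case 0
  then show ?case by (simp add: comm_def J_0)
next
  case (Suc j)
  have f: "comm (gen (Ym j)) (gen (Ym i)) \<in> J" if "k \<le> j"
    using Suc.prems that by (intro rel far_rels) auto
  have "gen (Ym j) \<in> fcarrier (ext_gens m)" if "k \<le> j"
    using Suc.prems that by (intro fcarrier_closed(1)[THEN iffD2]) (auto simp: ext_gens_mem)
  then show ?case
    using Suc f Ymi_fcarrier[of k j] by (auto intro!: comm_qcomm simp: comm_def[of 0] J_0)
qed

lemma Ypl_split: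
  assumes "1 \<le> i" "i < k" "k < j" "j \<le> m"
  shows "ext_class h m (Ypl h i j) = ext_class h m (qcomm (qp h 1) (Ypl h i k) (Ypl h k j))"
proof -
  have "Ypl h i j - qcomm (qp h 1) (Ypl h i k) (Ypl h k j) \<in> J"
    using assms
  proof (induction j)
    case (Suc j)
    show ?case
    proof (cases "k = j")
      case True
      then show ?thesis using Suc.prems by (simp add: J_0)
    next
      case False
      let ?q = "qp h 1" and ?z = "gen (Yp j) :: chev falg"
      have z: "?z \<in> fcarrier (ext_gens m)"
        using Suc.prems by (intro fcarrier_closed(1)[THEN iffD2]) (auto simp: ext_gens_mem)
      have "Ypl h i j - qcomm ?q (Ypl h i k) (Ypl h k j) \<in> J"
        using Suc False by simp
      then have 1: "qcomm ?q (Ypl h i j) ?z - qcomm ?q (qcomm ?q (Ypl h i k) (Ypl h k j)) ?z \<in> J"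
        using Suc.prems z by (intro qcomm_cong) (auto simp: J_0 intro: Ypl_fcarrier)
      have 2: "qcomm ?q (qcomm ?q (Ypl h i k) (Ypl h k j)) ?z
          - qcomm ?q (Ypl h i k) (qcomm ?q (Ypl h k j) ?z) \<in> J"
        using Suc.prems False by (intro qcomm_assoc Ypl_comm Ypl_fcarrier) auto
      show ?thesis
        using J_add[OF 1 2] Suc.prems False by auto
    qed
  qed simp
  then show ?thesis
    unfolding ext_class_def
    using assms by (intro pclass_eq fcarrier_closed' Ypl_fcarrier) auto
qed

lemma Ymi_split:
  assumes "1 \<le> k" "k < j" "j < i" "i \<le> m"
  shows "ext_class h m (Ymi h i k) = ext_class h m (qcomm (qp h (- 1)) (Ymi h i j) (Ymi h j k))"
proof -
  have "Ymi h i k - qcomm (qp h (- 1)) (Ymi h i j) (Ymi h j k) \<in> J"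
    using assms
  proof (induction i)
    case (Suc i)
    show ?case
    proof (cases "j = i")
      case True
      then show ?thesis using Suc.prems by (simp add: J_0)
    next
      case False
      let ?q = "qp h (- 1)" and ?z = "gen (Ym i) :: chev falg"
      have z: "?z \<in> fcarrier (ext_gens m)"
        using Suc.prems by (intro fcarrier_closed(1)[THEN iffD2]) (auto simp: ext_gens_mem)
      have "Ymi h i k - qcomm ?q (Ymi h i j) (Ymi h j k) \<in> J"
        using Suc False by simp
      then have 1: "qcomm ?q ?z (Ymi h i k) - qcomm ?q ?z (qcomm ?q (Ymi h i j) (Ymi h j k)) \<in> J"
        using Suc.prems z by (intro qcomm_cong) (auto simp: J_0 intro!: Ymi_fcarrier fcarrier_closed')
      have "comm ?z (Ymi h j k) = - comm (Ymi h j k) ?z"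
        by (simp add: comm_def)
      then have "comm ?z (Ymi h j k) \<in> J"
        using Suc.prems False by (auto intro!: J_uminus Ymi_comm)
      then have 2: "qcomm ?q (qcomm ?q ?z (Ymi h i j)) (Ymi h j k)
          - qcomm ?q ?z (qcomm ?q (Ymi h i j) (Ymi h j k)) \<in> J"
        using Suc.prems False z by (intro qcomm_assoc Ymi_fcarrier) auto
      show ?thesis
        using J_diff[OF 1 2] Suc.prems False by auto
    qed
  qed simp
  then show ?thesis
    unfolding ext_class_def
    using assms by (intro pclass_eq fcarrier_closed' Ymi_fcarrier) auto
qed

end

text \<open>\<open>Ap i\<close>, \<open>Am i\<close>, \<open>Nb i\<close>, \<open>QNb c i\<close> stand for \<open>a\<^sub>i\<^sup>+\<close>, \<open>a\<^sub>i\<^sup>-\<close>, \<open>N\<^sub>i\<close>, \<open>q\<^bsup>c N\<^sub>i\<^esup>\<close>.\<close>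
datatype boson = Ap nat | Am nat | Nb nat | QNb complex nat

definition boson_gens :: "nat \<Rightarrow> boson set" where
  "boson_gens n = (\<Union>i\<in>{1..n}. {Ap i, Am i, Nb i} \<union> range (\<lambda>c. QNb c i))"

definition delta :: "nat \<Rightarrow> nat \<Rightarrow> complex" where
  "delta i j = (if i = j then 1 else 0)"

definition boson_rels :: "complex \<Rightarrow> nat \<Rightarrow> boson falg set" where
  "boson_rels h n = (\<Union>i\<in>{1..n}. \<Union>j\<in>{1..n}.
     {comm (gen (Nb i)) (gen (Nb j)),
      comm (gen (Nb i)) (gen (Ap j)) - scal (delta i j) * gen (Ap j),
      comm (gen (Nb i)) (gen (Am j)) + scal (delta i j) * gen (Am j),
      comm (gen (Ap i)) (gen (Ap j)),
      comm (gen (Am i)) (gen (Am j)),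
      gen (Am i) * gen (Ap i) - scal (qp h (- 1)) * gen (Ap i) * gen (Am i) - gen (QNb 1 i),
      gen (Am i) * gen (Ap i) - scal (qp h 1) * gen (Ap i) * gen (Am i) - gen (QNb (- 1) i)}
     \<union> (if i \<noteq> j then {comm (gen (Ap i)) (gen (Am j))} else {})
     \<union> {gen (QNb 0 i) - 1}
     \<union> (\<Union>c d. {gen (QNb c i) * gen (QNb d i) - gen (QNb (c + d) i),
               comm (gen (QNb c i)) (gen (QNb d j)),
               comm (gen (QNb c i)) (gen (Nb j)),
               gen (QNb c i) * gen (Ap j) - scal (qp h (c * delta i j)) * gen (Ap j) * gen (QNb c i),
               gen (QNb c i) * gen (Am j) - scal (qp h (- c * delta i j)) * gen (Am j) * gen (QNb c i)}))"

definition boson_alg :: "complex \<Rightarrow> nat \<Rightarrow> boson falg set ring" where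
  "boson_alg h n = presented (boson_gens n) (boson_rels h n)"

definition boson_class :: "complex \<Rightarrow> nat \<Rightarrow> boson falg \<Rightarrow> boson falg set" where
  "boson_class h n = pclass (boson_gens n) (boson_rels h n)"

primrec boson_img :: "nat \<Rightarrow> chev \<Rightarrow> boson falg" where
  "boson_img n (H i) = gen (Nb i) - gen (Nb (Suc i))"
| "boson_img n (QH c i) = gen (QNb c i) * gen (QNb (- c) (Suc i))"
| "boson_img n (Yp i) = gen (Ap i) * gen (Am (Suc i))"
| "boson_img n (Ym i) = gen (Ap (Suc i)) * gen (Am i)"
| "boson_img n NT = (\<Sum>i\<in>{1..n}. gen (Nb i))"
| "boson_img n (QN c) = prod_list (map (\<lambda>i. gen (QNb c i)) [1..<Suc n])"

text \<open>On a coset \<open>X\<close> this takes the class of the image of any representative; the union collapses to that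
  class once the relations are respected.\<close>
definition realization :: "complex \<Rightarrow> nat \<Rightarrow> chev falg set \<Rightarrow> boson falg set" where
  "realization h n X = (\<Union>x\<in>X. boson_class h n (fext (boson_img n) x))"

definition sg :: "nat \<Rightarrow> nat \<Rightarrow> complex" where
  "sg i j = of_int (sgn (int i - int j))"

definition Zexp :: "nat \<Rightarrow> nat \<Rightarrow> nat \<Rightarrow> nat \<Rightarrow> nat \<Rightarrow> complex" where
  "Zexp k1 k2 s \<mu> l = 1/2 * (\<Sum>\<sigma>\<in>{1..k1} - {\<mu>}. sg \<sigma> \<mu> * Hform ((\<sigma>-1)*k2 + s) ((\<sigma>-1)*k2 + s + 1) l)"

definition Lam :: "nat \<Rightarrow> nat \<Rightarrow> nat \<Rightarrow> nat \<Rightarrow> complex" where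
  "Lam k1 k2 t l = (of_nat k2 - 1) / (of_nat k1 * of_nat k2) * (Nform l + (\<Sum>\<sigma>\<in>{2..k1*k2}. Hform 1 \<sigma> l))
     - (\<Sum>\<sigma>\<in>{t-k2+1..t-1}. Hform 1 \<sigma> l)"

definition Xexp :: "nat \<Rightarrow> nat \<Rightarrow> nat \<Rightarrow> nat \<Rightarrow> complex" where
  "Xexp k2 \<mu> t l = 1/2 * (\<Sum>\<nu>\<in>{\<mu>*k2+1..(\<mu>+1)*k2} - {t}. sg \<nu> t * Hform (\<nu>-k2) \<nu> l)"

text \<open>The elements assigned to the Chevalley generators of the two smaller algebras (the clauses for the
  number operator are never used).\<close>
primrec Zfam :: "complex \<Rightarrow> nat \<Rightarrow> nat \<Rightarrow> chev \<Rightarrow> chev falg" where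
  "Zfam h k1 k2 (H s) = (\<Sum>\<mu>\<in>{1..k1}. Hel ((\<mu>-1)*k2 + s) ((\<mu>-1)*k2 + s + 1))"
| "Zfam h k1 k2 (QH c s) = cartan_pow (k1*k2)
     (\<lambda>l. c * (\<Sum>\<mu>\<in>{1..k1}. Hform ((\<mu>-1)*k2 + s) ((\<mu>-1)*k2 + s + 1) l))"
| "Zfam h k1 k2 (Yp s) = (\<Sum>\<mu>\<in>{1..k1}. gen (Yp ((\<mu>-1)*k2 + s)) * cartan_pow (k1*k2) (Zexp k1 k2 s \<mu>))"
| "Zfam h k1 k2 (Ym s) = (\<Sum>\<mu>\<in>{1..k1}. gen (Ym ((\<mu>-1)*k2 + s)) * cartan_pow (k1*k2) (Zexp k1 k2 s \<mu>))"
| "Zfam h k1 k2 NT = 0"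
| "Zfam h k1 k2 (QN c) = 0"

primrec Xfam :: "complex \<Rightarrow> nat \<Rightarrow> nat \<Rightarrow> chev \<Rightarrow> chev falg" where
  "Xfam h k1 k2 (H \<mu>) = (\<Sum>s\<in>{(\<mu>-1)*k2+1..\<mu>*k2}. Hel s (s + k2))"
| "Xfam h k1 k2 (QH c \<mu>) = cartan_pow (k1*k2) (\<lambda>l. c * (\<Sum>s\<in>{(\<mu>-1)*k2+1..\<mu>*k2}. Hform s (s + k2) l))"
| "Xfam h k1 k2 (Yp \<mu>) = (\<Sum>t\<in>{\<mu>*k2+1..(\<mu>+1)*k2}.
     Ypl h (t-k2) t * cartan_pow (k1*k2) (\<lambda>l. Xexp k2 \<mu> t l + Lam k1 k2 t l))"
| "Xfam h k1 k2 (Ym \<mu>) = (\<Sum>t\<in>{\<mu>*k2+1..(\<mu>+1)*k2}.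
     Ymi h t (t-k2) * cartan_pow (k1*k2) (\<lambda>l. Xexp k2 \<mu> t l - Lam k1 k2 t l))"
| "Xfam h k1 k2 NT = 0"
| "Xfam h k1 k2 (QN c) = 0"

end

theory Submission
  imports Defs
begin

text \<open>
  In the realization, \<open>N + \<Sum>\<^sub>\<sigma> H\<^bsub>1\<sigma>\<^esub>\<close> becomes \<open>k\<^sub>1k\<^sub>2 N\<^sub>1\<close>, so that \<open>q\<close> to the power
  \<open>\<Lambda>\<^sub>t\<^sup>\<plusminus>\<close> exactly cancels the powers of \<open>q\<close> in the Cartan-Weyl elements, and \<open>X\<^sub>\<mu>\<^sup>+\<close>
  becomes a sum of terms \<open>a\<^sub>i\<^sup>+ a\<^sub>j\<^sup>-\<close> twisted by powers of the \<open>H\<close>. Arrange the bosons in a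
  \<open>k\<^sub>1 \<times> k\<^sub>2\<close> grid. Each column carries a copy of the algebra of rank \<open>k\<^sub>1 - 1\<close>, the copies commute,
  and the twisted sums over the columns are the iterated symmetric coproduct; hence they satisfy the same
  relations. The \<open>Z\<^sup>s\<close> arise in the same way from the transposed grid. A row generator and a column
  generator meet only in a \<open>2 \<times> 2\<close> square of bosons, where two \<open>q\<close>-commutators
  \<open>a\<^sub>j\<^sup>- a\<^sub>j\<^sup>+ - q\<^sup>\<plusminus>\<^sup>1 a\<^sub>j\<^sup>+ a\<^sub>j\<^sup>-\<close> at opposite corners cancel.
\<close>

section \<open>Free algebras and presentations\<close>

text \<open>The calculations call for rewriting in a type, while a presented algebra is a structure
  with a carrier. Relators are therefore mapped into the type \<open>qalg\<close>, shown to vanish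
  there, and read back as members of the ideal; the price is a target without a unit. The bosons
  enter only through the axioms of \<open>boson_bilinears\<close>. Decisive among them is
  \<open>e_chain\<close>, a q-commutator rule that holds with q and with q^-1 alike: the Serre
  relations follow from one choice, and the cancellation in a square takes the choice that its
  corner demands. As the axioms survive relabelling of the bosons, one theorem,
  \<open>grid_chev_rels\<close>, covers the realization itself, the X family and the Z family. The
  factor 1/2 in the exponents shares a twist evenly: when two terms from different columns are
  exchanged, each twist gives a half power. For two raising or two lowering terms the halves add up
  to the power of q that the Serre relations need; for a raising and a lowering term they
  cancel.\<close>

lemma scal_mult: "scal c * scal d = scal (c * d)"
  by (simp add: scal_def mult_single plus_list_def)

lemma scal_add: "scal (c + d) = scal c + scal d"
  by (simp add: scal_def single_add)

lemma scal_1: "scal 1 = 1"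
  by (simp add: scal_def one_falg)

lemma scal_0: "scal 0 = 0"
  by (simp add: scal_def)

lemma mult_scal: "x * (scal c * y) = scal c * (x * y)"
  by (metis scal_comm mult.assoc)

lemma fext_0 [simp]: "fext U 0 = 0"
  by (simp add: fext_def)

lemma fext_single: "fext U (Poly_Mapping.single w c) = scal c * prod_list (map U w)"
  by (simp add: fext_def scal_0)

lemma fext_add: "fext U (x + y) = fext U x + fext U y"
proof -
  let ?t = "\<lambda>z w. scal (Poly_Mapping.lookup z w) * prod_list (map U w)"
  let ?A = "Poly_Mapping.keys x \<union> Poly_Mapping.keys y"
  have *: "fext U z = (\<Sum>w\<in>?A. ?t z w)" if "Poly_Mapping.keys z \<subseteq> ?A" for z
    unfolding fext_def using that
    by (intro sum.mono_neutral_left) (auto simp: in_keys_iff scal_0)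
  show ?thesis
    using keys_add[of x y]
    by (simp add: * lookup_add scal_add distrib_right sum.distrib)
qed

lemma falg_induct [case_names add single]:
  assumes "\<And>x y. P x \<Longrightarrow> P y \<Longrightarrow> P (x + y)" and "\<And>w c. P (Poly_Mapping.single w c)"
  shows "P (x :: 'g falg)"
proof (induction x rule: update_induct)
  case const
  then show ?case using assms(2)[of "[]" 0] by simp
next
  case (update f k v)
  have "Poly_Mapping.update k v f = f + Poly_Mapping.single k v"
    using update(1)
    by (intro poly_mapping_eqI)
       (auto simp: lookup_update lookup_add lookup_single when_def in_keys_iff)
  then show ?case using assms(1)[OF update(3) assms(2), of k v] by simp
qed

lemma fext_mult: "fext U (x * y) = fext U x * fext U y"
proof (induction x rule: falg_induct)
  case (single w c)
  show ?case
  proof (induction y rule: falg_induct)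
    case (single v d)
    have "fext U (Poly_Mapping.single w c * Poly_Mapping.single v d)
        = scal (c * d) * (prod_list (map U w) * prod_list (map U v))"
      by (simp add: mult_single fext_single plus_list_def)
    also have "\<dots> = scal c * (scal d * prod_list (map U w)) * prod_list (map U v)"
      by (simp add: scal_mult[symmetric] mult.assoc)
    also have "\<dots> = fext U (Poly_Mapping.single w c) * fext U (Poly_Mapping.single v d)"
      by (simp only: scal_comm[of d] fext_single mult.assoc)
    finally show ?case .
  qed (simp add: distrib_left fext_add)
qed (simp add: distrib_right fext_add)

lemma fext_scal [simp]: "fext U (scal c) = scal c"
  using fext_single[of U "[]" c] by (simp add: scal_def)

lemma fext_1 [simp]: "fext U 1 = 1"
  using fext_scal[of U 1] by (simp add: scal_1)

lemma fext_gen: "fext U (gen g) = U g"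
  by (simp add: gen_def fext_single scal_1)

lemma fext_uminus: "fext U (- x) = - fext U x"
  using minus_unique[of "fext U x" "fext U (- x)"] fext_add[of U x "- x"] by simp

lemma fext_diff: "fext U (x - y) = fext U x - fext U y"
  using fext_add[of U x "- y"] by (simp add: fext_uminus)

lemma prod_list_fcarrier: "set xs \<subseteq> fcarrier S \<Longrightarrow> prod_list xs \<in> fcarrier S"
  by (induction xs) (auto intro: fcarrier_closed)

lemma sum_fcarrier: "(\<And>i. i \<in> A \<Longrightarrow> f i \<in> fcarrier S) \<Longrightarrow> sum f A \<in> fcarrier S"
  by (induction A rule: infinite_finite_induct) (auto intro: fcarrier_closed)

lemma fext_fcarrier:
  assumes "x \<in> fcarrier S" "\<And>g. g \<in> S \<Longrightarrow> U g \<in> fcarrier T"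
  shows "fext U x \<in> fcarrier T"
  unfolding fext_def using assms
  by (intro sum_fcarrier fcarrier_closed prod_list_fcarrier) (fastforce simp: fcarrier_iff)+

text \<open>Used for the substitution that keeps the generators in \<open>S\<close> and kills all
  others: it retracts the whole type onto the free algebra on \<open>S\<close>.\<close>

lemma fext_gen_id:
  assumes "x \<in> fcarrier S" "\<And>g. g \<in> S \<Longrightarrow> U g = gen g"
  shows "fext U x = x"
proof -
  have "prod_list (map gen w) = (Poly_Mapping.single w 1 :: 'a falg)" for w
    by (induction w) (simp_all add: gen_def mult_single plus_list_def one_falg)
  then have *: "scal c * prod_list (map gen w) = Poly_Mapping.single w c" for c and w :: "'a list"
    by (simp add: scal_def mult_single plus_list_def)
  have "fext U x = (\<Sum>w\<in>Poly_Mapping.keys x. Poly_Mapping.single w (Poly_Mapping.lookup x w))"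
    unfolding fext_def
  proof (rule sum.cong)
    fix w assume "w \<in> Poly_Mapping.keys x"
    then have "map U w = map gen w"
      using assms by (fastforce simp: fcarrier_iff)
    then show "scal (Poly_Mapping.lookup x w) * prod_list (map U w)
        = Poly_Mapping.single w (Poly_Mapping.lookup x w)"
      by (simp only: *)
  qed simp
  also have "\<dots> = x"
    by (intro poly_mapping_eqI)
       (simp add: lookup_sum lookup_single when_def in_keys_iff)
  finally show ?thesis .
qed

section \<open>Quotients by the ideal of relators\<close>

lemma presented_simps:
  "carrier (presented S R) = pclass S R ` fcarrier S"
  "\<one>\<^bsub>presented S R\<^esub> = pclass S R 1"
  by (auto simp: presented_def pclass_def FactRing_def A_RCOSETS_def')

context relators
begin

lemma pclass_eq_iff:
  assumes "x \<in> fcarrier S" "y \<in> fcarrier S"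
  shows "pclass S R x = pclass S R y \<longleftrightarrow> x - y \<in> J"
proof
  assume "pclass S R x = pclass S R y"
  then have "x \<in> J +>\<^bsub>free_algebra S\<^esub> y"
    unfolding pclass_def using fa.a_coset_join1 id.a_rcos_self assms by metis
  then show "x - y \<in> J"
    unfolding a_r_coset_def' by auto
qed (use assms pclass_eq in auto)

lemma pclass_mult:
  assumes "x \<in> fcarrier S" "y \<in> fcarrier S"
  shows "pclass S R x \<otimes>\<^bsub>presented S R\<^esub> pclass S R y = pclass S R (x * y)"
  using id.rcoset_mult_add[of x y] assms by (simp add: presented_def pclass_def FactRing_def)

lemma pclass_add:
  assumes "x \<in> fcarrier S" "y \<in> fcarrier S"
  shows "pclass S R x \<oplus>\<^bsub>presented S R\<^esub> pclass S R y = pclass S R (x + y)"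
  using id.a_rcos_sum[of x y] assms by (simp add: presented_def pclass_def FactRing_def)

lemma pclass_zero: "x \<in> J \<Longrightarrow> pclass S R x = \<zero>\<^bsub>presented S R\<^esub>"
  using id.a_rcos_const by (simp add: presented_def pclass_def FactRing_def)

lemma pclass_members: "x \<in> fcarrier S \<Longrightarrow> pclass S R x = {y \<in> fcarrier S. y - x \<in> J}"
proof -
  assume x: "x \<in> fcarrier S"
  have "y \<in> pclass S R x" if "y - x \<in> J" for y
    unfolding pclass_def a_r_coset_def' using that by (auto intro!: bexI[of _ "y - x"])
  moreover have "y \<in> fcarrier S" "y - x \<in> J" if "y \<in> pclass S R x" for y
    using that J_carrier x unfolding pclass_def a_r_coset_def' by (auto intro: fcarrier_closed(5))
  ultimately show ?thesis by blast
qed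

text \<open>The elements that \<open>fext U\<close> sends into \<open>J\<close> form an ideal, and
  the ideal generated by \<open>R'\<close> is the smallest one containing \<open>R'\<close>. This
  lets a map given on generators descend to presentations.\<close>

lemma fext_ideal:
  assumes R': "R' \<subseteq> fcarrier S'"
    and U: "\<And>g. g \<in> S' \<Longrightarrow> U g \<in> fcarrier S"
    and r: "\<And>r. r \<in> R' \<Longrightarrow> fext U r \<in> J"
    and x: "x \<in> Idl\<^bsub>free_algebra S'\<^esub> R'"
  shows "fext U x \<in> J"
proof -
  interpret T: relators S' R' by unfold_locales (rule R')
  let ?I = "{x \<in> fcarrier S'. fext U x \<in> J}"
  have "ideal ?I (free_algebra S')"
  proof (rule idealI)
    show "subgroup ?I (add_monoid (free_algebra S'))"
    proof
      fix x assume x: "x \<in> ?I"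
      have "inv\<^bsub>add_monoid (free_algebra S')\<^esub> x = - x"
        using T.fa.minus_equality[of "- x" x] x by (simp add: a_inv_def fcarrier_closed)
      then show "inv\<^bsub>add_monoid (free_algebra S')\<^esub> x \<in> ?I"
        using x by (auto simp: fext_uminus intro: J_uminus fcarrier_closed)
    qed (auto simp: fext_add J_0 intro: J_add fcarrier_closed)
  next
    fix a x assume "a \<in> ?I" and x: "x \<in> fcarrier S'"
    moreover have "fext U x \<in> fcarrier S"
      by (rule fext_fcarrier[OF x U])
    ultimately show "x \<otimes>\<^bsub>free_algebra S'\<^esub> a \<in> ?I" "a \<otimes>\<^bsub>free_algebra S'\<^esub> x \<in> ?I"
      by (auto simp: fext_mult intro: J_left J_right fcarrier_closed(7))
  qed (simp_all add: ring_free_algebra)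
  then have "T.J \<subseteq> ?I"
    using R' r by (intro T.fa.genideal_minimal) auto
  then show ?thesis using x by auto
qed

end

section \<open>The product of all quotients of the free algebra\<close>

text \<open>No unit is required: inside the product of all quotients, a single quotient has an
  idempotent as its unit, not the unit of the product.\<close>

class calg = ring +
  fixes cscale :: "complex \<Rightarrow> 'a \<Rightarrow> 'a" (infixr "\<cdot>\<^sub>C" 75)
  assumes cscale_add_right: "c \<cdot>\<^sub>C (x + y) = c \<cdot>\<^sub>C x + c \<cdot>\<^sub>C y"
    and cscale_add_left: "(c + d) \<cdot>\<^sub>C x = c \<cdot>\<^sub>C x + d \<cdot>\<^sub>C x"
    and cscale_cscale: "c \<cdot>\<^sub>C d \<cdot>\<^sub>C x = (c * d) \<cdot>\<^sub>C x"
    and cscale_one [simp]: "1 \<cdot>\<^sub>C x = x"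
    and cscale_mult_left: "(c \<cdot>\<^sub>C x) * y = c \<cdot>\<^sub>C (x * y)"
    and cscale_mult_right: "x * (c \<cdot>\<^sub>C y) = c \<cdot>\<^sub>C (x * y)"
begin

lemma cscale_zero_left [simp]: "0 \<cdot>\<^sub>C x = 0"
  using cscale_add_left[of 0 0 x] by simp

lemma cscale_zero_right [simp]: "c \<cdot>\<^sub>C 0 = 0"
  using cscale_add_right[of c 0 0] by simp

lemma cscale_minus_left: "(- c) \<cdot>\<^sub>C x = - (c \<cdot>\<^sub>C x)"
  using minus_unique[of "c \<cdot>\<^sub>C x" "(- c) \<cdot>\<^sub>C x"] cscale_add_left[of c "- c" x] by simp

lemma cscale_minus_right: "c \<cdot>\<^sub>C (- x) = - (c \<cdot>\<^sub>C x)"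
  using minus_unique[of "c \<cdot>\<^sub>C x" "c \<cdot>\<^sub>C (- x)"] cscale_add_right[of c x "- x"] by simp

lemma cscale_diff_left: "(c - d) \<cdot>\<^sub>C x = c \<cdot>\<^sub>C x - d \<cdot>\<^sub>C x"
  using cscale_add_left[of c "- d" x] by (simp add: cscale_minus_left)

lemma cscale_diff_right: "c \<cdot>\<^sub>C (x - y) = c \<cdot>\<^sub>C x - c \<cdot>\<^sub>C y"
  using cscale_add_right[of c x "- y"] by (simp add: cscale_minus_right)

lemma cscale_sum: "c \<cdot>\<^sub>C sum f A = (\<Sum>i\<in>A. c \<cdot>\<^sub>C f i)"
  by (induction A rule: infinite_finite_induct) (simp_all add: cscale_add_right)

end

definition two_sided :: "'g falg set \<Rightarrow> bool" where
  "two_sided I \<longleftrightarrow> 0 \<in> I \<and> (\<forall>x\<in>I. \<forall>y\<in>I. x + y \<in> I) \<and> (\<forall>x\<in>I. \<forall>a. a * x \<in> I \<and> x * a \<in> I)"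

lemma two_sidedD:
  assumes "two_sided I"
  shows "0 \<in> I" "x \<in> I \<Longrightarrow> y \<in> I \<Longrightarrow> x + y \<in> I" "x \<in> I \<Longrightarrow> a * x \<in> I" "x \<in> I \<Longrightarrow> x * a \<in> I"
    "x \<in> I \<Longrightarrow> - x \<in> I" "x \<in> I \<Longrightarrow> y \<in> I \<Longrightarrow> x - y \<in> I"
proof -
  show *: "0 \<in> I" "x \<in> I \<Longrightarrow> y \<in> I \<Longrightarrow> x + y \<in> I" "x \<in> I \<Longrightarrow> a * x \<in> I" "x \<in> I \<Longrightarrow> x * a \<in> I"
    for x y a using assms by (auto simp: two_sided_def)
  show m: "- x \<in> I" if "x \<in> I" for x
    using *(3)[of x "- 1"] that by simp
  show "x - y \<in> I" if "x \<in> I" "y \<in> I"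
    using *(2)[of x "- y"] m that by simp
qed

text \<open>
  The ideals of a presentation depend on parameters, so its quotient ring is not a type. The product of
  all quotients of the free algebra is one, and it contains each of them as a (non-unital) subring.
\<close>
definition qalg_rel :: "('g falg set \<Rightarrow> 'g falg) \<Rightarrow> ('g falg set \<Rightarrow> 'g falg) \<Rightarrow> bool" where
  "qalg_rel f g \<longleftrightarrow> (\<forall>I. two_sided I \<longrightarrow> f I - g I \<in> I)"

lemma qalg_relD: "qalg_rel f g \<Longrightarrow> two_sided I \<Longrightarrow> f I - g I \<in> I"
  by (simp add: qalg_rel_def)

quotient_type 'g qalg = "'g falg set \<Rightarrow> 'g falg" / qalg_rel
proof (intro equivpI reflpI sympI transpI)
  fix f g k :: "'g falg set \<Rightarrow> 'g falg"
  show "qalg_rel f f"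
    by (simp add: qalg_rel_def two_sidedD(1))
  assume fg: "qalg_rel f g"
  show "qalg_rel g f"
    unfolding qalg_rel_def using two_sidedD(5)[OF _ qalg_relD[OF fg]] by simp
  assume gk: "qalg_rel g k"
  show "qalg_rel f k"
    unfolding qalg_rel_def using two_sidedD(2)[OF _ qalg_relD[OF fg] qalg_relD[OF gk]] by simp
qed

instantiation qalg :: (type) calg
begin

lift_definition zero_qalg :: "'a qalg" is "\<lambda>_. 0" .
lift_definition plus_qalg :: "'a qalg \<Rightarrow> 'a qalg \<Rightarrow> 'a qalg" is "\<lambda>f g I. f I + g I"
  unfolding qalg_rel_def by (simp add: add_diff_add two_sidedD(2))
lift_definition uminus_qalg :: "'a qalg \<Rightarrow> 'a qalg" is "\<lambda>f I. - f I"
  unfolding qalg_rel_def using two_sidedD(5) by (metis minus_diff_minus)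
lift_definition minus_qalg :: "'a qalg \<Rightarrow> 'a qalg \<Rightarrow> 'a qalg" is "\<lambda>f g I. f I - g I"
proof -
  fix f g f' g' :: "'a falg set \<Rightarrow> 'a falg"
  assume *: "qalg_rel f f'" "qalg_rel g g'"
  have eq: "f I - g I - (f' I - g' I) = (f I - f' I) - (g I - g' I)" for I
    by (simp add: algebra_simps)
  show "qalg_rel (\<lambda>I. f I - g I) (\<lambda>I. f' I - g' I)"
    unfolding qalg_rel_def eq
    by (intro allI impI two_sidedD(6) qalg_relD[OF *(1)] qalg_relD[OF *(2)])
qed
lift_definition times_qalg :: "'a qalg \<Rightarrow> 'a qalg \<Rightarrow> 'a qalg" is "\<lambda>f g I. f I * g I"
proof -
  fix f g f' g' :: "'a falg set \<Rightarrow> 'a falg"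
  assume *: "qalg_rel f f'" "qalg_rel g g'"
  have "f I * g I - f' I * g' I = (f I - f' I) * g I + f' I * (g I - g' I)" for I
    by (simp add: algebra_simps)
  then show "qalg_rel (\<lambda>I. f I * g I) (\<lambda>I. f' I * g' I)"
    unfolding qalg_rel_def
    by (simp add: two_sidedD(2)[OF _ two_sidedD(4)[OF _ qalg_relD[OF *(1)]]
          two_sidedD(3)[OF _ qalg_relD[OF *(2)]]])
qed
lift_definition cscale_qalg :: "complex \<Rightarrow> 'a qalg \<Rightarrow> 'a qalg" is "\<lambda>c f I. scal c * f I"
  unfolding qalg_rel_def by (simp add: right_diff_distrib[symmetric] two_sidedD(3))

instance
proof
  fix a b c :: "'a qalg" and z w :: complex
  note * = qalg_rel_def two_sidedD(1)
  show "a + b + c = a + (b + c)" by transfer (simp add: * add.assoc)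
  show "a + b = b + a" by transfer (simp add: * add.commute)
  show "0 + a = a" by transfer (simp add: *)
  show "- a + a = 0" by transfer (simp add: *)
  show "a - b = a + - b" by transfer (simp add: *)
  show "a * b * c = a * (b * c)" by transfer (simp add: * mult.assoc)
  show "(a + b) * c = a * c + b * c" by transfer (simp add: * distrib_right)
  show "a * (b + c) = a * b + a * c" by transfer (simp add: * distrib_left)
  show "z \<cdot>\<^sub>C (a + b) = z \<cdot>\<^sub>C a + z \<cdot>\<^sub>C b" by transfer (simp add: * distrib_left)
  show "(z + w) \<cdot>\<^sub>C a = z \<cdot>\<^sub>C a + w \<cdot>\<^sub>C a" by transfer (simp add: * scal_add distrib_right)
  show "z \<cdot>\<^sub>C w \<cdot>\<^sub>C a = (z * w) \<cdot>\<^sub>C a"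
    by transfer (simp add: * mult.assoc scal_mult[symmetric])
  show "1 \<cdot>\<^sub>C a = a" by transfer (simp add: * scal_1)
  show "(z \<cdot>\<^sub>C a) * b = z \<cdot>\<^sub>C (a * b)" by transfer (simp add: * mult.assoc)
  show "a * (z \<cdot>\<^sub>C b) = z \<cdot>\<^sub>C (a * b)" by transfer (simp add: * mult_scal)
qed

end

text \<open>The value 0 at every other ideal keeps the map additive and multiplicative and leaves
  the coordinate at \<open>I\<close> as the only one that decides about vanishing.\<close>

definition proj :: "'g falg set \<Rightarrow> 'g falg \<Rightarrow> 'g qalg" where
  "proj I x = abs_qalg (\<lambda>I'. if I' = I then x else 0)"

lemma proj_hom:
  "proj I (x + y) = proj I x + proj I y"
  "proj I (x * y) = proj I x * proj I y"
  "proj I (scal c * x) = c \<cdot>\<^sub>C proj I x"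
  unfolding proj_def plus_qalg.abs_eq times_qalg.abs_eq cscale_qalg.abs_eq
  by (rule arg_cong[where f = abs_qalg]; auto)+

lemma proj_eq_0_iff: "two_sided I \<Longrightarrow> proj I x = 0 \<longleftrightarrow> x \<in> I"
  unfolding proj_def zero_qalg_def qalg.abs_eq_iff qalg_rel_def
  by (auto simp: two_sidedD(1) split: if_splits)

text \<open>Since \<open>\<Phi> 1\<close> need not be a unit of the target, scalars are governed
  through \<open>scal c * x\<close> and not through an image of \<open>scal c\<close> alone.\<close>

locale falg_hom =
  fixes \<Phi> :: "'g falg \<Rightarrow> 'a::calg"
  assumes add: "\<Phi> (x + y) = \<Phi> x + \<Phi> y"
    and mult: "\<Phi> (x * y) = \<Phi> x * \<Phi> y"
    and scale: "\<Phi> (scal c * x) = c \<cdot>\<^sub>C \<Phi> x"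
begin

lemma zero: "\<Phi> 0 = 0"
  using add[of 0 0] by simp

lemma uminus: "\<Phi> (- x) = - \<Phi> x"
  using minus_unique[of "\<Phi> x" "\<Phi> (- x)"] add[of x "- x"] by (simp add: zero)

lemma diff: "\<Phi> (x - y) = \<Phi> x - \<Phi> y"
  using add[of x "- y"] by (simp add: uminus)

lemma sum: "\<Phi> (sum f A) = (\<Sum>i\<in>A. \<Phi> (f i))"
  by (induction A rule: infinite_finite_induct) (simp_all add: zero add)

lemma scale_mult: "\<Phi> (scal c * x * y) = c \<cdot>\<^sub>C (\<Phi> x * \<Phi> y)"
  unfolding mult.assoc scale unfolding mult ..

lemma comm: "\<Phi> (comm x y) = \<Phi> x * \<Phi> y - \<Phi> y * \<Phi> x"
  by (simp add: comm_def diff mult)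

lemma qcomm: "\<Phi> (qcomm p x y) = \<Phi> x * \<Phi> y - p \<cdot>\<^sub>C (\<Phi> y * \<Phi> x)"
  unfolding qcomm_def diff scale_mult unfolding mult ..

lemma serre: "\<Phi> (serre h x y) = \<Phi> x * (\<Phi> x * \<Phi> y)
    - (qp h 1 + qp h (- 1)) \<cdot>\<^sub>C (\<Phi> x * (\<Phi> y * \<Phi> x)) + \<Phi> y * (\<Phi> x * \<Phi> x)"
  unfolding serre_def diff add power2_eq_square mult.assoc scale unfolding mult ..

lemma fext_hom: "falg_hom (\<lambda>x. \<Phi> (fext U x))"
  by (unfold_locales, simp_all only: fext_add fext_mult fext_scal add scale, simp only: mult)

end

context relators
begin

text \<open>Killing the generators outside \<open>S\<close> extends the ideal of the free algebra on \<open>S\<close> to one of the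
  whole type.\<close>
definition quot :: "'g falg \<Rightarrow> 'g qalg" where
  "quot = proj {x. fext (\<lambda>g. if g \<in> S then gen g else 0) x \<in> J}"

lemma quot_hom: "falg_hom quot"
  unfolding quot_def by unfold_locales (rule proj_hom)+

text \<open>Killing the foreign generators sends every element into the free algebra on
  \<open>S\<close>, so the preimage of \<open>J\<close> is two-sided even under multiplication by
  foreign words; on the free algebra on \<open>S\<close> the substitution is the identity. Equations
  proved in \<open>qalg\<close> thereby become memberships in \<open>J\<close>.\<close>

lemma quot_eq_0_iff: "x \<in> fcarrier S \<Longrightarrow> quot x = 0 \<longleftrightarrow> x \<in> J"
proof -
  assume x: "x \<in> fcarrier S"
  let ?U = "\<lambda>g. if g \<in> S then gen g else 0"
  have U: "fext ?U y \<in> fcarrier S" for y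
    by (rule fext_fcarrier[of y UNIV]) (auto simp: fcarrier_iff[of y] intro: fcarrier_closed(1)[THEN iffD2] fcarrier_closed)
  have "two_sided {x. fext ?U x \<in> J}"
    by (auto simp: two_sided_def fext_add fext_mult J_0 intro: J_add J_left[OF _ U] J_right[OF _ U])
  then show ?thesis
    using fext_gen_id[OF x, of ?U] by (simp add: quot_def proj_eq_0_iff)
qed

end

section \<open>Bilinears in the bosons\<close>

lemma qp_add: "qp h (x + y) = qp h x * qp h y"
  by (simp add: qp_def distrib_left exp_add)

lemma qp_0 [simp]: "qp h 0 = 1"
  by (simp add: qp_def)

lemma qp_nonzero [simp]: "qp h x \<noteq> 0"
  by (simp add: qp_def)

section \<open>Quantum Serre expressions\<close>

definition qserre :: "complex \<Rightarrow> 'a::calg \<Rightarrow> 'a \<Rightarrow> 'a" where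
  "qserre h x y = x * (x * y) - (qp h 1 + qp h (- 1)) \<cdot>\<^sub>C (x * (y * x)) + y * (x * x)"

text \<open>The exchange factors are those between two legs of a coproduct. The mixed terms split by
  degree into four groups. Moving factors with index 1 to the left turns each group into a
  combination of ordered monomials, whose coefficients vanish because p = q^a is a root of t^2 - (q
  + q^-1) t + 1. As q + q^-1 is symmetric, both signs \<open>a\<close> are covered.\<close>

lemma qserre_add:
  fixes x1 x2 y1 y2 :: "'a::calg"
  assumes a: "a = 1 \<or> a = - 1"
    and xx: "x2 * x1 = qp h (- 2 * a) \<cdot>\<^sub>C (x1 * x2)"
    and xy: "x2 * y1 = qp h a \<cdot>\<^sub>C (y1 * x2)"
    and yx: "y2 * x1 = qp h a \<cdot>\<^sub>C (x1 * y2)"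
  shows "qserre h (x1 + x2) (y1 + y2) = qserre h x1 y1 + qserre h x2 y2"
proof -
  define p where "p = qp h a"
  have p0: "p \<noteq> 0" by (simp add: p_def)
  have m: "qp h (- a) = 1 / p"
    using qp_add[of h a "- a"] p0 by (simp add: p_def field_simps)
  have m2: "qp h (- 2 * a) = 1 / p * (1 / p)"
    using qp_add[of h "- a" "- a"] by (simp add: m)
  have c: "qp h 1 + qp h (- 1) = p + 1 / p"
    using a m by (auto simp: p_def add.commute)
  have A: "x2 * (x1 * z) = (1 / p * (1 / p)) \<cdot>\<^sub>C (x1 * (x2 * z))"
    "x2 * (y1 * z) = p \<cdot>\<^sub>C (y1 * (x2 * z))" "y2 * (x1 * z) = p \<cdot>\<^sub>C (x1 * (y2 * z))" for z
    using xx xy yx by (metis mult.assoc cscale_mult_left m2 p_def)+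
  note B = A xx[unfolded m2] xy[folded p_def] yx[folded p_def]
  note simps = B c cscale_cscale cscale_mult_left cscale_mult_right cscale_add_right cscale_add_left
    cscale_diff_left cscale_diff_right distrib_left distrib_right mult.assoc
  have 1: "x1 * (x1 * y2) - (qp h 1 + qp h (- 1)) \<cdot>\<^sub>C (x1 * (y2 * x1)) + y2 * (x1 * x1) = 0" (is "?l1 = _")
  proof -
    have "?l1 = (1 - (p + 1 / p) * p + p * p) \<cdot>\<^sub>C (x1 * (x1 * y2))"
      by (simp add: simps)
    then show ?thesis using p0 by (simp add: field_simps)
  qed
  have 2: "x2 * (x2 * y1) - (qp h 1 + qp h (- 1)) \<cdot>\<^sub>C (x2 * (y1 * x2)) + y1 * (x2 * x2) = 0" (is "?l2 = _")
  proof -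
    have "?l2 = (p * p - (p + 1 / p) * p + 1) \<cdot>\<^sub>C (y1 * (x2 * x2))"
      by (simp add: simps)
    then show ?thesis using p0 by (simp add: field_simps)
  qed
  have 3: "x1 * (x2 * y1) + x2 * (x1 * y1)
      - (qp h 1 + qp h (- 1)) \<cdot>\<^sub>C (x1 * (y1 * x2) + x2 * (y1 * x1)) + y1 * (x1 * x2 + x2 * x1) = 0" (is "?l3 = _")
  proof -
    have "?l3 = (p + 1 / p - (p + 1 / p)) \<cdot>\<^sub>C (x1 * (y1 * x2))
        + (1 + 1 / p * (1 / p) - (p + 1 / p) * (1 / p)) \<cdot>\<^sub>C (y1 * (x1 * x2))"
      using p0 by (simp add: simps)
    then show ?thesis using p0 by (simp add: field_simps)
  qed
  have 4: "x1 * (x2 * y2) + x2 * (x1 * y2)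
      - (qp h 1 + qp h (- 1)) \<cdot>\<^sub>C (x1 * (y2 * x2) + x2 * (y2 * x1)) + y2 * (x1 * x2 + x2 * x1) = 0" (is "?l4 = _")
  proof -
    have "?l4 = (1 + 1 / p * (1 / p) - (p + 1 / p) * (1 / p)) \<cdot>\<^sub>C (x1 * (x2 * y2))
        + (p + 1 / p - (p + 1 / p)) \<cdot>\<^sub>C (x1 * (y2 * x2))"
      using p0 by (simp add: simps)
    then show ?thesis using p0 by (simp add: field_simps)
  qed
  have "qserre h (x1 + x2) (y1 + y2) = qserre h x1 y1 + qserre h x2 y2 + (?l1 + ?l2 + (?l3 + ?l4))"
    unfolding qserre_def by (simp add: algebra_simps cscale_add_right)
  then show ?thesis
    unfolding 1 2 3 4 by simp
qed

text \<open>The partial sum plays the first leg and the new summand the second: the exchange factors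
  are the same for all pairs s < t, so they pass through the sum.\<close>

lemma qserre_sum:
  fixes x y :: "nat \<Rightarrow> 'a::calg"
  assumes a: "a = 1 \<or> a = - 1"
    and xx: "\<And>s t. 1 \<le> s \<Longrightarrow> s < t \<Longrightarrow> t \<le> r \<Longrightarrow> x t * x s = qp h (- 2 * a) \<cdot>\<^sub>C (x s * x t)"
    and xy: "\<And>s t. 1 \<le> s \<Longrightarrow> s < t \<Longrightarrow> t \<le> r \<Longrightarrow> x t * y s = qp h a \<cdot>\<^sub>C (y s * x t)"
    and yx: "\<And>s t. 1 \<le> s \<Longrightarrow> s < t \<Longrightarrow> t \<le> r \<Longrightarrow> y t * x s = qp h a \<cdot>\<^sub>C (x s * y t)"
    and ser: "\<And>s. 1 \<le> s \<Longrightarrow> s \<le> r \<Longrightarrow> qserre h (x s) (y s) = 0"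
  shows "qserre h (\<Sum>s\<in>{1..r}. x s) (\<Sum>s\<in>{1..r}. y s) = 0"
  using xx xy yx ser
proof (induction r)
  case 0
  then show ?case by (simp add: qserre_def)
next
  case (Suc r)
  have "qserre h ((\<Sum>s\<in>{1..r}. x s) + x (Suc r)) ((\<Sum>s\<in>{1..r}. y s) + y (Suc r))
      = qserre h (\<Sum>s\<in>{1..r}. x s) (\<Sum>s\<in>{1..r}. y s) + qserre h (x (Suc r)) (y (Suc r))"
    by (rule qserre_add[OF a])
       (simp_all add: sum_distrib_left sum_distrib_right cscale_sum Suc.prems)
  moreover have "qserre h (\<Sum>s\<in>{1..r}. x s) (\<Sum>s\<in>{1..r}. y s) = 0"
    by (rule Suc.IH) (simp_all add: Suc.prems)
  ultimately show ?case by (simp add: Suc.prems)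
qed

text \<open>
  Here \<open>e i j\<close> stands for \<open>a\<^sub>i\<^sup>+ a\<^sub>j\<^sup>-\<close>, \<open>K f\<close> for \<open>q\<close> to the power \<open>\<Sum>\<^sub>i f(i) N\<^sub>i\<close>, and
  \<open>D f\<close> for this exponent itself. The target need not contain the unit of the source: \<open>K 0\<close> plays its role.
\<close>
locale boson_bilinears =
  fixes h :: complex and I :: "'i set"
    and e :: "'i \<Rightarrow> 'i \<Rightarrow> 'a::calg" and K D :: "('i \<Rightarrow> complex) \<Rightarrow> 'a"
  assumes K_cong: "(\<And>i. i \<in> I \<Longrightarrow> f i = g i) \<Longrightarrow> K f = K g"
    and K_K: "K f * K g = K (\<lambda>i. f i + g i)"
    and D_K: "D f * K g = K g * D f"
    and D_D: "D f * D g = D g * D f"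
    and K_e: "i \<in> I \<Longrightarrow> j \<in> I \<Longrightarrow> i \<noteq> j \<Longrightarrow> K f * e i j = qp h (f i - f j) \<cdot>\<^sub>C (e i j * K f)"
    and D_e: "i \<in> I \<Longrightarrow> j \<in> I \<Longrightarrow> i \<noteq> j \<Longrightarrow> D f * e i j = e i j * D f + (f i - f j) \<cdot>\<^sub>C e i j"
    and e_comm: "i \<in> I \<Longrightarrow> j \<in> I \<Longrightarrow> k \<in> I \<Longrightarrow> l \<in> I \<Longrightarrow> i \<noteq> j \<Longrightarrow> k \<noteq> l \<Longrightarrow> j \<noteq> k \<Longrightarrow> i \<noteq> l
      \<Longrightarrow> e i j * e k l = e k l * e i j"
    and e_opp: "i \<in> I \<Longrightarrow> j \<in> I \<Longrightarrow> i \<noteq> j \<Longrightarrow> e i j * e j i - e j i * e i j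
      = (1 / (qp h 1 - qp h (- 1))) \<cdot>\<^sub>C (K (\<lambda>k. of_bool (k = i) - of_bool (k = j))
          - K (\<lambda>k. of_bool (k = j) - of_bool (k = i)))"
    and e_chain: "i \<in> I \<Longrightarrow> j \<in> I \<Longrightarrow> l \<in> I \<Longrightarrow> i \<noteq> j \<Longrightarrow> j \<noteq> l \<Longrightarrow> i \<noteq> l \<Longrightarrow> a = 1 \<or> a = - 1
      \<Longrightarrow> e i j * e j l - qp h a \<cdot>\<^sub>C (e j l * e i j) = e i l * K (\<lambda>k. - a * of_bool (k = j))"
begin

lemma eK_eK:
  assumes "k \<in> I" "l \<in> I" "k \<noteq> l"
  shows "e i j * K f * (e k l * K g) = qp h (f k - f l) \<cdot>\<^sub>C (e i j * e k l * K (\<lambda>i. f i + g i))"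
proof -
  have "e i j * K f * (e k l * K g) = e i j * (K f * e k l) * K g"
    by (simp add: mult.assoc)
  also have "\<dots> = qp h (f k - f l) \<cdot>\<^sub>C (e i j * e k l * (K f * K g))"
    by (simp add: K_e assms cscale_mult_left cscale_mult_right mult.assoc)
  finally show ?thesis by (simp add: K_K)
qed

text \<open>Both orders have the same normal form up to a scalar, because no boson is created by one
  factor and annihilated by the other. The exponent is the difference of the two costs of moving a
  \<open>K\<close> past a bilinear.\<close>

lemma eK_exchange:
  assumes "i \<in> I" "j \<in> I" "k \<in> I" "l \<in> I" "i \<noteq> j" "k \<noteq> l" "j \<noteq> k" "i \<noteq> l"
  shows "e i j * K f * (e k l * K g)
    = qp h ((f k - f l) - (g i - g j)) \<cdot>\<^sub>C (e k l * K g * (e i j * K f))"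
proof -
  have "qp h ((f k - f l) - (g i - g j)) * qp h (g i - g j) = qp h (f k - f l)"
    by (simp add: qp_add[symmetric])
  then show ?thesis
    by (simp add: eK_eK assms cscale_cscale e_comm[of i j k l] add.commute)
qed

text \<open>With z = [x, y]_q, the Serre expression in x, y is x z - q^-1 z x, and the one in y, x
  is z y - q^-1 y z. By \<open>e_chain\<close>, z is again a bilinear times q^(-N_j), and this power
  alone makes z q-commute with x and with y.\<close>

lemma e_serre:
  assumes "i \<in> I" "j \<in> I" "l \<in> I" "i \<noteq> j" "j \<noteq> l" "i \<noteq> l"
  shows "qserre h (e i j) (e j l) = 0" "qserre h (e j l) (e i j) = 0"
proof -
  define z where "z = e i j * e j l - qp h 1 \<cdot>\<^sub>C (e j l * e i j)"
  have z: "z = e i l * K (\<lambda>k. - of_bool (k = j))"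
    using e_chain[of i j l 1] assms by (simp add: z_def)
  have q: "qp h (- 1) * qp h 1 = 1" "qp h 1 * qp h (- 1) = 1"
    by (simp_all add: qp_add[symmetric])
  have 1: "z * e i j = qp h 1 \<cdot>\<^sub>C (e i j * z)"
    using assms unfolding z
    by (simp add: mult.assoc K_e cscale_mult_right) (simp add: mult.assoc[symmetric] e_comm[of i l i j])
  have 2: "z * e j l = qp h (- 1) \<cdot>\<^sub>C (e j l * z)"
    using assms unfolding z
    by (simp add: mult.assoc K_e cscale_mult_right) (simp add: mult.assoc[symmetric] e_comm[of i l j l])
  have "qserre h (e i j) (e j l) = e i j * z - qp h (- 1) \<cdot>\<^sub>C (z * e i j)"
    by (simp add: qserre_def z_def algebra_simps cscale_add_left cscale_mult_left cscale_mult_right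
        cscale_diff_right cscale_cscale q)
  then show "qserre h (e i j) (e j l) = 0"
    by (simp add: 1 cscale_cscale q)
  have "qserre h (e j l) (e i j) = z * e j l - qp h (- 1) \<cdot>\<^sub>C (e j l * z)"
    by (simp add: qserre_def z_def algebra_simps cscale_add_left cscale_mult_left cscale_mult_right
        cscale_diff_right cscale_cscale q)
  then show "qserre h (e j l) (e i j) = 0"
    by (simp add: 2)
qed

text \<open>Exponents that agree at both ends of each bilinear commute with it, so all
  \<open>K\<close> factors collect on the right of every monomial.\<close>

lemma qserre_eK:
  assumes I: "i \<in> I" "j \<in> I" "k \<in> I" "l \<in> I" "i \<noteq> j" "k \<noteq> l"
    and f: "f i = f j" "f k = f l" and g: "g i = g j" "g k = g l"
    and S: "qserre h (e i j) (e k l) = 0"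
  shows "qserre h (e i j * K f) (e k l * K g) = 0"
proof -
  have c: "K f * (e i j * z) = e i j * (K f * z)" "K f * (e k l * z) = e k l * (K f * z)"
    "K g * (e i j * z) = e i j * (K g * z)" for z
    using I f g by (simp_all add: mult.assoc[symmetric] K_e)
  have k: "K f * (K g * K f) = K f * (K f * K g)" "K g * (K f * K f) = K f * (K f * K g)"
    by (simp_all add: K_K add_ac)
  have "qserre h (e i j * K f) (e k l * K g) = qserre h (e i j) (e k l) * (K f * (K f * K g))"
    by (simp add: qserre_def mult.assoc c k distrib_right left_diff_distrib cscale_mult_left)
  then show ?thesis by (simp add: S)
qed

text \<open>For \<open>a b\<close> above \<open>c d\<close> in a square, both commutators are multiples of \<open>e a d\<close>: the first one comes
  from the corner \<open>c\<close>, the second one from \<open>b\<close>.\<close>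
lemma eK_square:
  assumes I: "a \<in> I" "b \<in> I" "c \<in> I" "d \<in> I" "distinct [a, b, c, d]" and \<epsilon>: "\<epsilon> = 1 \<or> \<epsilon> = - 1"
    and p1: "f1 c - f1 d = p" "g2 a - g2 c = p - \<epsilon>"
    and p2: "g1 b - g1 d = p" "f2 a - f2 b = p - \<epsilon>"
    and fg: "\<And>i. i \<in> I \<Longrightarrow> \<epsilon> * of_bool (i = c) + (f1 i + g2 i) = \<epsilon> * of_bool (i = b) + (f2 i + g1 i)"
  shows "e a c * K f1 * (e c d * K g2) - e c d * K g2 * (e a c * K f1)
    + (e b d * K f2 * (e a b * K g1) - e a b * K g1 * (e b d * K f2)) = 0"
proof -
  have q: "qp h (p - \<epsilon>) = qp h p * qp h (- \<epsilon>)"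
    by (simp add: qp_add[symmetric])
  have \<epsilon>': "- \<epsilon> = 1 \<or> - \<epsilon> = - 1"
    using \<epsilon> by (auto simp: equation_minus_iff)
  \<comment> \<open>The two orders carry the powers p and p - \<epsilon>; their quotient
    q^(-\<epsilon>) is the parameter with which \<open>e_chain\<close> applies.\<close>
  have 1: "e a c * K f1 * (e c d * K g2) - e c d * K g2 * (e a c * K f1)
      = qp h p \<cdot>\<^sub>C (e a d * K (\<lambda>i. \<epsilon> * of_bool (i = c) + (f1 i + g2 i)))" (is "?l = _")
  proof -
    have "?l = qp h p \<cdot>\<^sub>C ((e a c * e c d - qp h (- \<epsilon>) \<cdot>\<^sub>C (e c d * e a c)) * K (\<lambda>i. f1 i + g2 i))"
      using I by (simp add: eK_eK p1 q cscale_diff_right left_diff_distrib cscale_mult_left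
          cscale_cscale add.commute[of "g2 _"])
    then show ?thesis
      using I by (simp add: e_chain[OF _ _ _ _ _ _ \<epsilon>'] mult.assoc K_K)
  qed
  have 2: "e b d * K f2 * (e a b * K g1) - e a b * K g1 * (e b d * K f2)
      = - (qp h p \<cdot>\<^sub>C (e a d * K (\<lambda>i. \<epsilon> * of_bool (i = b) + (f2 i + g1 i))))" (is "?l = _")
  proof -
    have "?l = - (qp h p \<cdot>\<^sub>C ((e a b * e b d - qp h (- \<epsilon>) \<cdot>\<^sub>C (e b d * e a b)) * K (\<lambda>i. f2 i + g1 i)))"
      using I by (simp add: eK_eK p2 q cscale_diff_right left_diff_distrib cscale_mult_left
          cscale_cscale add.commute[of "g1 _"])
    then show ?thesis
      using I by (simp add: e_chain[OF _ _ _ _ _ _ \<epsilon>'] mult.assoc K_K)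
  qed
  show ?thesis
    unfolding 1 2 by (simp add: K_cong[OF fg])
qed

end

section \<open>Chevalley generators on a grid of bosons\<close>

text \<open>The form (total of row i) - (total of row i+1): the iterated coproduct of a Cartan
  generator. It does not depend on the column.\<close>

definition wt :: "nat \<Rightarrow> nat \<times> nat \<Rightarrow> complex" where
  "wt i = (\<lambda>(\<rho>, \<nu>). of_bool (\<rho> = i) - of_bool (\<rho> = Suc i))"

text \<open>Half of H_i in every later column and minus half in every earlier one, as in the
  symmetric coproduct; \<open>sg s s = 0\<close> leaves out the column s itself.\<close>

definition twist :: "nat \<Rightarrow> nat \<Rightarrow> nat \<times> nat \<Rightarrow> complex" where
  "twist i s = (\<lambda>(\<rho>, \<nu>). 1/2 * sg \<nu> s * wt i (\<rho>, \<nu>))"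

text \<open>The flag \<open>d\<close> distinguishes raising from lowering terms; both carry the same twist.\<close>
definition root_term :: "(nat \<times> nat \<Rightarrow> nat \<times> nat \<Rightarrow> 'a::calg) \<Rightarrow> ((nat \<times> nat \<Rightarrow> complex) \<Rightarrow> 'a)
    \<Rightarrow> bool \<Rightarrow> nat \<Rightarrow> nat \<Rightarrow> 'a" where
  "root_term e K d i s = (if d then e (i, s) (Suc i, s) else e (Suc i, s) (i, s)) * K (twist i s)"

definition root_sum :: "nat \<Rightarrow> (nat \<times> nat \<Rightarrow> nat \<times> nat \<Rightarrow> 'a::calg) \<Rightarrow> ((nat \<times> nat \<Rightarrow> complex) \<Rightarrow> 'a)
    \<Rightarrow> bool \<Rightarrow> nat \<Rightarrow> 'a" where
  "root_sum r e K d i = (\<Sum>s\<in>{1..r}. root_term e K d i s)"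

text \<open>The clauses for the number operator are never used.\<close>
primrec grid_gen :: "nat \<Rightarrow> (nat \<times> nat \<Rightarrow> nat \<times> nat \<Rightarrow> 'a::calg) \<Rightarrow> ((nat \<times> nat \<Rightarrow> complex) \<Rightarrow> 'a)
    \<Rightarrow> ((nat \<times> nat \<Rightarrow> complex) \<Rightarrow> 'a) \<Rightarrow> chev \<Rightarrow> 'a" where
  "grid_gen r e K D (H i) = D (wt i)"
| "grid_gen r e K D (QH c i) = K (\<lambda>p. c * wt i p)"
| "grid_gen r e K D (Yp i) = root_sum r e K True i"
| "grid_gen r e K D (Ym i) = root_sum r e K False i"
| "grid_gen r e K D NT = 0"
| "grid_gen r e K D (QN c) = 0"

abbreviation sign :: "bool \<Rightarrow> complex" where
  "sign d \<equiv> if d then 1 else - 1"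

lemma sg_simps [simp]: "sg s s = 0" "s < t \<Longrightarrow> sg s t = - 1" "t < s \<Longrightarrow> sg s t = 1"
  by (simp_all add: sg_def)

lemma sg_commute: "sg s t = - sg t s"
  by (cases s t rule: linorder_cases) simp_all

lemma wt_diff: "wt i (j, s) - wt i (Suc j, s) = cartan i j"
  by (auto simp: wt_def cartan_def)

lemma cartan_commute: "cartan i j = cartan j i"
  by (auto simp: cartan_def)

lemma twist_diff: "twist i s (j, t) - twist i s (Suc j, t) = 1/2 * sg t s * cartan i j"
  by (simp add: twist_def wt_diff[of i j t, symmetric] right_diff_distrib)

locale boson_grid = boson_bilinears h "{1..m} \<times> {1..r}" e K D
  for h :: complex and m r :: nat and e :: "nat \<times> nat \<Rightarrow> nat \<times> nat \<Rightarrow> 'a::calg" and K D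
begin

text \<open>The assumption excludes exactly the pairs within one column in which one term may create
  what the other annihilates. Each twist contributes half of the exponent, with the sign of the term
  that it is moved past; hence the halves cancel for opposite flags, and within one column
  \<open>sg\<close> makes the exponent 0.\<close>

lemma root_term_exchange:
  assumes "i \<in> {1..<m}" "j \<in> {1..<m}" "s \<in> {1..r}" "t \<in> {1..r}"
    and "s \<noteq> t \<or> d = d' \<and> i \<noteq> Suc j \<and> j \<noteq> Suc i \<or> d \<noteq> d' \<and> i \<noteq> j"
  shows "root_term e K d i s * root_term e K d' j t
    = qp h ((sign d + sign d') / 2 * (sg t s * cartan i j)) \<cdot>\<^sub>C (root_term e K d' j t * root_term e K d i s)"
proof -
  have *: "twist i s (j, t) - twist i s (Suc j, t) = 1/2 * (sg t s * cartan i j)"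
    "twist j t (i, s) - twist j t (Suc i, s) = - (1/2 * (sg t s * cartan i j))"
    using twist_diff[of i s j t] twist_diff[of j t i s] sg_commute[of s t] cartan_commute[of j i]
    by simp_all
  then have "twist i s (Suc j, t) - twist i s (j, t) = - (1/2 * (sg t s * cartan i j))"
    "twist j t (Suc i, s) - twist j t (i, s) = 1/2 * (sg t s * cartan i j)"
    by (metis minus_diff_eq minus_minus)+
  note * = * this
  show ?thesis
    unfolding root_term_def using assms
    by (cases d; cases d'; simp; subst eK_exchange; auto simp: * mult.commute[of "sg t s"])
qed

lemma root_sum_commute:
  assumes "i \<in> {1..<m}" "j \<in> {1..<m}" "i + 2 \<le> j \<or> j + 2 \<le> i"
  shows "root_sum r e K d i * root_sum r e K d j = root_sum r e K d j * root_sum r e K d i"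
proof -
  have c: "cartan i j = 0" using assms by (auto simp: cartan_def)
  have "root_sum r e K d i * root_sum r e K d j
      = (\<Sum>s\<in>{1..r}. \<Sum>t\<in>{1..r}. root_term e K d i s * root_term e K d j t)"
    by (simp add: root_sum_def sum_product)
  also have "\<dots> = (\<Sum>s\<in>{1..r}. \<Sum>t\<in>{1..r}. root_term e K d j t * root_term e K d i s)"
    using assms by (intro sum.cong refl, subst root_term_exchange) (auto simp: c)
  also have "\<dots> = root_sum r e K d j * root_sum r e K d i"
    by (subst sum.swap) (simp add: root_sum_def sum_product)
  finally show ?thesis .
qed

lemma root_sum_serre:
  assumes "i \<in> {1..<m}" "j \<in> {1..<m}" "i = Suc j \<or> j = Suc i"
  shows "qserre h (root_sum r e K d i) (root_sum r e K d j) = 0"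
  unfolding root_sum_def
\<comment> \<open>Moving a later column past an earlier one costs -\<open>sign d\<close> times the
  Cartan number: -2 \<open>sign d\<close> for equal indices and \<open>sign d\<close> for
  neighbours, as required with a = \<open>sign d\<close>.\<close>
proof (rule qserre_sum[of "sign d"])
  fix s t assume st: "1 \<le> s" "s < t" "t \<le> r"
  have c: "cartan i j = - 1" "cartan j i = - 1" "cartan i i = 2"
    using assms(3) by (auto simp: cartan_def)
  show "root_term e K d i t * root_term e K d i s
      = qp h (- 2 * sign d) \<cdot>\<^sub>C (root_term e K d i s * root_term e K d i t)"
    using root_term_exchange[of i i t s d d] assms st c by (auto split: if_splits)
  show "root_term e K d i t * root_term e K d j s
      = qp h (sign d) \<cdot>\<^sub>C (root_term e K d j s * root_term e K d i t)"
    using root_term_exchange[of i j t s d d] assms st c by (auto split: if_splits)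
  show "root_term e K d j t * root_term e K d i s
      = qp h (sign d) \<cdot>\<^sub>C (root_term e K d i s * root_term e K d j t)"
    using root_term_exchange[of j i t s d d] assms st c by (auto split: if_splits)
next
  fix s assume s: "1 \<le> s" "s \<le> r"
  \<comment> \<open>In its own column a twist is trivial, so \<open>qserre_eK\<close> reduces the
    claim to the untwisted bilinears.\<close>
  have tw: "twist i s (\<rho>, s) = 0" "twist j s (\<rho>, s) = 0" for \<rho>
    by (simp_all add: twist_def)
  have "qserre h (if d then e (i, s) (Suc i, s) else e (Suc i, s) (i, s))
      (if d then e (j, s) (Suc j, s) else e (Suc j, s) (j, s)) = 0"
    using assms s by (auto intro!: e_serre)
  then show "qserre h (root_term e K d i s) (root_term e K d j s) = 0"
    unfolding root_term_def using assms s
    by (cases d) (simp_all add: qserre_eK tw)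
qed simp

text \<open>Terms from different columns commute exactly, so only the diagonal of the double sum
  remains. In column s the commutator is the difference of q^H and q^(-H) there, with the doubled
  twist on the other columns, which is what makes the sum telescope.\<close>

lemma root_sum_opposite:
  assumes "i \<in> {1..<m}" "j \<in> {1..<m}"
  shows "root_sum r e K True i * root_sum r e K False j - root_sum r e K False j * root_sum r e K True i
    = (if i = j then (1 / (qp h 1 - qp h (- 1))) \<cdot>\<^sub>C (K (wt i) - K (\<lambda>p. - wt i p)) else 0)"
proof -
  let ?C = "\<lambda>s t. root_term e K True i s * root_term e K False j t
    - root_term e K False j t * root_term e K True i s"
  have z: "?C s t = 0" if "s \<in> {1..r}" "t \<in> {1..r}" "s \<noteq> t \<or> i \<noteq> j" for s t
    using root_term_exchange[of i j s t True False] assms that by auto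
  have "root_sum r e K True i * root_sum r e K False j - root_sum r e K False j * root_sum r e K True i
      = (\<Sum>s\<in>{1..r}. \<Sum>t\<in>{1..r}. ?C s t)"
    unfolding root_sum_def sum_product sum_subtractf
    by (subst (2) sum.swap) simp
  also have "\<dots> = (\<Sum>s\<in>{1..r}. ?C s s)"
  proof (rule sum.cong[OF refl])
    fix s assume "s \<in> {1..r}"
    then show "(\<Sum>t\<in>{1..r}. ?C s t) = ?C s s"
      using z by (subst sum.remove[of _ s]) (auto intro!: sum.neutral)
  qed
  also have "\<dots> = (if i = j then (1 / (qp h 1 - qp h (- 1))) \<cdot>\<^sub>C (K (wt i) - K (\<lambda>p. - wt i p)) else 0)"
  proof (cases "i = j")
    case False
    then show ?thesis using z by (simp add: sum.neutral)
  next
    case True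
    \<comment> \<open>the commutators in the single columns telescope along \<open>T\<close>\<close>
    define T where "T k = K (\<lambda>(\<rho>, \<nu>). (if \<nu> \<le> k then - 1 else 1) * wt i (\<rho>, \<nu>))" for k
    let ?c = "1 / (qp h 1 - qp h (- 1))"
    have "?C s s = ?c \<cdot>\<^sub>C (T (s - 1) - T s)" if s: "s \<in> {1..r}" for s
    proof -
      let ?a = "(i, s)" and ?b = "(Suc i, s)" and ?t = "\<lambda>p. twist i s p + twist i s p"
      have tw: "twist i s (\<rho>, s) = 0" "twist j s (\<rho>, s) = 0" for \<rho>
        by (simp_all add: twist_def)
      have ab: "?a \<in> {1..m} \<times> {1..r}" "?b \<in> {1..m} \<times> {1..r}"
        using assms s by auto
      have "?C s s = (e ?a ?b * e ?b ?a - e ?b ?a * e ?a ?b) * K ?t"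
        unfolding root_term_def using ab True
        by (simp add: eK_eK tw left_diff_distrib)
      also have "\<dots> = ?c \<cdot>\<^sub>C (K (\<lambda>k. of_bool (k = ?a) - of_bool (k = ?b) + ?t k)
          - K (\<lambda>k. of_bool (k = ?b) - of_bool (k = ?a) + ?t k))"
        using ab by (simp add: e_opp cscale_mult_left left_diff_distrib K_K)
      \<comment> \<open>Doubling the twist removes the 1/2: the sign is +1 on later columns and -1
        on earlier ones. The commutator fills in column s, with + here, so the flipped columns end
        at s - 1; with - below, they end at s.\<close>
      also have "K (\<lambda>k. of_bool (k = ?a) - of_bool (k = ?b) + ?t k) = T (s - 1)"
        unfolding T_def
      proof (intro K_cong, clarify)
        fix \<rho> \<nu> show "of_bool ((\<rho>, \<nu>) = ?a) - of_bool ((\<rho>, \<nu>) = ?b) + ?t (\<rho>, \<nu>)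
            = (if \<nu> \<le> s - 1 then - 1 else 1) * wt i (\<rho>, \<nu>)"
          using s by (cases \<nu> s rule: linorder_cases) (auto simp: twist_def wt_def)
      qed
      also have "K (\<lambda>k. of_bool (k = ?b) - of_bool (k = ?a) + ?t k) = T s"
        unfolding T_def
      proof (intro K_cong, clarify)
        fix \<rho> \<nu> show "of_bool ((\<rho>, \<nu>) = ?b) - of_bool ((\<rho>, \<nu>) = ?a) + ?t (\<rho>, \<nu>)
            = (if \<nu> \<le> s then - 1 else 1) * wt i (\<rho>, \<nu>)"
          using s by (cases \<nu> s rule: linorder_cases) (auto simp: twist_def wt_def)
      qed
      finally show ?thesis .
    qed
    then have "(\<Sum>s\<in>{1..r}. ?C s s) = ?c \<cdot>\<^sub>C (\<Sum>s\<in>{1..r}. T (s - 1) - T s)"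
      by (simp add: cscale_sum)
    also have "(\<Sum>s\<in>{1..r}. T (s - 1) - T s) = T 0 - T r"
      by (induction r) simp_all
    also have "T 0 = K (wt i)"
      unfolding T_def by (intro K_cong) auto
    also have "T r = K (\<lambda>p. - wt i p)"
      unfolding T_def by (intro K_cong) auto
    finally show ?thesis using True by simp
  qed
  finally show ?thesis .
qed

text \<open>A common difference c in all columns gives every summand the same factor. It is a Cartan
  number for the weights of the same family and 0 for those of the transposed one.\<close>

lemma K_root_sum:
  assumes i: "i \<in> {1..<m}" and f: "\<And>s. s \<in> {1..r} \<Longrightarrow> f (i, s) - f (Suc i, s) = c"
  shows "K f * root_sum r e K d i = qp h (sign d * c) \<cdot>\<^sub>C (root_sum r e K d i * K f)"
proof -
  have f': "f (Suc i, s) - f (i, s) = - c" if "s \<in> {1..r}" for s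
    using f[OF that] by (simp add: algebra_simps)
  have "K f * root_term e K d i s = qp h (sign d * c) \<cdot>\<^sub>C (root_term e K d i s * K f)"
    if s: "s \<in> {1..r}" for s
    unfolding root_term_def using i s f[OF s] f'[OF s]
    by (cases d)
       (simp_all add: mult.assoc[symmetric] K_e cscale_mult_left mult.assoc K_K add.commute)
  then show ?thesis
    by (simp add: root_sum_def sum_distrib_left sum_distrib_right cscale_sum)
qed

lemma D_root_sum:
  assumes i: "i \<in> {1..<m}" and f: "\<And>s. s \<in> {1..r} \<Longrightarrow> f (i, s) - f (Suc i, s) = c"
  shows "D f * root_sum r e K d i = root_sum r e K d i * D f + (sign d * c) \<cdot>\<^sub>C root_sum r e K d i"
proof -
  have f': "f (Suc i, s) - f (i, s) = - c" if "s \<in> {1..r}" for s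
    using f[OF that] by (simp add: algebra_simps)
  have "D f * root_term e K d i s = root_term e K d i s * D f + (sign d * c) \<cdot>\<^sub>C root_term e K d i s"
    if s: "s \<in> {1..r}" for s
    unfolding root_term_def using i s f[OF s] f'[OF s]
    by (cases d)
       (simp_all add: mult.assoc[symmetric] D_e cscale_mult_left distrib_right, simp_all add: mult.assoc D_K)
  then show ?thesis
    by (simp add: root_sum_def sum_distrib_left sum_distrib_right cscale_sum sum.distrib)
qed

text \<open>The homomorphism is arbitrary because the lemma is applied to the realization as well as
  to its composites with the substitutions of both families. The assumption on
  \<open>\<Phi> 1\<close> replaces preservation of units.\<close>

lemma grid_chev_rels:
  assumes hom: "falg_hom \<Phi>" and one: "\<Phi> 1 = K (\<lambda>_. 0)"
    and \<Phi>: "\<And>g. g \<in> chev_gens m \<Longrightarrow> \<Phi> (gen g) = grid_gen r e K D g"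
    and rel: "x \<in> chev_rels h m"
  shows "\<Phi> x = 0"
proof -
  interpret falg_hom \<Phi> by (rule hom)
  have gens: "\<Phi> (gen (H i)) = D (wt i)" "\<Phi> (gen (QH c i)) = K (\<lambda>p. c * wt i p)"
    "\<Phi> (gen (Yp i)) = root_sum r e K True i" "\<Phi> (gen (Ym i)) = root_sum r e K False i"
    if "i \<in> {1..<m}" for i c
  proof -
    have "{H i, QH c i, Yp i, Ym i} \<subseteq> chev_gens m"
      using that unfolding chev_gens_def by blast
    then show "\<Phi> (gen (H i)) = D (wt i)" "\<Phi> (gen (QH c i)) = K (\<lambda>p. c * wt i p)"
      "\<Phi> (gen (Yp i)) = root_sum r e K True i" "\<Phi> (gen (Ym i)) = root_sum r e K False i"
      by (simp_all add: \<Phi>)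
  qed
  have serre': "\<Phi> (serre h y z) = qserre h (\<Phi> y) (\<Phi> z)" for y z
    by (simp add: serre qserre_def)
  have D: "D (wt i) * root_sum r e K d j
      = root_sum r e K d j * D (wt i) + (sign d * cartan i j) \<cdot>\<^sub>C root_sum r e K d j"
    if "j \<in> {1..<m}" for i j d
    using that by (intro D_root_sum) (simp_all add: wt_diff)
  have K: "K (\<lambda>p. c * wt i p) * root_sum r e K d j
      = qp h (sign d * (c * cartan i j)) \<cdot>\<^sub>C (root_sum r e K d j * K (\<lambda>p. c * wt i p))"
    if "j \<in> {1..<m}" for i j d c
    using that by (intro K_root_sum) (simp_all add: right_diff_distrib[symmetric] wt_diff)
  from rel obtain i j where ij: "i \<in> {1..<m}" "j \<in> {1..<m}" and x: "x \<in>
     {comm (gen (H i)) (gen (H j)),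
      comm (gen (H i)) (gen (Yp j)) - scal (cartan i j) * gen (Yp j),
      comm (gen (H i)) (gen (Ym j)) + scal (cartan i j) * gen (Ym j),
      comm (gen (Yp i)) (gen (Ym j)) - (if i = j then qbracket_H h i else 0)}
     \<union> (if i + 2 \<le> j \<or> j + 2 \<le> i
        then {comm (gen (Yp i)) (gen (Yp j)), comm (gen (Ym i)) (gen (Ym j))} else {})
     \<union> (if i = Suc j \<or> j = Suc i
        then {serre h (gen (Yp i)) (gen (Yp j)), serre h (gen (Ym i)) (gen (Ym j))} else {})
     \<union> {gen (QH 0 i) - 1}
     \<union> (\<Union>c d. {gen (QH c i) * gen (QH d i) - gen (QH (c + d) i),
               comm (gen (QH c i)) (gen (QH d j)),
               comm (gen (QH c i)) (gen (H j)),
               gen (QH c i) * gen (Yp j) - scal (qp h (c * cartan i j)) * gen (Yp j) * gen (QH c i),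
               gen (QH c i) * gen (Ym j) - scal (qp h (- c * cartan i j)) * gen (Ym j) * gen (QH c i)})"
    unfolding chev_rels_def by (elim UN_E) blast
  note img = gens[OF ij(1)] gens[OF ij(2)]
  have 1: "\<Phi> (comm (gen (H i)) (gen (H j))) = 0"
    "\<Phi> (comm (gen (H i)) (gen (Yp j)) - scal (cartan i j) * gen (Yp j)) = 0"
    "\<Phi> (comm (gen (H i)) (gen (Ym j)) + scal (cartan i j) * gen (Ym j)) = 0"
    by (simp_all only: comm diff add scale img D_D D[OF ij(2)]) (simp_all add: cscale_minus_left)
  have 2: "\<Phi> (comm (gen (Yp i)) (gen (Ym j)) - (if i = j then qbracket_H h i else 0)) = 0"
    using root_sum_opposite[OF ij]
    by (auto simp: comm diff img qbracket_H_def scale zero simp del: mult)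
  have 3: "\<Phi> (comm (gen (Yp i)) (gen (Yp j))) = 0" "\<Phi> (comm (gen (Ym i)) (gen (Ym j))) = 0"
    if "i + 2 \<le> j \<or> j + 2 \<le> i"
    using root_sum_commute[OF ij that] by (simp_all add: comm img)
  have 4: "\<Phi> (serre h (gen (Yp i)) (gen (Yp j))) = 0" "\<Phi> (serre h (gen (Ym i)) (gen (Ym j))) = 0"
    if "i = Suc j \<or> j = Suc i"
    using root_sum_serre[OF ij that] by (simp_all add: serre' img)
  have 5: "\<Phi> (gen (QH 0 i) - 1) = 0"
    by (simp add: diff img one)
  have 6: "\<Phi> (gen (QH c i) * gen (QH d i) - gen (QH (c + d) i)) = 0"
    "\<Phi> (comm (gen (QH c i)) (gen (QH d j))) = 0"
    "\<Phi> (comm (gen (QH c i)) (gen (H j))) = 0"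
    "\<Phi> (gen (QH c i) * gen (Yp j) - scal (qp h (c * cartan i j)) * gen (Yp j) * gen (QH c i)) = 0"
    "\<Phi> (gen (QH c i) * gen (Ym j) - scal (qp h (- c * cartan i j)) * gen (Ym j) * gen (QH c i)) = 0"
    for c d
    by (simp_all only: comm diff scale_mult) (simp_all add: mult img K_K D_K K[OF ij(2)] distrib_right add.commute)
  show ?thesis
    using x 1 2 3 4 5 6 by (auto split: if_splits)
qed

end

section \<open>The transposed grid\<close>

text \<open>A step past t changes the sign in two halves. This confines the interaction of a row
  root with a column root to the two adjacent positions on either side.\<close>

lemma sg_Suc_left: "sg s t - sg (Suc s) t = - of_bool (t = s) - of_bool (t = Suc s)"
  by (cases t s rule: linorder_cases; cases "t = Suc s") simp_all

lemma sg_Suc_right: "sg s t - sg s (Suc t) = of_bool (s = t) + of_bool (s = Suc t)"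
  by (cases s t rule: linorder_cases; cases "s = Suc t") simp_all

text \<open>The axioms mention the indices only up to equality. Bilinears are pulled back along
  \<open>b\<close>, exponents along its inverse \<open>d\<close>, since \<open>K\<close> and
  \<open>D\<close> take functions on the indices.\<close>

lemma (in boson_bilinears) reindex:
  fixes I' :: "'k set"
  assumes b: "\<And>p. p \<in> I' \<Longrightarrow> b p \<in> I \<and> d (b p) = p" and d: "\<And>i. i \<in> I \<Longrightarrow> d i \<in> I' \<and> b (d i) = i"
  shows "boson_bilinears h I' (\<lambda>p q. e (b p) (b q)) (\<lambda>f. K (\<lambda>i. f (d i))) (\<lambda>f. D (\<lambda>i. f (d i)))"
proof
  have ne: "b p \<noteq> b q" if "p \<in> I'" "q \<in> I'" "p \<noteq> q" for p q
    using that b by metis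
  have eq: "d i = p \<longleftrightarrow> i = b p" if "i \<in> I" "p \<in> I'" for i p
    using that b d by metis
  show "K (\<lambda>i. f (d i)) = K (\<lambda>i. g (d i))" if "\<And>p. p \<in> I' \<Longrightarrow> f p = g p" for f g
    using that d by (intro K_cong) auto
  fix i j k l :: 'k and f g :: "'k \<Rightarrow> complex"
  show "K (\<lambda>i. f (d i)) * K (\<lambda>i. g (d i)) = K (\<lambda>i. f (d i) + g (d i))"
    "D (\<lambda>i. f (d i)) * K (\<lambda>i. g (d i)) = K (\<lambda>i. g (d i)) * D (\<lambda>i. f (d i))"
    "D (\<lambda>i. f (d i)) * D (\<lambda>i. g (d i)) = D (\<lambda>i. g (d i)) * D (\<lambda>i. f (d i))"
    by (simp_all add: K_K D_K) (rule D_D)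
  assume ij: "i \<in> I'" "j \<in> I'"
  { assume "i \<noteq> j"
    note A = ij this
    show "K (\<lambda>i. f (d i)) * e (b i) (b j) = qp h (f i - f j) \<cdot>\<^sub>C (e (b i) (b j) * K (\<lambda>i. f (d i)))"
      "D (\<lambda>i. f (d i)) * e (b i) (b j) = e (b i) (b j) * D (\<lambda>i. f (d i)) + (f i - f j) \<cdot>\<^sub>C e (b i) (b j)"
      using A b ne by (simp_all add: K_e D_e)
    have "K (\<lambda>k. of_bool (d k = i) - of_bool (d k = j)) = K (\<lambda>k. of_bool (k = b i) - of_bool (k = b j))"
      "K (\<lambda>k. of_bool (d k = j) - of_bool (d k = i)) = K (\<lambda>k. of_bool (k = b j) - of_bool (k = b i))"
      using ij eq by (auto intro!: K_cong)
    then show "e (b i) (b j) * e (b j) (b i) - e (b j) (b i) * e (b i) (b j)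
        = (1 / (qp h 1 - qp h (- 1))) \<cdot>\<^sub>C (K (\<lambda>k. of_bool (d k = i) - of_bool (d k = j))
          - K (\<lambda>k. of_bool (d k = j) - of_bool (d k = i)))"
      using A b ne by (simp add: e_opp)
  }
  assume l: "l \<in> I'"
  { assume k: "k \<in> I'" "i \<noteq> j" "k \<noteq> l" "j \<noteq> k" "i \<noteq> l"
    then show "e (b i) (b j) * e (b k) (b l) = e (b k) (b l) * e (b i) (b j)"
      using ij l b ne by (intro e_comm) auto
  }
  fix a :: complex
  assume A: "i \<noteq> j" "j \<noteq> l" "i \<noteq> l" "a = 1 \<or> a = - 1"
  have "K (\<lambda>k. - a * of_bool (d k = j)) = K (\<lambda>k. - a * of_bool (k = b j))"
    using ij eq by (auto intro!: K_cong)
  moreover have "e (b i) (b j) * e (b j) (b l) - qp h a \<cdot>\<^sub>C (e (b j) (b l) * e (b i) (b j))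
      = e (b i) (b l) * K (\<lambda>k. - a * of_bool (k = b j))"
    using A ij l b ne by (intro e_chain) auto
  ultimately show "e (b i) (b j) * e (b j) (b l) - qp h a \<cdot>\<^sub>C (e (b j) (b l) * e (b i) (b j))
      = e (b i) (b l) * K (\<lambda>k. - a * of_bool (d k = j))"
    by simp
qed

abbreviation transpose_e :: "('i \<times> 'j \<Rightarrow> 'i \<times> 'j \<Rightarrow> 'a) \<Rightarrow> 'j \<times> 'i \<Rightarrow> 'j \<times> 'i \<Rightarrow> 'a" where
  "transpose_e e \<equiv> \<lambda>p q. e (prod.swap p) (prod.swap q)"

abbreviation transpose_K :: "(('i \<times> 'j \<Rightarrow> complex) \<Rightarrow> 'a) \<Rightarrow> ('j \<times> 'i \<Rightarrow> complex) \<Rightarrow> 'a" where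
  "transpose_K K \<equiv> \<lambda>f. K (\<lambda>p. f (prod.swap p))"

section \<open>Commutation of the two families\<close>

context boson_grid
begin

lemma transpose: "boson_grid h r m (transpose_e e) (transpose_K K) (transpose_K D)"
  unfolding boson_grid_def by (rule reindex) auto

text \<open>These are the exponent conditions of \<open>eK_square\<close>. The change of one twist
  under j to j+1 and of the other under i to i+1 live on the corners of the square with values
  +-1/2. On one pair of opposite corners they cancel, on the other they add up to the +-1 that
  \<open>e_chain\<close> leaves there. Both directions are stated, and 1 is written as a factor, to
  match \<epsilon>.\<close>

lemma twist_square:
  fixes p :: "nat \<times> nat"
  shows "1 * of_bool (p = (Suc i, j)) + (twist i j p + twist j (Suc i) (prod.swap p))
      = 1 * of_bool (p = (i, Suc j)) + (twist i (Suc j) p + twist j i (prod.swap p))" (is ?A)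
    and "1 * of_bool (p = (i, Suc j)) + (twist i (Suc j) p + twist j i (prod.swap p))
      = 1 * of_bool (p = (Suc i, j)) + (twist i j p + twist j (Suc i) (prod.swap p))"
    and "- 1 * of_bool (p = (i, j)) + (twist i j p + twist j i (prod.swap p))
      = - 1 * of_bool (p = (Suc i, Suc j)) + (twist i (Suc j) p + twist j (Suc i) (prod.swap p))" (is ?B)
    and "- 1 * of_bool (p = (Suc i, Suc j)) + (twist i (Suc j) p + twist j (Suc i) (prod.swap p))
      = - 1 * of_bool (p = (i, j)) + (twist i j p + twist j i (prod.swap p))"
proof -
  obtain \<rho> \<nu> where p: "p = (\<rho>, \<nu>)" by fastforce
  have *: "sg \<nu> j = sg \<nu> (Suc j) + (of_bool (\<nu> = j) + of_bool (\<nu> = Suc j))"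
    "sg \<rho> i = sg \<rho> (Suc i) + (of_bool (\<rho> = i) + of_bool (\<rho> = Suc i))"
    using sg_Suc_right[of \<nu> j] sg_Suc_right[of \<rho> i] by (metis diff_eq_eq add.commute)+
  show A: ?A and B: ?B
    unfolding p twist_def wt_def by (auto simp: *(1) *(2) field_simps)
  from A[symmetric] B[symmetric] show
    "1 * of_bool (p = (i, Suc j)) + (twist i (Suc j) p + twist j i (prod.swap p))
      = 1 * of_bool (p = (Suc i, j)) + (twist i j p + twist j (Suc i) (prod.swap p))"
    "- 1 * of_bool (p = (Suc i, Suc j)) + (twist i (Suc j) p + twist j (Suc i) (prod.swap p))
      = - 1 * of_bool (p = (i, j)) + (twist i j p + twist j i (prod.swap p))" .
qed

text \<open>Almost all pairs of terms commute one by one; the two exceptions do not, but their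
  commutators are opposite by \<open>eK_square\<close>.\<close>

lemma root_sum_transpose_commute:
  assumes i: "i \<in> {1..<m}" and j: "j \<in> {1..<r}"
  shows "root_sum r e K d i * root_sum m (transpose_e e) (transpose_K K) d' j
    = root_sum m (transpose_e e) (transpose_K K) d' j * root_sum r e K d i"
proof -
  let ?x = "\<lambda>t. root_term e K d i t" and ?z = "\<lambda>\<sigma>. root_term (transpose_e e) (transpose_K K) d' j \<sigma>"
  define C where "C t \<sigma> = ?x t * ?z \<sigma> - ?z \<sigma> * ?x t" for t \<sigma>
  \<comment> \<open>the two pairs of terms that share a boson with opposite roles\<close>
  define S where "S = (if d = d' then {(j, Suc i), (Suc j, i)} else {(j, i), (Suc j, Suc i)})"
  have S: "S \<subseteq> {1..r} \<times> {1..m}"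
    using i j by (auto simp: S_def)
  have z: "?z \<sigma> = (if d' then e (\<sigma>, j) (\<sigma>, Suc j) else e (\<sigma>, Suc j) (\<sigma>, j))
      * K (\<lambda>p. twist j \<sigma> (prod.swap p))" for \<sigma>
    by (simp add: root_term_def)
  have C0: "C t \<sigma> = 0" if t: "t \<in> {1..r}" "\<sigma> \<in> {1..m}" "(t, \<sigma>) \<notin> S" for t \<sigma>
  proof -
    have *: "twist i t (\<sigma>, j) - twist i t (\<sigma>, Suc j)
        = - 1/2 * (of_bool (t = j) + of_bool (t = Suc j)) * (of_bool (\<sigma> = i) - of_bool (\<sigma> = Suc i))"
      "twist j \<sigma> (t, i) - twist j \<sigma> (t, Suc i)
        = - 1/2 * (of_bool (\<sigma> = i) + of_bool (\<sigma> = Suc i)) * (of_bool (t = j) - of_bool (t = Suc j))"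
      using sg_Suc_left[of j t] sg_Suc_left[of i \<sigma>]
      by (simp_all add: twist_def wt_def left_diff_distrib[symmetric] diff_divide_distrib[symmetric])
    have **: "twist i t (\<sigma>, Suc j) - twist i t (\<sigma>, j) = - (twist i t (\<sigma>, j) - twist i t (\<sigma>, Suc j))"
      "twist j \<sigma> (t, Suc i) - twist j \<sigma> (t, i) = - (twist j \<sigma> (t, i) - twist j \<sigma> (t, Suc i))"
      by simp_all
    \<comment> \<open>Away from the square both twists contribute nothing. At its two remaining
      corners they contribute equal half powers, which cancel in the exchange.\<close>
    have "?x t * ?z \<sigma> = qp h 0 \<cdot>\<^sub>C (?z \<sigma> * ?x t)"
      unfolding z unfolding root_term_def using i j t
      by (cases d; cases d'; simp only: if_True if_False; subst eK_exchange;
          (simp only: swap_simp ** *)?; auto simp: S_def)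
    then show ?thesis by (simp add: C_def)
  qed
  have CS: "sum (\<lambda>(t, \<sigma>). C t \<sigma>) S = 0"
  proof -
    \<comment> \<open>\<epsilon> is 1 for equal flags and -1 for different ones, and p =
      \<epsilon>/2, so that p - \<epsilon> = -p: the two orders carry opposite half powers.\<close>
    have "C j (Suc i) + C (Suc j) i = 0" if "d \<and> d'"
      unfolding C_def z unfolding root_term_def using that
      by (simp only: if_True if_False simp_thms, intro eK_square[where \<epsilon> = "1" and p = "1/2"])
         ((rule twist_square | use i j in \<open>simp add: twist_def wt_def\<close>)+)
    moreover have "C (Suc j) (Suc i) + C j i = 0" if "d \<and> \<not> d'"
      unfolding C_def z unfolding root_term_def using that
      by (simp only: if_True if_False simp_thms, intro eK_square[where \<epsilon> = "- 1" and p = "- 1/2"])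
         ((rule twist_square | use i j in \<open>simp add: twist_def wt_def\<close>)+)
    moreover have "C j i + C (Suc j) (Suc i) = 0" if "\<not> d \<and> d'"
      unfolding C_def z unfolding root_term_def using that
      by (simp only: if_True if_False simp_thms, intro eK_square[where \<epsilon> = "- 1" and p = "- 1/2"])
         ((rule twist_square | use i j in \<open>simp add: twist_def wt_def\<close>)+)
    moreover have "C (Suc j) i + C j (Suc i) = 0" if "\<not> d \<and> \<not> d'"
      unfolding C_def z unfolding root_term_def using that
      by (simp only: if_True if_False simp_thms, intro eK_square[where \<epsilon> = "1" and p = "1/2"])
         ((rule twist_square | use i j in \<open>simp add: twist_def wt_def\<close>)+)
    ultimately show ?thesis
      by (cases d; cases d') (simp_all add: S_def add.commute)
  qed
  have "root_sum r e K d i * root_sum m (transpose_e e) (transpose_K K) d' j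
      - root_sum m (transpose_e e) (transpose_K K) d' j * root_sum r e K d i
      = (\<Sum>t\<in>{1..r}. \<Sum>\<sigma>\<in>{1..m}. C t \<sigma>)"
    unfolding root_sum_def sum_product C_def sum_subtractf
    by (subst (2) sum.swap) simp
  also have "\<dots> = sum (\<lambda>(t, \<sigma>). C t \<sigma>) ({1..r} \<times> {1..m})"
    by (simp add: sum.cartesian_product)
  also have "\<dots> = sum (\<lambda>(t, \<sigma>). C t \<sigma>) S"
    using S C0 by (intro sum.mono_neutral_right) auto
  finally show ?thesis using CS by simp
qed

lemma grid_gen_commute:
  assumes g: "g \<in> chev_gens m" and g': "g' \<in> chev_gens r"
  shows "grid_gen r e K D g * grid_gen m (transpose_e e) (transpose_K K) (transpose_K D) g'
    = grid_gen m (transpose_e e) (transpose_K K) (transpose_K D) g' * grid_gen r e K D g"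
proof -
  interpret T: boson_grid h r m "transpose_e e" "transpose_K K" "transpose_K D"
    by (rule transpose)
  \<comment> \<open>A column weight agrees at both ends of a root that stays in its column, so the
    common difference is 0. The function \<open>f\<close> treats the weight and its multiples
    together.\<close>
  have 1: "K (\<lambda>p. f (wt j (prod.swap p))) * root_sum r e K d i
      = root_sum r e K d i * K (\<lambda>p. f (wt j (prod.swap p)))"
    "D (\<lambda>p. f (wt j (prod.swap p))) * root_sum r e K d i
      = root_sum r e K d i * D (\<lambda>p. f (wt j (prod.swap p)))"
    if "i \<in> {1..<m}" for i j d and f :: "complex \<Rightarrow> complex"
    using that K_root_sum[of i "\<lambda>p. f (wt j (prod.swap p))" 0] D_root_sum[of i "\<lambda>p. f (wt j (prod.swap p))" 0]
    by (simp_all add: wt_def)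
  have 2: "K (\<lambda>p. f (wt i p)) * root_sum m (transpose_e e) (transpose_K K) d j
      = root_sum m (transpose_e e) (transpose_K K) d j * K (\<lambda>p. f (wt i p))"
    "D (\<lambda>p. f (wt i p)) * root_sum m (transpose_e e) (transpose_K K) d j
      = root_sum m (transpose_e e) (transpose_K K) d j * D (\<lambda>p. f (wt i p))"
    if "j \<in> {1..<r}" for i j d and f :: "complex \<Rightarrow> complex"
    using that T.K_root_sum[of j "\<lambda>p. f (wt i (prod.swap p))" 0]
      T.D_root_sum[of j "\<lambda>p. f (wt i (prod.swap p))" 0]
    by (simp_all add: wt_def)
  obtain i where i: "i \<in> {1..<m}" and g: "g \<in> {H i, Yp i, Ym i} \<union> range (\<lambda>c. QH c i)"
    using g by (auto simp: chev_gens_def)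
  obtain j where j: "j \<in> {1..<r}" and g': "g' \<in> {H j, Yp j, Ym j} \<union> range (\<lambda>c. QH c j)"
    using g' by (auto simp: chev_gens_def)
  show ?thesis
    using g g' 1[OF i, of "\<lambda>x. x"] 1[OF i, of "\<lambda>x. _ * x"] 2[OF j, of "\<lambda>x. x"] 2[OF j, of "\<lambda>x. _ * x"]
    by (auto simp: root_sum_transpose_commute[OF i j] K_K D_K D_D add.commute)
qed

end

section \<open>The bosons\<close>

lemma boson_relsI:
  assumes "i \<in> {1..n}" "j \<in> {1..n}"
  shows "comm (gen (Nb i)) (gen (Nb j)) \<in> boson_rels h n"
    "comm (gen (Nb i)) (gen (Ap j)) - scal (delta i j) * gen (Ap j) \<in> boson_rels h n"
    "comm (gen (Nb i)) (gen (Am j)) + scal (delta i j) * gen (Am j) \<in> boson_rels h n"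
    "comm (gen (Ap i)) (gen (Ap j)) \<in> boson_rels h n"
    "comm (gen (Am i)) (gen (Am j)) \<in> boson_rels h n"
    "gen (Am i) * gen (Ap i) - scal (qp h (- 1)) * gen (Ap i) * gen (Am i) - gen (QNb 1 i) \<in> boson_rels h n"
    "gen (Am i) * gen (Ap i) - scal (qp h 1) * gen (Ap i) * gen (Am i) - gen (QNb (- 1) i) \<in> boson_rels h n"
    "i \<noteq> j \<Longrightarrow> comm (gen (Ap i)) (gen (Am j)) \<in> boson_rels h n"
    "gen (QNb 0 i) - 1 \<in> boson_rels h n"
    "gen (QNb c i) * gen (QNb d i) - gen (QNb (c + d) i) \<in> boson_rels h n"
    "comm (gen (QNb c i)) (gen (QNb d j)) \<in> boson_rels h n"
    "comm (gen (QNb c i)) (gen (Nb j)) \<in> boson_rels h n"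
    "gen (QNb c i) * gen (Ap j) - scal (qp h (c * delta i j)) * gen (Ap j) * gen (QNb c i) \<in> boson_rels h n"
    "gen (QNb c i) * gen (Am j) - scal (qp h (- c * delta i j)) * gen (Am j) * gen (QNb c i) \<in> boson_rels h n"
  unfolding boson_rels_def
  by (rule UN_I[OF assms(1)], rule UN_I[OF assms(2)], simp; blast)+

locale bosons = falg_hom \<Phi> for \<Phi> :: "boson falg \<Rightarrow> 'a::calg" +
  fixes h :: complex and n :: nat
  assumes boson_rels: "x \<in> boson_rels h n \<Longrightarrow> \<Phi> x = 0"
    and q_ne: "qp h 1 \<noteq> qp h (- 1)"
begin

abbreviation "ap i \<equiv> \<Phi> (gen (Ap i))"
abbreviation "am i \<equiv> \<Phi> (gen (Am i))"
abbreviation "nb i \<equiv> \<Phi> (gen (Nb i))"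
abbreviation "qn c i \<equiv> \<Phi> (gen (QNb c i))"

lemma unit: "\<Phi> 1 * \<Phi> x = \<Phi> x" "\<Phi> x * \<Phi> 1 = \<Phi> x"
  by (simp_all add: mult[symmetric])

lemma relations:
  assumes "i \<in> {1..n}" "j \<in> {1..n}"
  shows "nb i * nb j = nb j * nb i"
    "nb i * ap j = ap j * nb i + delta i j \<cdot>\<^sub>C ap j"
    "nb i * am j = am j * nb i - delta i j \<cdot>\<^sub>C am j"
    "ap i * ap j = ap j * ap i"
    "am i * am j = am j * am i"
    "am i * ap i = qp h (- 1) \<cdot>\<^sub>C (ap i * am i) + qn 1 i"
    "am i * ap i = qp h 1 \<cdot>\<^sub>C (ap i * am i) + qn (- 1) i"
    "i \<noteq> j \<Longrightarrow> ap i * am j = am j * ap i"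
    "qn 0 i = \<Phi> 1"
    "qn c i * qn d i = qn (c + d) i"
    "qn c i * qn d j = qn d j * qn c i"
    "qn c i * nb j = nb j * qn c i"
    "qn c i * ap j = qp h (c * delta i j) \<cdot>\<^sub>C (ap j * qn c i)"
    "qn c i * am j = qp h (- c * delta i j) \<cdot>\<^sub>C (am j * qn c i)"
proof -
  note R = boson_relsI[OF assms, THEN boson_rels]
  show "nb i * nb j = nb j * nb i" using R(1) by (simp add: comm)
  show "nb i * ap j = ap j * nb i + delta i j \<cdot>\<^sub>C ap j"
    using R(2) by (simp only: comm diff scale) (simp add: algebra_simps)
  show "nb i * am j = am j * nb i - delta i j \<cdot>\<^sub>C am j"
    using R(3) by (simp only: comm add scale) (simp add: algebra_simps add_eq_0_iff)
  show "ap i * ap j = ap j * ap i" using R(4) by (simp add: comm)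
  show "am i * am j = am j * am i" using R(5) by (simp add: comm)
  show "am i * ap i = qp h (- 1) \<cdot>\<^sub>C (ap i * am i) + qn 1 i"
    using R(6) by (simp only: diff scale_mult) (simp add: mult algebra_simps)
  show "am i * ap i = qp h 1 \<cdot>\<^sub>C (ap i * am i) + qn (- 1) i"
    using R(7) by (simp only: diff scale_mult) (simp add: mult algebra_simps)
  show "ap i * am j = am j * ap i" if "i \<noteq> j" using R(8)[OF that] by (simp add: comm)
  show "qn 0 i = \<Phi> 1" using R(9) by (simp add: diff)
  show "qn c i * qn d i = qn (c + d) i" using R(10)[of c d] by (simp add: diff mult)
  show "qn c i * qn d j = qn d j * qn c i" using R(11)[of c d] by (simp add: comm)
  show "qn c i * nb j = nb j * qn c i" using R(12)[of c] by (simp add: comm)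
  show "qn c i * ap j = qp h (c * delta i j) \<cdot>\<^sub>C (ap j * qn c i)"
    using R(13)[of c] by (simp only: diff scale_mult) (simp add: mult)
  show "qn c i * am j = qp h (- c * delta i j) \<cdot>\<^sub>C (am j * qn c i)"
    using R(14)[of c] by (simp only: diff scale_mult) (simp add: mult)
qed

definition bil :: "nat \<Rightarrow> nat \<Rightarrow> 'a" where
  "bil i j = ap i * am j"

text \<open>Truncated at k for induction. The product is formed in the free algebra and then mapped,
  since an empty product in the target would need a unit.\<close>

definition numpow_upto :: "nat \<Rightarrow> (nat \<Rightarrow> complex) \<Rightarrow> 'a" where
  "numpow_upto k f = \<Phi> (prod_list (map (\<lambda>i. gen (QNb (f i) i)) [1..<Suc k]))"

abbreviation numpow :: "(nat \<Rightarrow> complex) \<Rightarrow> 'a" where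
  "numpow \<equiv> numpow_upto n"

definition num :: "(nat \<Rightarrow> complex) \<Rightarrow> 'a" where
  "num f = (\<Sum>i\<in>{1..n}. f i \<cdot>\<^sub>C nb i)"

lemma numpow_upto_0: "numpow_upto 0 f = \<Phi> 1"
  by (simp add: numpow_upto_def)

lemma numpow_upto_Suc: "numpow_upto (Suc k) f = numpow_upto k f * qn (f (Suc k)) (Suc k)"
  by (simp add: numpow_upto_def mult)

lemma numpow_upto_cong: "(\<And>i. i \<in> {1..k} \<Longrightarrow> f i = g i) \<Longrightarrow> numpow_upto k f = numpow_upto k g"
  unfolding numpow_upto_def by (intro arg_cong[where f = \<Phi>] arg_cong[where f = prod_list] map_cong) auto

lemma numpow_upto_qn: "k \<le> n \<Longrightarrow> j \<in> {1..n} \<Longrightarrow> numpow_upto k f * qn c j = qn c j * numpow_upto k f"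
proof (induction k)
  case (Suc k)
  have "qn (f (Suc k)) (Suc k) * qn c j = qn c j * qn (f (Suc k)) (Suc k)"
    using Suc by (intro relations(11)) auto
  then show ?case
    using Suc by (simp add: numpow_upto_Suc) (metis mult.assoc)
qed (simp add: numpow_upto_0 unit)

lemma numpow_upto_nb: "k \<le> n \<Longrightarrow> j \<in> {1..n} \<Longrightarrow> numpow_upto k f * nb j = nb j * numpow_upto k f"
proof (induction k)
  case (Suc k)
  have "qn (f (Suc k)) (Suc k) * nb j = nb j * qn (f (Suc k)) (Suc k)"
    using Suc by (intro relations(12)) auto
  then show ?case
    using Suc by (simp add: numpow_upto_Suc) (metis mult.assoc)
qed (simp add: numpow_upto_0 unit)

lemma numpow_upto_mult: "k \<le> n \<Longrightarrow> numpow_upto k f * numpow_upto k g = numpow_upto k (\<lambda>i. f i + g i)"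
proof (induction k)
  case (Suc k)
  let ?q = "\<lambda>f. qn (f (Suc k)) (Suc k)"
  have "numpow_upto (Suc k) f * numpow_upto (Suc k) g
      = numpow_upto k f * (?q f * numpow_upto k g) * ?q g"
    by (simp add: numpow_upto_Suc mult.assoc)
  also have "?q f * numpow_upto k g = numpow_upto k g * ?q f"
    using Suc.prems by (simp add: numpow_upto_qn)
  also have "numpow_upto k f * (numpow_upto k g * ?q f) * ?q g
      = (numpow_upto k f * numpow_upto k g) * (?q f * ?q g)"
    by (simp add: mult.assoc)
  also have "?q f * ?q g = qn (f (Suc k) + g (Suc k)) (Suc k)"
    using Suc.prems relations(10)[of "Suc k" "Suc k"] by simp
  finally show ?case
    using Suc by (simp add: numpow_upto_Suc)
qed (simp add: numpow_upto_0 unit)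

lemma numpow_upto_ap_am:
  assumes "j \<in> {1..n}" "k \<le> n"
  shows "numpow_upto k f * ap j = qp h (if j \<le> k then f j else 0) \<cdot>\<^sub>C (ap j * numpow_upto k f)"
    and "numpow_upto k f * am j = qp h (if j \<le> k then - f j else 0) \<cdot>\<^sub>C (am j * numpow_upto k f)"
  using assms(2)
proof (induction k)
  case 0
  {
    case 1 then show ?case using assms by (simp add: numpow_upto_0 unit)
  next
    case 2 then show ?case using assms by (simp add: numpow_upto_0 unit)
  }
next
  case (Suc k)
  let ?q = "qn (f (Suc k)) (Suc k)"
  {
    case 1
    have "numpow_upto (Suc k) f * ap j = numpow_upto k f * (?q * ap j)"
      by (simp add: numpow_upto_Suc mult.assoc)
    also have "?q * ap j = qp h (f (Suc k) * delta (Suc k) j) \<cdot>\<^sub>C (ap j * ?q)"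
      using 1 assms(1) by (intro relations(13)) auto
    also have "numpow_upto k f * (qp h (f (Suc k) * delta (Suc k) j) \<cdot>\<^sub>C (ap j * ?q))
        = qp h (f (Suc k) * delta (Suc k) j) \<cdot>\<^sub>C (numpow_upto k f * ap j * ?q)"
      by (simp add: cscale_mult_right mult.assoc)
    also have "\<dots> = qp h (if j \<le> Suc k then f j else 0) \<cdot>\<^sub>C (ap j * numpow_upto (Suc k) f)"
      using Suc.IH(1) 1
      by (auto simp: numpow_upto_Suc delta_def cscale_cscale cscale_mult_left mult.assoc le_Suc_eq)
    finally show ?case .
  next
    case 2
    have "numpow_upto (Suc k) f * am j = numpow_upto k f * (?q * am j)"
      by (simp add: numpow_upto_Suc mult.assoc)
    also have "?q * am j = qp h (- f (Suc k) * delta (Suc k) j) \<cdot>\<^sub>C (am j * ?q)"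
      using 2 assms(1) by (intro relations(14)) auto
    also have "numpow_upto k f * (qp h (- f (Suc k) * delta (Suc k) j) \<cdot>\<^sub>C (am j * ?q))
        = qp h (- f (Suc k) * delta (Suc k) j) \<cdot>\<^sub>C (numpow_upto k f * am j * ?q)"
      by (simp add: cscale_mult_right mult.assoc)
    also have "\<dots> = qp h (if j \<le> Suc k then - f j else 0) \<cdot>\<^sub>C (am j * numpow_upto (Suc k) f)"
      using Suc.IH(2) 2
      by (auto simp: numpow_upto_Suc delta_def cscale_cscale cscale_mult_left mult.assoc le_Suc_eq)
    finally show ?case .
  }
qed

lemma numpow_ap: "j \<in> {1..n} \<Longrightarrow> numpow f * ap j = qp h (f j) \<cdot>\<^sub>C (ap j * numpow f)"
  and numpow_am: "j \<in> {1..n} \<Longrightarrow> numpow f * am j = qp h (- f j) \<cdot>\<^sub>C (am j * numpow f)"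
  using numpow_upto_ap_am[of j n f] by simp_all

lemma numpow_single:
  assumes i: "i \<in> {1..n}"
  shows "numpow (\<lambda>k. c * of_bool (k = i)) = qn c i"
proof -
  have "numpow_upto k (\<lambda>k. c * of_bool (k = i)) = (if i \<le> k then qn c i else \<Phi> 1)" if "k \<le> n" for k
    using that
  proof (induction k)
    case (Suc k)
    have "qn 0 (Suc k) = \<Phi> 1"
      using Suc.prems by (intro relations(9)) auto
    then show ?case
      using Suc unit by (auto simp: numpow_upto_Suc le_Suc_eq)
  qed (use i in \<open>simp add: numpow_upto_0\<close>)
  then show ?thesis using i by simp
qed

lemma numpow_0: "numpow (\<lambda>_. 0) = \<Phi> 1"
proof -
  have "numpow_upto k (\<lambda>_. 0) = \<Phi> 1" if "k \<le> n" for k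
    using that
  proof (induction k)
    case (Suc k)
    then show ?case
      using relations(9)[of "Suc k" "Suc k"] unit by (auto simp: numpow_upto_Suc)
  qed (simp add: numpow_upto_0)
  then show ?thesis by simp
qed

lemma qn_qn_inverse:
  assumes "i \<in> {1..n}" "j \<in> {1..n}"
  shows "qn c i * qn (- c) j = numpow (\<lambda>k. c * (of_bool (k = i) - of_bool (k = j)))"
  using assms numpow_upto_mult[of n "\<lambda>k. c * of_bool (k = i)" "\<lambda>k. - c * of_bool (k = j)"]
    numpow_single[of i c] numpow_single[of j "- c"]
  by (simp add: right_diff_distrib)

lemma num_single: "i \<in> {1..n} \<Longrightarrow> num (\<lambda>k. of_bool (k = i)) = nb i"
  unfolding num_def by (subst sum.remove[of _ i]) (auto intro!: sum.neutral)

lemma num_linear: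
  "num (\<lambda>k. f k - g k) = num f - num g"
  "num (\<lambda>k. \<Sum>s\<in>A. F s k) = (\<Sum>s\<in>A. num (F s))"
proof -
  show "num (\<lambda>k. f k - g k) = num f - num g"
    by (simp add: num_def cscale_diff_left sum_subtractf)
  have "(\<Sum>s\<in>A. c s) \<cdot>\<^sub>C x = (\<Sum>s\<in>A. c s \<cdot>\<^sub>C x)" for c and x :: 'a
    by (induction A rule: infinite_finite_induct) (simp_all add: cscale_add_left)
  then show "num (\<lambda>k. \<Sum>s\<in>A. F s k) = (\<Sum>s\<in>A. num (F s))"
    unfolding num_def by (subst sum.swap) simp
qed

lemma num_ap: "j \<in> {1..n} \<Longrightarrow> num f * ap j = ap j * num f + f j \<cdot>\<^sub>C ap j"
  and num_am: "j \<in> {1..n} \<Longrightarrow> num f * am j = am j * num f - f j \<cdot>\<^sub>C am j"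
proof -
  assume j: "j \<in> {1..n}"
  have s: "(\<Sum>i\<in>{1..n}. (f i * delta i j) \<cdot>\<^sub>C x) = f j \<cdot>\<^sub>C x" for x :: 'a
    using j by (subst sum.remove[of _ j]) (auto simp: delta_def intro!: sum.neutral)
  have "num f * ap j = (\<Sum>i\<in>{1..n}. ap j * (f i \<cdot>\<^sub>C nb i) + (f i * delta i j) \<cdot>\<^sub>C ap j)"
    unfolding num_def sum_distrib_right using j
    by (intro sum.cong) (simp_all add: cscale_mult_left relations(2) cscale_add_right cscale_mult_right cscale_cscale)
  then show "num f * ap j = ap j * num f + f j \<cdot>\<^sub>C ap j"
    by (simp only: sum.distrib s num_def sum_distrib_left)
  have "num f * am j = (\<Sum>i\<in>{1..n}. am j * (f i \<cdot>\<^sub>C nb i) - (f i * delta i j) \<cdot>\<^sub>C am j)"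
    unfolding num_def sum_distrib_right using j
    by (intro sum.cong) (simp_all add: cscale_mult_left relations(3) cscale_diff_right cscale_mult_right cscale_cscale)
  then show "num f * am j = am j * num f - f j \<cdot>\<^sub>C am j"
    by (simp only: sum_subtractf s num_def sum_distrib_left)
qed

sublocale boson_bilinears h "{1..n}" bil numpow num
proof
  let ?q = "qp h 1" and ?p = "qp h (- 1)"
  show "numpow f = numpow g" if "\<And>i. i \<in> {1..n} \<Longrightarrow> f i = g i" for f g
    using that by (rule numpow_upto_cong)
  fix f g :: "nat \<Rightarrow> complex"
  show "numpow f * numpow g = numpow (\<lambda>i. f i + g i)"
    by (simp add: numpow_upto_mult)
  show "num f * numpow g = numpow g * num f"
    unfolding num_def sum_distrib_left sum_distrib_right
    by (intro sum.cong) (simp_all add: cscale_mult_left cscale_mult_right numpow_upto_nb)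
  show "num f * num g = num g * num f"
    unfolding num_def sum_product
    by (subst sum.swap, intro sum.cong refl)
       (simp add: cscale_mult_left cscale_mult_right cscale_cscale relations(1) mult.commute[of "f _"])
  fix i j k l
  assume ij: "i \<in> {1..n}" "j \<in> {1..n}"
  {
    assume "i \<noteq> j"
    have "numpow f * bil i j = (numpow f * ap i) * am j"
      by (simp add: bil_def mult.assoc)
    also have "\<dots> = qp h (f i) \<cdot>\<^sub>C (ap i * (numpow f * am j))"
      using ij by (simp add: numpow_ap cscale_mult_left mult.assoc)
    also have "\<dots> = qp h (f i - f j) \<cdot>\<^sub>C (bil i j * numpow f)"
      using ij qp_add[of h "f i" "- f j"]
      by (simp add: numpow_am cscale_mult_right cscale_cscale bil_def mult.assoc)
    finally show "numpow f * bil i j = qp h (f i - f j) \<cdot>\<^sub>C (bil i j * numpow f)" .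
    have "num f * bil i j = (num f * ap i) * am j"
      by (simp add: bil_def mult.assoc)
    also have "\<dots> = ap i * (num f * am j) + f i \<cdot>\<^sub>C (ap i * am j)"
      using ij by (simp add: num_ap distrib_right cscale_mult_left mult.assoc)
    also have "\<dots> = bil i j * num f + (f i - f j) \<cdot>\<^sub>C bil i j"
      using ij by (simp add: num_am right_diff_distrib cscale_mult_right cscale_diff_left bil_def mult.assoc)
    finally show "num f * bil i j = bil i j * num f + (f i - f j) \<cdot>\<^sub>C bil i j" .
  }
  {
    assume ne: "i \<noteq> j"
    define c where "c = 1 / (?q - ?p)"
    have qp: "?q - ?p \<noteq> 0" using q_ne by simp
    \<comment> \<open>The two boson relations are a linear system in a^+ a^- and a^- a^+ with
      determinant +-(q - q^-1); its solution is [N]_q here and [N+1]_q in \<open>M\<close>.\<close>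
    have N: "ap i * am i = c \<cdot>\<^sub>C (qn 1 i - qn (- 1) i)" if "i \<in> {1..n}" for i
    proof -
      have "(?q - ?p) \<cdot>\<^sub>C (ap i * am i) = qn 1 i - qn (- 1) i"
        using relations(6,7)[OF that that] by (simp add: cscale_diff_left algebra_simps)
      then have "c \<cdot>\<^sub>C ((?q - ?p) \<cdot>\<^sub>C (ap i * am i)) = c \<cdot>\<^sub>C (qn 1 i - qn (- 1) i)"
        by simp
      then show ?thesis using qp by (simp add: cscale_cscale c_def)
    qed
    have M: "am i * ap i = c \<cdot>\<^sub>C (?q \<cdot>\<^sub>C qn 1 i - ?p \<cdot>\<^sub>C qn (- 1) i)" if "i \<in> {1..n}" for i
    proof -
      have "am i * ap i = ?p \<cdot>\<^sub>C (c \<cdot>\<^sub>C (qn 1 i - qn (- 1) i)) + (c * (?q - ?p)) \<cdot>\<^sub>C qn 1 i"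
        using relations(6)[OF that that] N[OF that] qp by (simp add: c_def)
      also have "\<dots> = c \<cdot>\<^sub>C (?q \<cdot>\<^sub>C qn 1 i - ?p \<cdot>\<^sub>C qn (- 1) i)"
        by (simp add: cscale_diff_right cscale_diff_left cscale_cscale right_diff_distrib mult.commute)
      finally show ?thesis .
    qed
    have comm: "qn d j * qn c i = qn c i * qn d j" for c d
      using ij by (intro relations(11))
    have e: "bil i j * bil j i = (ap i * am i) * (am j * ap j)" if "i \<in> {1..n}" "j \<in> {1..n}" "i \<noteq> j" for i j
    proof -
      have "bil i j * bil j i = ap i * (am j * ap j * am i)"
        by (simp add: bil_def mult.assoc)
      also have "am j * ap j * am i = am i * (am j * ap j)"
        using that relations(5)[of i j] relations(8)[of j i] by (metis mult.assoc)
      finally show ?thesis by (simp add: mult.assoc)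
    qed
    \<comment> \<open>This is the identity [x][y+1] - [y][x+1] = [x-y] for q-numbers.\<close>
    have "bil i j * bil j i - bil j i * bil i j
        = (c * c) \<cdot>\<^sub>C ((?q - ?p) \<cdot>\<^sub>C (qn 1 i * qn (- 1) j - qn 1 j * qn (- 1) i))"
      using ij ne
      by (simp add: e N M comm cscale_add_right cscale_mult_left cscale_mult_right cscale_cscale cscale_diff_right
          cscale_diff_left left_diff_distrib right_diff_distrib algebra_simps)
    also have "\<dots> = c \<cdot>\<^sub>C (qn 1 i * qn (- 1) j - qn 1 j * qn (- 1) i)"
      using qp by (simp add: cscale_cscale c_def)
    finally show "bil i j * bil j i - bil j i * bil i j
        = (1 / (?q - ?p)) \<cdot>\<^sub>C (numpow (\<lambda>k. of_bool (k = i) - of_bool (k = j))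
          - numpow (\<lambda>k. of_bool (k = j) - of_bool (k = i)))"
      using qn_qn_inverse[of i j 1] qn_qn_inverse[of j i 1] ij by (simp add: c_def)
  }
  assume l: "l \<in> {1..n}"
  {
    assume k: "k \<in> {1..n}" "i \<noteq> j" "k \<noteq> l" "j \<noteq> k" "i \<noteq> l"
    have c: "am j * ap k = ap k * am j" "ap i * ap k = ap k * ap i"
      "am j * am l = am l * am j" "ap i * am l = am l * ap i"
      using ij k l relations(4)[of i k] relations(5)[of j l] relations(8)[of k j] relations(8)[of i l]
      by simp_all
    have "bil i j * bil k l = ap i * (am j * ap k) * am l"
      by (simp add: bil_def mult.assoc)
    also have "\<dots> = (ap i * ap k) * (am j * am l)"
      unfolding c(1) unfolding mult.assoc ..
    also have "\<dots> = ap k * (ap i * am l) * am j"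
      unfolding c(2,3) unfolding mult.assoc ..
    also have "\<dots> = bil k l * bil i j"
      unfolding c(4) by (simp add: bil_def mult.assoc)
    finally show "bil i j * bil k l = bil k l * bil i j" .
  }
  fix a :: complex
  assume A: "i \<noteq> j" "j \<noteq> l" "i \<noteq> l" "a = 1 \<or> a = - 1"
  have 1: "bil i j * bil j l = bil i l * (am j * ap j)"
  proof -
    have "am j * ap j * am l = am l * (am j * ap j)"
      using ij l A relations(5)[of l j] relations(8)[of j l] by (metis mult.assoc)
    then show ?thesis by (simp add: bil_def mult.assoc)
  qed
  have 2: "bil j l * bil i j = bil i l * (ap j * am j)"
  proof -
    have c: "am l * ap i = ap i * am l" "ap j * ap i = ap i * ap j" "ap j * am l = am l * ap j"
      using ij l A relations(4)[of i j] relations(8)[of j l] relations(8)[of i l] by simp_all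
    have "bil j l * bil i j = ap j * (am l * ap i) * am j"
      by (simp add: bil_def mult.assoc)
    also have "\<dots> = (ap j * ap i) * am l * am j"
      unfolding c(1) unfolding mult.assoc ..
    also have "\<dots> = ap i * (ap j * am l) * am j"
      unfolding c(2) unfolding mult.assoc ..
    also have "\<dots> = bil i l * (ap j * am j)"
      unfolding c(3) by (simp add: bil_def mult.assoc)
    finally show ?thesis .
  qed
  \<comment> \<open>The two signs of \<open>a\<close> are the two defining q-boson
    relations.\<close>
  have 3: "am j * ap j - qp h a \<cdot>\<^sub>C (ap j * am j) = qn (- a) j"
  proof (cases "a = 1")
    case True
    then show ?thesis by (simp add: relations(7)[OF ij(2) ij(2)])
  next
    case False
    then show ?thesis using A(4) by (simp add: relations(6)[OF ij(2) ij(2)])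
  qed
  have "bil i j * bil j l - qp h a \<cdot>\<^sub>C (bil j l * bil i j)
      = bil i l * (am j * ap j - qp h a \<cdot>\<^sub>C (ap j * am j))"
    by (simp add: 1 2 right_diff_distrib cscale_mult_right)
  then show "bil i j * bil j l - qp h a \<cdot>\<^sub>C (bil j l * bil i j)
      = bil i l * numpow (\<lambda>k. - a * of_bool (k = j))"
    using numpow_single[OF ij(2), of "- a"] by (simp add: 3)
qed

end

section \<open>Images of the generators\<close>

text \<open>The coefficient of \<open>N\<^sub>l\<close> in the image of the linear form encoded by \<open>f\<close>.\<close>
definition chev_form :: "nat \<Rightarrow> (nat \<Rightarrow> complex) \<Rightarrow> nat \<Rightarrow> complex" where
  "chev_form n f l = f 0 + (if l < n then f l else 0) - (if 2 \<le> l then f (l - 1) else 0)"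

lemma chev_form_linear:
  "chev_form n (\<lambda>l. c * f l) l = c * chev_form n f l"
  "chev_form n (\<lambda>l. f l + g l) l = chev_form n f l + chev_form n g l"
  "chev_form n (\<lambda>l. f l - g l) l = chev_form n f l - chev_form n g l"
  "chev_form n (\<lambda>l. \<Sum>s\<in>A. F s l) l = (\<Sum>s\<in>A. chev_form n (F s) l)"
  by (simp_all add: chev_form_def algebra_simps sum.distrib sum_subtractf)

lemma chev_form_Hform:
  assumes "i \<in> {1..n}" "j \<in> {1..n}" "l \<in> {1..n}"
  shows "chev_form n (Hform i j) l = of_bool (l = i) - of_bool (l = j)"
  using assms by (auto simp: chev_form_def Hform_def)

lemma chev_form_Nform: "l \<in> {1..n} \<Longrightarrow> chev_form n Nform l = 1"
  by (simp add: chev_form_def Nform_def)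

text \<open>The k2 - 1 forms H_{1 \<sigma>} subtracted in \<Lambda>_t contain (k2 - 1) N_1, and the
  fraction is chosen so that the first summand restores precisely this. What remains is the sum of
  the N_\<sigma> strictly between t - k2 and t.\<close>

lemma chev_form_Lam:
  assumes k: "1 \<le> k1" "1 \<le> k2" and l: "l \<in> {1..k1 * k2}" and t: "k2 < t" "t \<le> k1 * k2"
  shows "chev_form (k1 * k2) (Lam k1 k2 t) l = of_bool (t - k2 < l \<and> l < t)"
proof -
  let ?n = "k1 * k2" and ?one = "of_bool (l = 1) :: complex"
  have n: "1 \<le> ?n" using k by simp
  have 1: "(\<Sum>\<sigma>\<in>{a..b}. chev_form ?n (Hform 1 \<sigma>) l) = of_nat (Suc b - a) * ?one - of_bool (a \<le> l \<and> l \<le> b)"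
    if "1 \<le> a" "b \<le> ?n" for a b
  proof -
    have "(\<Sum>\<sigma>\<in>{a..b}. chev_form ?n (Hform 1 \<sigma>) l) = (\<Sum>\<sigma>\<in>{a..b}. ?one - of_bool (l = \<sigma>))"
      using that l n by (intro sum.cong) (auto simp: chev_form_Hform)
    also have "\<dots> = of_nat (Suc b - a) * ?one - of_bool (a \<le> l \<and> l \<le> b)"
      by (simp add: sum_subtractf of_bool_def)
    finally show ?thesis .
  qed
  have S: "(\<Sum>\<sigma>\<in>{2..?n}. chev_form ?n (Hform 1 \<sigma>) l) = of_nat (?n - 1) * ?one - of_bool (2 \<le> l)"
    "(\<Sum>\<sigma>\<in>{t-k2+1..t-1}. chev_form ?n (Hform 1 \<sigma>) l)
      = of_nat (k2 - 1) * ?one - of_bool (t - k2 < l \<and> l < t)"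
  proof -
    have "Suc (t - 1) - (t - k2 + 1) = k2 - 1" "t - k2 + 1 \<le> l \<and> l \<le> t - 1 \<longleftrightarrow> t - k2 < l \<and> l < t"
      using t k by auto
    then show "(\<Sum>\<sigma>\<in>{t-k2+1..t-1}. chev_form ?n (Hform 1 \<sigma>) l)
      = of_nat (k2 - 1) * ?one - of_bool (t - k2 < l \<and> l < t)"
      using 1[of "t - k2 + 1" "t - 1"] t by simp
  qed (use 1[of 2 ?n] l in simp)
  have "chev_form ?n (Lam k1 k2 t) l
      = (of_nat k2 - 1) / (of_nat k1 * of_nat k2)
          * (chev_form ?n Nform l + (\<Sum>\<sigma>\<in>{2..?n}. chev_form ?n (Hform 1 \<sigma>) l))
        - (\<Sum>\<sigma>\<in>{t-k2+1..t-1}. chev_form ?n (Hform 1 \<sigma>) l)"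
    unfolding Lam_def[abs_def] by (simp only: chev_form_linear)
  also have "\<dots> = (of_nat k2 - 1) / of_nat ?n * (1 + of_nat (?n - 1) * ?one - of_bool (2 \<le> l))
      - (of_nat (k2 - 1) * ?one - of_bool (t - k2 < l \<and> l < t))"
    by (simp only: S chev_form_Nform[OF l] of_nat_mult) (simp only: add_diff_eq)
  also have "\<dots> = of_bool (t - k2 < l \<and> l < t)"
    using l n k by (cases "l = 1") (auto simp: of_nat_diff simp del: of_nat_mult)
  finally show ?thesis .
qed

section \<open>Row-major numbering of the grid\<close>

definition cell :: "nat \<Rightarrow> nat \<times> nat \<Rightarrow> nat" where
  "cell k = (\<lambda>(\<rho>, \<kappa>). (\<rho> - 1) * k + \<kappa>)"

definition cell_inv :: "nat \<Rightarrow> nat \<Rightarrow> nat \<times> nat" where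
  "cell_inv k l = ((l - 1) div k + 1, (l - 1) mod k + 1)"

lemma cell_inv_cell: "1 \<le> \<rho> \<Longrightarrow> \<kappa> \<in> {1..k} \<Longrightarrow> cell_inv k (cell k (\<rho>, \<kappa>)) = (\<rho>, \<kappa>)"
  by (cases \<rho>; cases \<kappa>) (auto simp: cell_def cell_inv_def)

lemma cell_range: "p \<in> {1..m} \<times> {1..k} \<Longrightarrow> cell k p \<in> {1..m * k}"
proof -
  assume "p \<in> {1..m} \<times> {1..k}"
  then obtain \<rho> \<kappa> where p: "p = (\<rho>, \<kappa>)" "1 \<le> \<rho>" "\<rho> \<le> m" "1 \<le> \<kappa>" "\<kappa> \<le> k" by auto
  have "(\<rho> - 1) * k + \<kappa> \<le> (\<rho> - 1) * k + k" using p by simp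
  also have "\<dots> = \<rho> * k" using p by (cases \<rho>) simp_all
  also have "\<dots> \<le> m * k" using p by simp
  finally show ?thesis using p by (simp add: cell_def)
qed

lemma cell_inv_range:
  assumes "l \<in> {1..m * k}"
  shows "cell_inv k l \<in> {1..m} \<times> {1..k} \<and> cell k (cell_inv k l) = l"
proof -
  have k: "k > 0" using assms by (cases k) auto
  have "(l - 1) div k < m" "(l - 1) mod k < k"
    using assms k by (auto simp: less_mult_imp_div_less mod_less_divisor)
  then show ?thesis
    using assms by (auto simp: cell_inv_def cell_def)
qed

text \<open>Roots of height k therefore move a boson along a column, simple roots move it along a
  row.\<close>

lemma cell_Suc: "1 \<le> \<rho> \<Longrightarrow> cell k (Suc \<rho>, \<kappa>) = cell k (\<rho>, \<kappa>) + k" "cell k (\<rho>, Suc \<kappa>) = cell k (\<rho>, \<kappa>) + 1"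
  by (cases \<rho>; simp add: cell_def)+

lemma eq_cell_iff:
  assumes "l \<in> {1..m * k}" "cell_inv k l = (\<rho>, \<kappa>)" "1 \<le> \<mu>" "\<nu> \<in> {1..k}"
  shows "l = cell k (\<mu>, \<nu>) \<longleftrightarrow> \<mu> = \<rho> \<and> \<nu> = \<kappa>"
proof -
  have "cell k (\<rho>, \<kappa>) = l" "cell_inv k (cell k (\<mu>, \<nu>)) = (\<mu>, \<nu>)"
    using cell_inv_range[OF assms(1)] cell_inv_cell[OF assms(3,4)] assms(2) by simp_all
  then show ?thesis using assms(2) by (metis prod.inject)
qed

lemma sum_block:
  assumes "1 \<le> \<mu>"
  shows "(\<Sum>s\<in>{(\<mu>-1)*k+1..\<mu>*k}. F s) = (\<Sum>\<kappa>\<in>{1..k}. F (cell k (\<mu>, \<kappa>)))"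
proof -
  have "\<mu> * k = k + (\<mu> - 1) * k" using assms by (cases \<mu>) simp_all
  then show ?thesis
    using sum.shift_bounds_cl_nat_ivl[of F 1 "(\<mu> - 1) * k" k] by (simp add: cell_def add.commute)
qed

lemma sum_rows:
  assumes l: "l \<in> {1..m * k}" and \<mu>: "1 \<le> \<mu>"
  shows "(\<Sum>\<nu>\<in>{1..k}. g \<nu> * (of_bool (l = cell k (\<mu>, \<nu>)) - of_bool (l = cell k (Suc \<mu>, \<nu>))))
    = g (snd (cell_inv k l)) * wt \<mu> (cell_inv k l)"
proof -
  obtain \<rho> \<kappa> where p: "cell_inv k l = (\<rho>, \<kappa>)" by fastforce
  have \<kappa>: "\<kappa> \<in> {1..k}" using conjunct1[OF cell_inv_range[OF l]] p by simp
  have "(\<Sum>\<nu>\<in>{1..k}. g \<nu> * (of_bool (l = cell k (\<mu>, \<nu>)) - of_bool (l = cell k (Suc \<mu>, \<nu>))))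
      = (\<Sum>\<nu>\<in>{1..k}. if \<nu> = \<kappa> then g \<nu> * wt \<mu> (\<rho>, \<kappa>) else 0)"
    by (intro sum.cong refl) (auto simp: eq_cell_iff[OF l p] \<mu>[simplified] wt_def)
  also have "\<dots> = g \<kappa> * wt \<mu> (\<rho>, \<kappa>)"
    using \<kappa> by simp
  finally show ?thesis by (simp add: p)
qed

text \<open>The bound s < k keeps \<open>Suc s\<close> in the same row; at s = k the next index
  would wrap around.\<close>

lemma sum_columns:
  assumes l: "l \<in> {1..m * k}" and s: "s \<in> {1..<k}"
  shows "(\<Sum>\<sigma>\<in>{1..m}. g \<sigma> * (of_bool (l = cell k (\<sigma>, s)) - of_bool (l = cell k (\<sigma>, Suc s))))
    = g (fst (cell_inv k l)) * wt s (prod.swap (cell_inv k l))"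
proof -
  obtain \<rho> \<kappa> where p: "cell_inv k l = (\<rho>, \<kappa>)" by fastforce
  have \<rho>: "\<rho> \<in> {1..m}" using conjunct1[OF cell_inv_range[OF l]] p by simp
  have "(\<Sum>\<sigma>\<in>{1..m}. g \<sigma> * (of_bool (l = cell k (\<sigma>, s)) - of_bool (l = cell k (\<sigma>, Suc s))))
      = (\<Sum>\<sigma>\<in>{1..m}. if \<sigma> = \<rho> then g \<sigma> * wt s (\<kappa>, \<rho>) else 0)"
    using s by (intro sum.cong refl) (auto simp: eq_cell_iff[OF l p] wt_def)
  also have "\<dots> = g \<rho> * wt s (\<kappa>, \<rho>)"
    using \<rho> by simp
  finally show ?thesis by (simp add: p)
qed

section \<open>Images of Cartan powers and Cartan-Weyl elements\<close>

context bosons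
begin

abbreviation img :: "chev falg \<Rightarrow> 'a" where
  "img x \<equiv> \<Phi> (fext (boson_img n) x)"

sublocale img: falg_hom img
  by (rule fext_hom)

lemma img_gen:
  "i \<in> {1..<n} \<Longrightarrow> img (gen (H i)) = num (\<lambda>k. of_bool (k = i) - of_bool (k = Suc i))"
  "i \<in> {1..<n} \<Longrightarrow> img (gen (QH c i)) = numpow (\<lambda>k. c * (of_bool (k = i) - of_bool (k = Suc i)))"
  "img (gen (Yp i)) = bil i (Suc i)" "img (gen (Ym i)) = bil (Suc i) i"
  "img (gen NT) = num (\<lambda>_. 1)" "img (gen (QN c)) = numpow (\<lambda>_. c)" "img 1 = numpow (\<lambda>_. 0)"
proof -
  show "img (gen NT) = num (\<lambda>_. 1)" "img (gen (QN c)) = numpow (\<lambda>_. c)" for c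
    by (simp_all add: fext_gen sum num_def numpow_upto_def)
qed (simp_all add: fext_gen num_linear num_single diff mult qn_qn_inverse bil_def numpow_0)

lemma num_cong: "(\<And>i. i \<in> {1..n} \<Longrightarrow> f i = g i) \<Longrightarrow> num f = num g"
  unfolding num_def by (intro sum.cong) auto

lemma img_Hel:
  assumes "1 \<le> i" "i < j" "j \<le> n"
  shows "img (Hel i j) = num (\<lambda>k. of_bool (k = i) - of_bool (k = j))"
proof -
  have "img (Hel i j) = (\<Sum>l\<in>{i..<j}. nb l - nb (Suc l))"
    using assms by (simp add: Hel_def img.diff img.sum diff zero fext_gen)
  also have "\<dots> = - (\<Sum>l\<in>{i..<j}. nb (Suc l) - nb l)"
    by (simp add: sum_negf[symmetric])
  also have "\<dots> = nb i - nb j"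
    using assms by (subst sum_Suc_diff') auto
  finally show ?thesis
    using assms by (simp add: num_linear num_single)
qed

lemma img_cartan_pow:
  assumes "1 \<le> n"
  shows "img (cartan_pow n f) = numpow (chev_form n f)"
proof -
  \<comment> \<open>The factor i puts f(i) on N_i and -f(i) on N_{i+1}, so after k factors the
    negative part already reaches k + 1.\<close>
  have *: "img (prod_list (map (\<lambda>i. gen (QH (f i) i)) [1..<Suc k]))
      = numpow (\<lambda>l. (if l \<le> k then f l else 0) - (if 2 \<le> l \<and> l \<le> Suc k then f (l - 1) else 0))"
    if "k < n" for k
    using that
  proof (induction k)
    case 0
    have "img (prod_list (map (\<lambda>i. gen (QH (f i) i)) [1..<Suc 0])) = numpow (\<lambda>_. 0)"
      by (simp add: numpow_0)
    also have "\<dots> = numpow (\<lambda>l. (if l \<le> 0 then f l else 0)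
        - (if 2 \<le> l \<and> l \<le> Suc 0 then f (l - 1) else 0))"
      by (rule K_cong) auto
    finally show ?case .
  next
    case (Suc k)
    have "img (prod_list (map (\<lambda>i. gen (QH (f i) i)) [1..<Suc (Suc k)]))
        = img (prod_list (map (\<lambda>i. gen (QH (f i) i)) [1..<Suc k])) * img (gen (QH (f (Suc k)) (Suc k)))"
      by (simp add: img.mult)
    also have "img (gen (QH (f (Suc k)) (Suc k)))
        = numpow (\<lambda>l. f (Suc k) * (of_bool (l = Suc k) - of_bool (l = Suc (Suc k))))"
      using Suc.prems by (intro img_gen) simp
    also have "img (prod_list (map (\<lambda>i. gen (QH (f i) i)) [1..<Suc k])) * \<dots>
        = numpow (\<lambda>l. (if l \<le> k then f l else 0) - (if 2 \<le> l \<and> l \<le> Suc k then f (l - 1) else 0)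
            + f (Suc k) * (of_bool (l = Suc k) - of_bool (l = Suc (Suc k))))"
      using Suc by (simp only: Suc.IH[OF Suc_lessD] K_K)
    also have "\<dots> = numpow (\<lambda>l. (if l \<le> Suc k then f l else 0)
        - (if 2 \<le> l \<and> l \<le> Suc (Suc k) then f (l - 1) else 0))"
      by (intro K_cong) (auto simp: le_Suc_eq)
    finally show ?case .
  qed
  have "img (cartan_pow n f)
      = numpow (\<lambda>_. f 0) * img (prod_list (map (\<lambda>i. gen (QH (f i) i)) [1..<Suc (n - 1)]))"
    using assms by (simp add: cartan_pow_def img.mult img_gen)
  also have "\<dots> = numpow (chev_form n f)"
    using assms unfolding *[of "n - 1", OF diff_less[OF zero_less_one less_le_trans[OF zero_less_one assms]]] K_K
    by (intro K_cong) (auto simp: chev_form_def)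
  finally show ?thesis .
qed

text \<open>Each recursion step is \<open>e_chain\<close> at the boson j, which leaves q^(-N_j)
  behind. The power collected earlier has exponent 0 at j and j+1 and commutes with the new simple
  root.\<close>

lemma img_Ypl:
  assumes "1 \<le> i" "i < j" "j \<le> n"
  shows "img (Ypl h i j) = bil i j * numpow (\<lambda>k. - of_bool (i < k \<and> k < j))"
  using assms(2,3)
proof (induction j)
  case (Suc j)
  show ?case
  proof (cases "i = j")
    case True
    have "numpow (\<lambda>k. - of_bool (i < k \<and> k < Suc i)) = numpow (\<lambda>_. 0)"
      by (rule K_cong) auto
    then show ?thesis
      using True by (simp add: img_gen bil_def numpow_0 mult[symmetric])
  next
    case False
    let ?K = "numpow (\<lambda>k. - of_bool (i < k \<and> k < j))"
    have IH: "img (Ypl h i j) = bil i j * ?K"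
      using Suc False by simp
    have c: "?K * bil j (Suc j) = bil j (Suc j) * ?K"
      using Suc.prems False assms(1) by (subst K_e) auto
    have "img (Ypl h i (Suc j)) = bil i j * (?K * bil j (Suc j)) - qp h 1 \<cdot>\<^sub>C (bil j (Suc j) * (bil i j * ?K))"
      using Suc.prems False by (simp add: img.qcomm IH img_gen mult.assoc)
    also have "\<dots> = (bil i j * bil j (Suc j) - qp h 1 \<cdot>\<^sub>C (bil j (Suc j) * bil i j)) * ?K"
      by (simp add: c left_diff_distrib cscale_mult_left mult.assoc)
    also have "\<dots> = bil i (Suc j) * (numpow (\<lambda>k. - 1 * of_bool (k = j)) * ?K)"
      using Suc.prems False assms(1) by (subst e_chain) (auto simp: mult.assoc)
    also have "numpow (\<lambda>k. - 1 * of_bool (k = j)) * ?K = numpow (\<lambda>k. - of_bool (i < k \<and> k < Suc j))"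
      unfolding K_K using Suc.prems False by (intro K_cong) auto
    finally show ?thesis .
  qed
qed simp

lemma img_Ymi:
  assumes "1 \<le> j" "j < i" "i \<le> n"
  shows "img (Ymi h i j) = bil i j * numpow (\<lambda>k. of_bool (j < k \<and> k < i))"
  using assms(2,3)
proof (induction i)
  case (Suc i)
  show ?case
  proof (cases "i = j")
    case True
    have "numpow (\<lambda>k. of_bool (j < k \<and> k < Suc j)) = numpow (\<lambda>_. 0)"
      by (rule K_cong) auto
    then show ?thesis
      using True by (simp add: img_gen bil_def numpow_0 mult[symmetric])
  next
    case False
    let ?K = "numpow (\<lambda>k. of_bool (j < k \<and> k < i))"
    have IH: "img (Ymi h i j) = bil i j * ?K"
      using Suc False by simp
    have c: "?K * bil (Suc i) i = bil (Suc i) i * ?K"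
      using Suc.prems False assms(1) by (subst K_e) auto
    have "img (Ymi h (Suc i) j) = bil (Suc i) i * (bil i j * ?K) - qp h (- 1) \<cdot>\<^sub>C (bil i j * (?K * bil (Suc i) i))"
      using Suc.prems False by (simp add: img.qcomm IH img_gen mult.assoc)
    also have "\<dots> = (bil (Suc i) i * bil i j - qp h (- 1) \<cdot>\<^sub>C (bil i j * bil (Suc i) i)) * ?K"
      by (simp add: c left_diff_distrib cscale_mult_left mult.assoc)
    also have "\<dots> = bil (Suc i) j * (numpow (\<lambda>k. - (- 1) * of_bool (k = i)) * ?K)"
      using Suc.prems False assms(1) by (subst e_chain) (auto simp: mult.assoc)
    also have "numpow (\<lambda>k. - (- 1) * of_bool (k = i)) * ?K = numpow (\<lambda>k. of_bool (j < k \<and> k < Suc i))"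
      unfolding K_K using Suc.prems False by (intro K_cong) auto
    finally show ?thesis .
  qed
qed simp

lemma img_ext_rels:
  assumes "x \<in> ext_rels h n"
  shows "img x = 0"
proof -
  \<comment> \<open>the realization is the grid with a single column\<close>
  let ?e = "\<lambda>p q. bil (fst p) (fst q)" and ?K = "\<lambda>f. numpow (\<lambda>i. f (i, 1))" and ?D = "\<lambda>f. num (\<lambda>i. f (i, 1))"
  interpret G: boson_grid h n 1 ?e ?K ?D
    unfolding boson_grid_def by (rule reindex) auto
  \<comment> \<open>With one column there is no other column to twist by.\<close>
  have u: "?K (twist i 1) = \<Phi> 1" for i
    unfolding numpow_0[symmetric] by (rule K_cong) (simp add: twist_def)
  have chev: "img x = 0" if "x \<in> chev_rels h n" for x
  proof (rule G.grid_chev_rels[OF img.falg_hom_axioms _ _ that])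
    show "img 1 = ?K (\<lambda>_. 0)" by (rule img_gen)
    fix g assume "g \<in> chev_gens n"
    then obtain i where "i \<in> {1..<n}" "g \<in> {H i, Yp i, Ym i} \<union> range (\<lambda>c. QH c i)"
      unfolding chev_gens_def by blast
    then show "img (gen g) = grid_gen 1 ?e ?K ?D g"
      using u[of i] by (auto simp: img_gen root_sum_def root_term_def wt_def bil_def mult[symmetric])
  qed
  \<comment> \<open>Bilinears preserve the total number of bosons: a constant exponent takes the
    same value at both ends.\<close>
  have c: "num (\<lambda>_. 1) * img (gen g) = img (gen g) * num (\<lambda>_. 1)"
    "numpow (\<lambda>_. c) * img (gen g) = img (gen g) * numpow (\<lambda>_. c)" if "g \<in> ext_gens n" for c g
    using that unfolding ext_gens_def chev_gens_def
    by (auto simp: img_gen D_D D_K K_K K_e D_e add.commute)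
  show ?thesis
    using assms unfolding ext_rels_def
    by (auto simp: chev img.comm img.diff img.mult img_gen c K_K numpow_0)
qed

end

section \<open>The two families on the grid\<close>

locale boson_lattice = bosons \<Phi> h "k1 * k2"
  for \<Phi> :: "boson falg \<Rightarrow> 'a::calg" and h :: complex and k1 k2 :: nat +
  assumes k1: "1 \<le> k1" and k2: "1 \<le> k2"
begin

abbreviation "grid_e \<equiv> \<lambda>p q. bil (cell k2 p) (cell k2 q)"
abbreviation "grid_K \<equiv> \<lambda>f. numpow (\<lambda>l. f (cell_inv k2 l))"
abbreviation "grid_D \<equiv> \<lambda>f. num (\<lambda>l. f (cell_inv k2 l))"

sublocale grid: boson_grid h k1 k2 grid_e grid_K grid_D
  unfolding boson_grid_def
  by (rule reindex) (use cell_range cell_inv_range in \<open>auto simp: cell_inv_cell\<close>)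

lemma n1: "1 \<le> k1 * k2"
  using k1 k2 by simp

lemma cells:
  assumes "\<mu> \<in> {1..<k1}" "\<nu> \<in> {1..k2}"
  shows "1 \<le> cell k2 (\<mu>, \<nu>)" "cell k2 (\<mu>, \<nu>) < cell k2 (Suc \<mu>, \<nu>)" "cell k2 (Suc \<mu>, \<nu>) \<le> k1 * k2"
  using assms cell_range[of "(\<mu>, \<nu>)" k1 k2] cell_range[of "(Suc \<mu>, \<nu>)" k1 k2] k2 by (auto simp: cell_Suc)

lemma cells':
  assumes "\<mu> \<in> {1..k1}" "\<nu> \<in> {1..<k2}"
  shows "1 \<le> cell k2 (\<mu>, \<nu>)" "cell k2 (\<mu>, \<nu>) < k1 * k2"
  using assms cell_range[of "(\<mu>, \<nu>)" k1 k2] cell_range[of "(\<mu>, Suc \<nu>)" k1 k2] by (auto simp: cell_Suc)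

lemma chev_form_rows:
  assumes \<mu>: "\<mu> \<in> {1..<k1}" and l: "l \<in> {1..k1 * k2}"
  shows "chev_form (k1 * k2) (\<lambda>l. \<Sum>\<nu>\<in>{1..k2}. g \<nu> * Hform (cell k2 (\<mu>, \<nu>)) (cell k2 (Suc \<mu>, \<nu>)) l) l
    = g (snd (cell_inv k2 l)) * wt \<mu> (cell_inv k2 l)"
proof -
  have "chev_form (k1 * k2) (\<lambda>l. \<Sum>\<nu>\<in>{1..k2}. g \<nu> * Hform (cell k2 (\<mu>, \<nu>)) (cell k2 (Suc \<mu>, \<nu>)) l) l
      = (\<Sum>\<nu>\<in>{1..k2}. g \<nu> * (of_bool (l = cell k2 (\<mu>, \<nu>)) - of_bool (l = cell k2 (Suc \<mu>, \<nu>))))"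
    unfolding chev_form_linear using cells[OF \<mu>] l
    by (intro sum.cong refl, subst chev_form_Hform) fastforce+
  then show ?thesis
    using sum_rows[OF l, of \<mu> g] \<mu> by simp
qed

lemma chev_form_columns:
  assumes s: "s \<in> {1..<k2}" and l: "l \<in> {1..k1 * k2}"
  shows "chev_form (k1 * k2) (\<lambda>l. \<Sum>\<sigma>\<in>{1..k1}. g \<sigma> * Hform (cell k2 (\<sigma>, s)) (cell k2 (\<sigma>, Suc s)) l) l
    = g (fst (cell_inv k2 l)) * wt s (prod.swap (cell_inv k2 l))"
proof -
  have "chev_form (k1 * k2) (\<lambda>l. \<Sum>\<sigma>\<in>{1..k1}. g \<sigma> * Hform (cell k2 (\<sigma>, s)) (cell k2 (\<sigma>, Suc s)) l) l
      = (\<Sum>\<sigma>\<in>{1..k1}. g \<sigma> * (of_bool (l = cell k2 (\<sigma>, s)) - of_bool (l = cell k2 (\<sigma>, Suc s))))"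
    unfolding chev_form_linear using cells'[OF _ s] l
    by (intro sum.cong refl, subst chev_form_Hform) (fastforce simp: cell_Suc)+
  then show ?thesis
    using sum_columns[OF l s, of g] by simp
qed

text \<open>Within one row the order of the indices is the order of the columns, so sign(\<nu> - t)
  compares columns. The omitted \<nu> = t may be restored, as its sign is 0.\<close>

lemma Xexp_form:
  assumes \<mu>: "\<mu> \<in> {1..<k1}" and s: "s \<in> {1..k2}" and l: "l \<in> {1..k1 * k2}"
  shows "chev_form (k1 * k2) (Xexp k2 \<mu> (cell k2 (Suc \<mu>, s))) l = twist \<mu> s (cell_inv k2 l)"
proof -
  let ?t = "cell k2 (Suc \<mu>, s)"
  have "Xexp k2 \<mu> ?t l = 1/2 * (\<Sum>\<nu>\<in>{1..k2}. sg \<nu> s * Hform (cell k2 (\<mu>, \<nu>)) (cell k2 (Suc \<mu>, \<nu>)) l)" for l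
  proof -
    have "Xexp k2 \<mu> ?t l = 1/2 * (\<Sum>\<nu>\<in>{(Suc \<mu> - 1)*k2+1..Suc \<mu> * k2}. sg \<nu> ?t * Hform (\<nu> - k2) \<nu> l)"
      unfolding Xexp_def by (intro arg_cong[where f = "\<lambda>x. 1/2 * x"] sum.mono_neutral_left) auto
    also have "\<dots> = 1/2 * (\<Sum>\<nu>\<in>{1..k2}. sg (cell k2 (Suc \<mu>, \<nu>)) ?t
        * Hform (cell k2 (Suc \<mu>, \<nu>) - k2) (cell k2 (Suc \<mu>, \<nu>)) l)"
      by (subst sum_block) simp_all
    also have "\<dots> = 1/2 * (\<Sum>\<nu>\<in>{1..k2}. sg \<nu> s * Hform (cell k2 (\<mu>, \<nu>)) (cell k2 (Suc \<mu>, \<nu>)) l)"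
      using \<mu> by (intro arg_cong[where f = "\<lambda>x. 1/2 * x"] sum.cong) (simp_all add: cell_Suc, simp_all add: sg_def cell_def)
    finally show ?thesis .
  qed
  then have "chev_form (k1 * k2) (Xexp k2 \<mu> ?t) l = chev_form (k1 * k2)
      (\<lambda>l. 1/2 * (\<Sum>\<nu>\<in>{1..k2}. sg \<nu> s * Hform (cell k2 (\<mu>, \<nu>)) (cell k2 (Suc \<mu>, \<nu>)) l)) l"
    by presburger
  then show ?thesis
    unfolding chev_form_linear(1) chev_form_rows[OF \<mu> l]
    by (cases "cell_inv k2 l") (simp add: twist_def)
qed

lemma Zexp_form:
  assumes \<mu>: "\<mu> \<in> {1..k1}" and s: "s \<in> {1..<k2}" and l: "l \<in> {1..k1 * k2}"
  shows "chev_form (k1 * k2) (Zexp k1 k2 s \<mu>) l = twist s \<mu> (prod.swap (cell_inv k2 l))"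
proof -
  have "Zexp k1 k2 s \<mu> l = 1/2 * (\<Sum>\<sigma>\<in>{1..k1}. sg \<sigma> \<mu> * Hform (cell k2 (\<sigma>, s)) (cell k2 (\<sigma>, Suc s)) l)" for l
    unfolding Zexp_def
    by (intro arg_cong[where f = "\<lambda>x. 1/2 * x"] sum.mono_neutral_cong_left) (auto simp: cell_def)
  then have "chev_form (k1 * k2) (Zexp k1 k2 s \<mu>) l = chev_form (k1 * k2)
      (\<lambda>l. 1/2 * (\<Sum>\<sigma>\<in>{1..k1}. sg \<sigma> \<mu> * Hform (cell k2 (\<sigma>, s)) (cell k2 (\<sigma>, Suc s)) l)) l"
    by presburger
  then show ?thesis
    unfolding chev_form_linear(1) chev_form_columns[OF s l]
    by (cases "cell_inv k2 l") (simp add: twist_def)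
qed

lemma img_Xfam:
  assumes g: "g \<in> chev_gens k1"
  shows "img (Xfam h k1 k2 g) = grid_gen k2 grid_e grid_K grid_D g"
proof -
  obtain \<mu> where \<mu>: "\<mu> \<in> {1..<k1}" and g: "g \<in> {H \<mu>, Yp \<mu>, Ym \<mu>} \<union> range (\<lambda>c. QH c \<mu>)"
    using g unfolding chev_gens_def by blast
  note c = cells[OF \<mu>]
  have minus: "cell k2 (Suc \<mu>, s) - k2 = cell k2 (\<mu>, s)" for s
    using \<mu> by (simp add: cell_Suc)
  have H: "img (Xfam h k1 k2 (H \<mu>)) = num (\<lambda>l. wt \<mu> (cell_inv k2 l))"
  proof -
    have "img (Xfam h k1 k2 (H \<mu>)) = (\<Sum>\<nu>\<in>{1..k2}. img (Hel (cell k2 (\<mu>, \<nu>)) (cell k2 (Suc \<mu>, \<nu>))))"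
      using \<mu> by (simp only: Xfam.simps img.sum) (subst sum_block, simp_all add: cell_Suc)
    also have "\<dots> = num (\<lambda>l. \<Sum>\<nu>\<in>{1..k2}. of_bool (l = cell k2 (\<mu>, \<nu>)) - of_bool (l = cell k2 (Suc \<mu>, \<nu>)))"
      using c by (simp add: num_linear(2) img_Hel)
    also have "\<dots> = num (\<lambda>l. wt \<mu> (cell_inv k2 l))"
      using sum_rows[of _ k1 k2 \<mu> "\<lambda>_. 1"] \<mu> by (intro num_cong) simp
    finally show ?thesis .
  qed
  have QH: "img (Xfam h k1 k2 (QH c \<mu>)) = numpow (\<lambda>l. c * wt \<mu> (cell_inv k2 l))" for c
  proof -
    have "(\<Sum>s\<in>{(\<mu>-1)*k2+1..\<mu>*k2}. Hform s (s + k2) l)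
        = (\<Sum>\<nu>\<in>{1..k2}. 1 * Hform (cell k2 (\<mu>, \<nu>)) (cell k2 (Suc \<mu>, \<nu>)) l)" for l
      using \<mu> by (subst sum_block) (simp_all add: cell_Suc)
    then show ?thesis
      using \<mu> by (simp only: Xfam.simps img_cartan_pow[OF n1])
         (intro K_cong, simp only: chev_form_linear(1) chev_form_rows, simp)
  qed
  have YY: "(if d then img (Xfam h k1 k2 (Yp \<mu>)) else img (Xfam h k1 k2 (Ym \<mu>)))
      = root_sum k2 grid_e grid_K d \<mu>" for d
  proof -
    let ?Y = "\<lambda>d t. if d then Ypl h (t - k2) t else Ymi h t (t - k2)"
    let ?L = "\<lambda>d t. cartan_pow (k1 * k2) (\<lambda>l. Xexp k2 \<mu> t l + sign d * Lam k1 k2 t l)"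
    have "(if d then img (Xfam h k1 k2 (Yp \<mu>)) else img (Xfam h k1 k2 (Ym \<mu>)))
        = (\<Sum>t\<in>{(Suc \<mu> - 1)*k2+1..Suc \<mu> * k2}. img (?Y d t * ?L d t))"
      by (simp add: img.sum)
    also have "\<dots> = (\<Sum>s\<in>{1..k2}. img (?Y d (cell k2 (Suc \<mu>, s)) * ?L d (cell k2 (Suc \<mu>, s))))"
      by (rule sum_block) simp
    also have "\<dots> = (\<Sum>s\<in>{1..k2}. root_term grid_e grid_K d \<mu> s)"
    proof (rule sum.cong[OF refl])
      fix s assume s: "s \<in> {1..k2}"
      let ?i = "cell k2 (\<mu>, s)" and ?t = "cell k2 (Suc \<mu>, s)"
      have k: "k2 < ?t"
        using s \<mu> by (cases \<mu>) (auto simp: cell_def)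
      have Y: "img (?Y d ?t) = (if d then bil ?i ?t else bil ?t ?i)
          * numpow (\<lambda>k. - sign d * of_bool (?i < k \<and> k < ?t))"
        using c[OF s] by (simp add: minus img_Ypl img_Ymi)
      \<comment> \<open>The power inherited from the Cartan-Weyl element and the one from \<Lambda>
        have opposite signs for either value of \<open>d\<close>; only the twist survives.\<close>
      have L: "numpow (\<lambda>k. - sign d * of_bool (?i < k \<and> k < ?t)) * img (?L d ?t)
          = numpow (\<lambda>l. twist \<mu> s (cell_inv k2 l))"
        unfolding img_cartan_pow[OF n1] K_K
        using \<mu> s k c(3)[OF s] k1 k2
        by (intro K_cong) (simp only: chev_form_linear Xexp_form chev_form_Lam minus, simp)
      show "img (?Y d ?t * ?L d ?t) = root_term grid_e grid_K d \<mu> s"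
        unfolding img.mult Y mult.assoc L root_term_def by simp
    qed
    finally show ?thesis by (simp only: root_sum_def)
  qed
  show ?thesis
    using g H QH YY[of True] YY[of False] by (auto simp del: Xfam.simps)
qed

lemma img_Zfam:
  assumes g: "g \<in> chev_gens k2"
  shows "img (Zfam h k1 k2 g)
    = grid_gen k1 (transpose_e grid_e) (transpose_K grid_K) (transpose_K grid_D) g"
proof -
  obtain s where s: "s \<in> {1..<k2}" and g: "g \<in> {H s, Yp s, Ym s} \<union> range (\<lambda>c. QH c s)"
    using g unfolding chev_gens_def by blast
  have cell: "(\<mu> - 1) * k2 + s = cell k2 (\<mu>, s)" "cell k2 (\<mu>, s) + 1 = cell k2 (\<mu>, Suc s)" for \<mu>
    by (simp_all add: cell_def)
  note c = cells'[OF _ s]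
  have H: "img (Zfam h k1 k2 (H s)) = num (\<lambda>l. wt s (prod.swap (cell_inv k2 l)))"
  proof -
    have "img (Zfam h k1 k2 (H s)) = (\<Sum>\<mu>\<in>{1..k1}. img (Hel (cell k2 (\<mu>, s)) (cell k2 (\<mu>, Suc s))))"
      by (simp only: Zfam.simps img.sum cell)
    also have "\<dots> = num (\<lambda>l. \<Sum>\<mu>\<in>{1..k1}. of_bool (l = cell k2 (\<mu>, s)) - of_bool (l = cell k2 (\<mu>, Suc s)))"
      using c by (simp add: num_linear(2) img_Hel cell_Suc Suc_le_eq)
    also have "\<dots> = num (\<lambda>l. wt s (prod.swap (cell_inv k2 l)))"
      using sum_columns[of _ k1 k2 s "\<lambda>_. 1"] s by (intro num_cong) simp
    finally show ?thesis .
  qed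
  have QH: "img (Zfam h k1 k2 (QH c s)) = numpow (\<lambda>l. c * wt s (prod.swap (cell_inv k2 l)))" for c
  proof -
    have "(\<Sum>\<mu>\<in>{1..k1}. Hform ((\<mu>-1)*k2 + s) ((\<mu>-1)*k2 + s + 1) l)
        = (\<Sum>\<mu>\<in>{1..k1}. 1 * Hform (cell k2 (\<mu>, s)) (cell k2 (\<mu>, Suc s)) l)" for l
      by (simp only: cell mult_1)
    then show ?thesis
      using s by (simp only: Zfam.simps img_cartan_pow[OF n1])
         (intro K_cong, simp only: chev_form_linear(1) chev_form_columns, simp)
  qed
  have YY: "(if d then img (Zfam h k1 k2 (Yp s)) else img (Zfam h k1 k2 (Ym s)))
      = root_sum k1 (transpose_e grid_e) (transpose_K grid_K) d s" for d
  proof -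
    have L: "img (cartan_pow (k1 * k2) (Zexp k1 k2 s \<mu>)) = numpow (\<lambda>l. twist s \<mu> (prod.swap (cell_inv k2 l)))"
      if "\<mu> \<in> {1..k1}" for \<mu>
      unfolding img_cartan_pow[OF n1] using that s by (intro K_cong Zexp_form)
    show ?thesis
      using L by (cases d)
        (simp_all add: root_sum_def root_term_def img.sum img.mult img_gen cell_def)
  qed
  show ?thesis
    using g H QH YY[of True] YY[of False] by (auto simp del: Zfam.simps)
qed

end

section \<open>The embedding\<close>

lemma boson_gens_mem:
  "Ap i \<in> boson_gens n \<longleftrightarrow> 1 \<le> i \<and> i \<le> n" "Am i \<in> boson_gens n \<longleftrightarrow> 1 \<le> i \<and> i \<le> n"
  "Nb i \<in> boson_gens n \<longleftrightarrow> 1 \<le> i \<and> i \<le> n" "QNb c i \<in> boson_gens n \<longleftrightarrow> 1 \<le> i \<and> i \<le> n"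
  by (auto simp: boson_gens_def image_iff)

lemma boson_rels_fcarrier: "boson_rels h n \<subseteq> fcarrier (boson_gens n)"
proof -
  note [intro!] = fcarrier_closed(2-7) fcarrier_closed' fcarrier_closed(1)[THEN iffD2]
  show ?thesis
    unfolding boson_rels_def
    by (intro UN_least Un_least insert_subsetI) (auto simp: boson_gens_mem)
qed

lemma relators_boson: "relators (boson_gens n) (boson_rels h n)"
  by unfold_locales (rule boson_rels_fcarrier)

lemma boson_img_fcarrier:
  assumes "g \<in> ext_gens n"
  shows "boson_img n g \<in> fcarrier (boson_gens n)"
  using assms
  by (cases g) (auto simp: ext_gens_mem boson_gens_mem fcarrier_closed(1)
      intro!: fcarrier_closed(2-7) fcarrier_closed' sum_fcarrier prod_list_fcarrier)

lemma cartan_pow_fcarrier: "cartan_pow n f \<in> fcarrier (ext_gens n)"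
  unfolding cartan_pow_def
  by (auto simp: ext_gens_mem fcarrier_closed(1) intro!: fcarrier_closed(7) prod_list_fcarrier)

lemma Hel_fcarrier: "1 \<le> i \<Longrightarrow> j \<le> n \<Longrightarrow> i \<le> j \<Longrightarrow> Hel i j \<in> fcarrier (ext_gens n)"
  unfolding Hel_def
  by (auto simp: ext_gens_mem fcarrier_closed(1) intro!: fcarrier_closed' sum_fcarrier)

lemma Xfam_fcarrier:
  assumes "g \<in> chev_gens k1"
  shows "Xfam h k1 k2 g \<in> fcarrier (ext_gens (k1 * k2))"
proof -
  obtain \<mu> where \<mu>: "\<mu> \<in> {1..<k1}" and g: "g \<in> {H \<mu>, Yp \<mu>, Ym \<mu>} \<union> range (\<lambda>c. QH c \<mu>)"
    using assms unfolding chev_gens_def by blast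
  have "(\<mu> + 1) * k2 \<le> k1 * k2"
    using \<mu> by (intro mult_le_mono1) simp
  moreover have "1 \<le> t - k2" if "\<mu> * k2 + 1 \<le> t" for t
    using that \<mu> by (cases \<mu>) auto
  ultimately have "(\<mu> + 1) * k2 \<le> k1 * k2" "\<And>t. \<mu> * k2 + 1 \<le> t \<Longrightarrow> 1 \<le> t - k2"
    by blast+
  then show ?thesis
    using g by (auto intro!: sum_fcarrier Hel_fcarrier cartan_pow_fcarrier fcarrier_closed(3,7)
        Ypl_fcarrier Ymi_fcarrier)
qed

lemma Zfam_fcarrier:
  assumes "g \<in> chev_gens k2"
  shows "Zfam h k1 k2 g \<in> fcarrier (ext_gens (k1 * k2))"
proof -
  obtain s where s: "s \<in> {1..<k2}" and g: "g \<in> {H s, Yp s, Ym s} \<union> range (\<lambda>c. QH c s)"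
    using assms unfolding chev_gens_def by blast
  have "(\<mu> - 1) * k2 + s < k1 * k2" if "\<mu> \<in> {1..k1}" for \<mu>
    using cell_range[of "(\<mu>, Suc s)" k1 k2] that s by (auto simp: cell_def)
  then show ?thesis
    using g s by (fastforce simp: fcarrier_closed(1) ext_gens_mem
        intro!: sum_fcarrier Hel_fcarrier cartan_pow_fcarrier fcarrier_closed(7))
qed

lemma chev_rels_fcarrier:
  assumes "r \<in> chev_rels h m" and U: "\<And>g. g \<in> chev_gens m \<Longrightarrow> U g \<in> fcarrier S"
    and "U NT = 0" "\<And>c. U (QN c) = 0"
  shows "fext U r \<in> fcarrier S"
proof (rule fext_fcarrier)
  show "r \<in> fcarrier (ext_gens m)"
    using assms(1) by (intro subsetD[OF ext_rels_fcarrier[of h m]]) (simp add: ext_rels_def)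
  show "U g \<in> fcarrier S" if "g \<in> ext_gens m" for g
    using that assms(2-) by (auto simp: ext_gens_def fcarrier_closed(3))
qed

theorem proposition2:
  fixes q h :: complex and k1 k2 :: nat
  assumes "q \<noteq> 0" and "q\<^sup>2 \<noteq> 1" and "exp h = q"
    and "2 \<le> k2" and "k2 \<le> k1"
  defines "n \<equiv> k1 * k2"
  defines "X \<equiv> \<lambda>g. ext_class h n (Xfam h k1 k2 g)"
    and "Z \<equiv> \<lambda>g. ext_class h n (Zfam h k1 k2 g)"
    and "\<rho> \<equiv> realization h n"
    and "B \<equiv> boson_alg h n"
  shows "\<rho> \<in> ring_hom (ext_alg h n) B
    \<and> (\<forall>g\<in>chev_gens k1. X g \<in> carrier (ext_alg h n))
    \<and> (\<forall>g\<in>chev_gens k2. Z g \<in> carrier (ext_alg h n))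
    \<and> (\<forall>r\<in>chev_rels h k1. \<rho> (ext_class h n (fext (Xfam h k1 k2) r)) = \<zero>\<^bsub>B\<^esub>)
    \<and> (\<forall>r\<in>chev_rels h k2. \<rho> (ext_class h n (fext (Zfam h k1 k2) r)) = \<zero>\<^bsub>B\<^esub>)
    \<and> (\<forall>g\<in>chev_gens k1. \<forall>g'\<in>chev_gens k2. \<rho> (X g) \<otimes>\<^bsub>B\<^esub> \<rho> (Z g') = \<rho> (Z g') \<otimes>\<^bsub>B\<^esub> \<rho> (X g))"
proof -
  interpret B: relators "boson_gens n" "boson_rels h n"
    by (rule relators_boson)
  interpret E: relators "ext_gens n" "ext_rels h n"
    by (rule relators_ext)
  have "qp h 1 = q" "qp h (- 1) = 1 / q"
    using assms(3) by (simp_all add: qp_def exp_minus field_simps)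
  then have q: "qp h 1 \<noteq> qp h (- 1)"
    using assms(1,2) by (auto simp: field_simps power2_eq_square)
  interpret L: boson_lattice B.quot h k1 k2
  proof (intro boson_lattice.intro bosons.intro bosons_axioms.intro boson_lattice_axioms.intro)
    show "falg_hom B.quot" by (rule B.quot_hom)
    show "B.quot x = 0" if "x \<in> boson_rels h (k1 * k2)" for x
      using B.quot_eq_0_iff[OF subsetD[OF boson_rels_fcarrier]] B.rel that by (simp add: n_def)
  qed (use q assms(4,5) in auto)
  define \<psi> where "\<psi> = fext (boson_img n)"
  have \<psi>: "\<psi> x \<in> fcarrier (boson_gens n)" if "x \<in> fcarrier (ext_gens n)" for x
    unfolding \<psi>_def using that boson_img_fcarrier by (rule fext_fcarrier)
  have \<psi>_1: "\<psi> 1 = 1"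
    by (simp add: \<psi>_def)
  \<comment> \<open>Representatives of one coset thus have congruent images, which collapses the
    union in \<open>realization\<close>.\<close>
  have \<psi>_J: "\<psi> x \<in> B.J" if "x \<in> E.J" for x
    unfolding \<psi>_def
  proof (rule B.fext_ideal[OF ext_rels_fcarrier boson_img_fcarrier _ that])
    fix r assume r: "r \<in> ext_rels h n"
    then have "B.quot (\<psi> r) = 0"
      using L.img_ext_rels by (simp add: \<psi>_def n_def)
    then show "fext (boson_img n) r \<in> B.J"
      using B.quot_eq_0_iff[OF \<psi>] r ext_rels_fcarrier by (auto simp: \<psi>_def)
  qed
  have \<rho>: "\<rho> (ext_class h n x) = boson_class h n (\<psi> x)" if x: "x \<in> fcarrier (ext_gens n)" for x
  proof -
    have const: "boson_class h n (\<psi> y) = boson_class h n (\<psi> x)" if "y \<in> fcarrier (ext_gens n)" "y - x \<in> E.J" for y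
      unfolding boson_class_def using \<psi>_J[OF that(2)] \<psi>[OF x]
      by (intro B.pclass_eq) (simp_all add: \<psi>_def fext_diff)
    have members: "ext_class h n x = {y \<in> fcarrier (ext_gens n). y - x \<in> E.J}"
      unfolding ext_class_def using x by (rule E.pclass_members)
    show ?thesis
      unfolding \<rho>_def realization_def \<psi>_def[symmetric] members
    proof (intro equalityI UN_least)
      show "boson_class h n (\<psi> y) \<subseteq> boson_class h n (\<psi> x)"
        if "y \<in> {y \<in> fcarrier (ext_gens n). y - x \<in> E.J}" for y
        using const that by simp
      show "boson_class h n (\<psi> x) \<subseteq> (\<Union>y\<in>{y \<in> fcarrier (ext_gens n). y - x \<in> E.J}. boson_class h n (\<psi> y))"
        by (rule UN_upper[of x]) (simp add: x E.J_0)
    qed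
  qed
  have hom: "\<rho> \<in> ring_hom (ext_alg h n) B"
  proof (rule ring_hom_memI)
    fix x assume "x \<in> carrier (ext_alg h n)"
    then obtain a where a: "a \<in> fcarrier (ext_gens n)" "x = ext_class h n a"
      by (auto simp: ext_alg_def ext_class_def presented_simps)
    then show "\<rho> x \<in> carrier B"
      using \<rho> \<psi> by (simp add: B_def boson_alg_def boson_class_def presented_simps)
    fix y assume "y \<in> carrier (ext_alg h n)"
    then obtain b where b: "b \<in> fcarrier (ext_gens n)" "y = ext_class h n b"
      by (auto simp: ext_alg_def ext_class_def presented_simps)
    have "x \<otimes>\<^bsub>ext_alg h n\<^esub> y = ext_class h n (a * b)" "x \<oplus>\<^bsub>ext_alg h n\<^esub> y = ext_class h n (a + b)"
      using a b by (simp_all add: ext_alg_def ext_class_def E.pclass_mult E.pclass_add)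
    then show "\<rho> (x \<otimes>\<^bsub>ext_alg h n\<^esub> y) = \<rho> x \<otimes>\<^bsub>B\<^esub> \<rho> y" "\<rho> (x \<oplus>\<^bsub>ext_alg h n\<^esub> y) = \<rho> x \<oplus>\<^bsub>B\<^esub> \<rho> y"
      using a b \<psi> fcarrier_closed(5,7)[OF a(1) b(1)]
      by (simp_all add: \<rho> B_def boson_alg_def boson_class_def B.pclass_mult B.pclass_add)
         (simp_all add: \<psi>_def fext_add fext_mult)
  next
    have "\<one>\<^bsub>ext_alg h n\<^esub> = ext_class h n 1"
      by (simp add: ext_alg_def ext_class_def presented_simps)
    then show "\<rho> \<one>\<^bsub>ext_alg h n\<^esub> = \<one>\<^bsub>B\<^esub>"
      by (simp add: \<rho> fcarrier_closed(4) B_def boson_alg_def boson_class_def presented_simps \<psi>_def)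
  qed
  have zero: "\<rho> (ext_class h n x) = \<zero>\<^bsub>B\<^esub>" if x: "x \<in> fcarrier (ext_gens n)" and "B.quot (\<psi> x) = 0" for x
    using that B.quot_eq_0_iff[OF \<psi>[OF x]]
    by (simp add: \<rho> B_def boson_alg_def boson_class_def B.pclass_zero)
  \<comment> \<open>Common to both families: substituting the family and then realizing is one
    homomorphism out of the free algebra, whose values on generators are those of a grid.\<close>
  have rel: "\<rho> (ext_class h n (fext U r)) = \<zero>\<^bsub>B\<^esub>"
    if "boson_grid h m k e K D" and U: "\<And>g. g \<in> chev_gens m \<Longrightarrow> B.quot (\<psi> (U g)) = grid_gen k e K D g"
      and U': "\<And>g. g \<in> chev_gens m \<Longrightarrow> U g \<in> fcarrier (ext_gens n)" "U NT = 0" "\<And>c. U (QN c) = 0"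
      and K: "K (\<lambda>_. 0) = B.quot 1" and r: "r \<in> chev_rels h m" for U m k e K D r
  proof (rule zero)
    interpret G: boson_grid h m k e K D by fact
    show "fext U r \<in> fcarrier (ext_gens n)"
      using r U' by (rule chev_rels_fcarrier)
    show "B.quot (\<psi> (fext U r)) = 0"
    proof (rule G.grid_chev_rels[OF _ _ _ r])
      show "falg_hom (\<lambda>x. B.quot (\<psi> (fext U x)))"
        unfolding \<psi>_def n_def[symmetric] using L.img.fext_hom by (simp add: n_def)
    qed (simp_all add: fext_gen U K \<psi>_1)
  qed
  have XZ: "\<rho> (X g) \<otimes>\<^bsub>B\<^esub> \<rho> (Z g') = \<rho> (Z g') \<otimes>\<^bsub>B\<^esub> \<rho> (X g)"
    if g: "g \<in> chev_gens k1" and g': "g' \<in> chev_gens k2" for g g'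
  proof -
    let ?x = "\<psi> (Xfam h k1 k2 g)" and ?z = "\<psi> (Zfam h k1 k2 g')"
    have x: "Xfam h k1 k2 g \<in> fcarrier (ext_gens n)" "Zfam h k1 k2 g' \<in> fcarrier (ext_gens n)"
      unfolding n_def using g g' by (simp_all add: Xfam_fcarrier Zfam_fcarrier)
    have "B.quot (comm ?x ?z) = 0"
      unfolding L.comm using L.grid.grid_gen_commute[OF g g'] L.img_Xfam[OF g] L.img_Zfam[OF g']
      by (simp add: \<psi>_def n_def)
    then have "?x * ?z - ?z * ?x \<in> B.J"
      using x \<psi> by (simp add: B.quot_eq_0_iff fcarrier_closed' comm_def[symmetric])
    then show ?thesis
      using x \<psi> by (simp add: X_def Z_def \<rho> B_def boson_alg_def boson_class_def B.pclass_mult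
          B.pclass_eq_iff fcarrier_closed(7))
  qed
  have XZ_carrier: "X g \<in> carrier (ext_alg h n)" "Z g' \<in> carrier (ext_alg h n)"
    if "g \<in> chev_gens k1" "g' \<in> chev_gens k2" for g g'
    using that Xfam_fcarrier Zfam_fcarrier
    by (auto simp: X_def Z_def n_def ext_alg_def ext_class_def presented_simps)
  \<comment> \<open>\<open>XZ_carrier\<close> speaks of a pair; a generator on either side lets each
    half be used alone.\<close>
  have ne: "H 1 \<in> chev_gens k1" "H 1 \<in> chev_gens k2"
    using assms(4,5) by (auto simp: chev_gens_def)
  have X_rel: "\<rho> (ext_class h n (fext (Xfam h k1 k2) r)) = \<zero>\<^bsub>B\<^esub>" if "r \<in> chev_rels h k1" for r
    using that L.img_Xfam Xfam_fcarrier
    by (intro rel[OF L.grid.boson_grid_axioms]) (rule L.numpow_0 | simp add: \<psi>_def n_def)+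
  have Z_rel: "\<rho> (ext_class h n (fext (Zfam h k1 k2) r)) = \<zero>\<^bsub>B\<^esub>" if "r \<in> chev_rels h k2" for r
    using that L.img_Zfam Zfam_fcarrier
    by (intro rel[OF L.grid.transpose]) (rule L.numpow_0 | simp add: \<psi>_def n_def)+
  show ?thesis
    using hom XZ_carrier ne X_rel Z_rel XZ by blast
qed

end
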